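(* Let $k$ be a field and $S$ an inverse semigroup. Then the finite dimensional simple $kS$-modules are precisely (up to isomorphism) those of the form $\mathrm{Ind}_e(N)$, where $e$ is a finite index idempotent of $\mathcal{L}(S)$ and $N$ is a finite dimensional simple $kG_e$-module.
   Context: $kS$ is the semigroup algebra. Modules are left modules; for a ring $A$ (not necessarily unital), $A$-modules $M$ are assumed unitary ($AM=M$), and a simple $A$-module is an $A$-module $M$ with $AM\ne 0$ and no non-zero proper submodules. Homomorphisms of inverse semigroups with zero are not assumed to preserve zero, and a zero of $S$ is not assumed to act as zero. For $A\subseteq S$, $A^{\uparrow}=\{s\in S: a\le s\text{ for some }a\in A\}$ (natural partial order); $A$ is closed if $A=A^{\uparrow}$, and directed if it is non-empty and any $a,b\in A$ have a lower bound $c\le a,b$ in $A$. $\mathcal{L}(S)$ is the inverse semigroup of all closed directed subsets of $S$ with product $A\otimes B=(AB)^{\uparrow}$ and inverse $A^{-1}=\{a^{-1}:a\in A\}$. Its idempotents are the closed directed inverse subsemigroups of $S$. The map $\iota:S\to\mathcal{L}(S)$, $s\mapsto s^{\uparrow}$, is an embedding. Let $e$ be an idempotent of $\mathcal{L}(S)$. It has finite index if the $\mathcal{D}$-class of $e$ in $\mathcal{L}(S)$ contains only finitely many idempotents. $G_e$ is the maximal subgroup (the $\mathcal{H}$-class) of $\mathcal{L}(S)$ at $e$. (If $e=H$ as a closed directed inverse subsemigroup of $S$ and $F=E(H)$ is its set of idempotents, then $G_e\cong \overline{F}/\sigma$, where $\overline{F}=\{s\in S: s^{-1}Fs\subseteq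 F,\ sFs^{-1}\subseteq F\}$ and $\sigma$ is the minimum group congruence on $\overline{F}$.) $L_e=\{A\in\mathcal{L}(S):A^{-1}\otimes A=e\}$ is the $\mathcal{L}$-class of $e$. The vector space $kL_e$ with basis $L_e$ is a right $kG_e$-module via right multiplication in $\mathcal{L}(S)$, and a left $k\mathcal{L}(S)$-module via the left Schützenberger action: $B\in\mathcal{L}(S)$ sends a basis element $A\in L_e$ to $B\otimes A$ if $B\otimes A\in L_e$ and to $0$ otherwise. For a $kG_e$-module $N$, $\mathrm{Ind}_e(N)=kL_e\otimes_{kG_e}N$, regarded as a $kS$-module via $\iota$. *)

theory Defs
  imports "Jordan_Normal_Form.Missing_VectorSpace" "HOL-Algebra.AbelCoset"
begin

section \<open>Inverse semigroups\<close>

text \<open>Semigroups are carried by HOL-Algebra's monoid records; the field \<open>one\<close> plays no role for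
  them and is only meaningful for the maximal subgroups below.\<close>

locale inverse_semigroup =
  fixes S :: "('s, 'm) monoid_scheme" (structure)
  assumes mult_closed: "\<lbrakk>a \<in> carrier S; b \<in> carrier S\<rbrakk> \<Longrightarrow> a \<otimes> b \<in> carrier S"
    and mult_assoc: "\<lbrakk>a \<in> carrier S; b \<in> carrier S; c \<in> carrier S\<rbrakk>
      \<Longrightarrow> (a \<otimes> b) \<otimes> c = a \<otimes> (b \<otimes> c)"
    and unique_inverse: "a \<in> carrier S
      \<Longrightarrow> \<exists>!b. b \<in> carrier S \<and> a \<otimes> b \<otimes> a = a \<and> b \<otimes> a \<otimes> b = b"

text \<open>The library's \<open>m_inv\<close> is the group-theoretic inverse and does not apply here.\<close>

definition sinv :: "('s, 'm) monoid_scheme \<Rightarrow> 's \<Rightarrow> 's" where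
  "sinv S a = (THE b. b \<in> carrier S \<and> a \<otimes>\<^bsub>S\<^esub> b \<otimes>\<^bsub>S\<^esub> a = a \<and> b \<otimes>\<^bsub>S\<^esub> a \<otimes>\<^bsub>S\<^esub> b = b)"

definition idems :: "('s, 'm) monoid_scheme \<Rightarrow> 's set" where
  "idems S = {e \<in> carrier S. e \<otimes>\<^bsub>S\<^esub> e = e}"

definition nat_le :: "('s, 'm) monoid_scheme \<Rightarrow> 's \<Rightarrow> 's \<Rightarrow> bool" where
  "nat_le S a b \<longleftrightarrow> a \<in> carrier S \<and> b \<in> carrier S \<and> (\<exists>e \<in> idems S. a = e \<otimes>\<^bsub>S\<^esub> b)"

definition up_closure :: "('s, 'm) monoid_scheme \<Rightarrow> 's set \<Rightarrow> 's set" where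
  "up_closure S A = {s \<in> carrier S. \<exists>a \<in> A. nat_le S a s}"

definition closed_directed :: "('s, 'm) monoid_scheme \<Rightarrow> 's set \<Rightarrow> bool" where
  "closed_directed S A \<longleftrightarrow> A \<subseteq> carrier S \<and> A = up_closure S A \<and>
     A \<noteq> {} \<and> (\<forall>a \<in> A. \<forall>b \<in> A. \<exists>c \<in> A. nat_le S c a \<and> nat_le S c b)"

definition cd_semigroup :: "('s, 'm) monoid_scheme \<Rightarrow> 's set monoid" where
  "cd_semigroup S =
     \<lparr>carrier = {A. closed_directed S A},
      mult = (\<lambda>A B. up_closure S (A <#>\<^bsub>S\<^esub> B)),
      one = undefined\<rparr>"

definition iota :: "('s, 'm) monoid_scheme \<Rightarrow> 's \<Rightarrow> 's set" where
  "iota S s = up_closure S {s}"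


subsection \<open>Green's relations\<close>

definition left_ideal1 :: "('s, 'm) monoid_scheme \<Rightarrow> 's \<Rightarrow> 's set" where
  "left_ideal1 T a = insert a {t \<otimes>\<^bsub>T\<^esub> a | t. t \<in> carrier T}"

definition right_ideal1 :: "('s, 'm) monoid_scheme \<Rightarrow> 's \<Rightarrow> 's set" where
  "right_ideal1 T a = insert a {a \<otimes>\<^bsub>T\<^esub> t | t. t \<in> carrier T}"

definition green_L :: "('s, 'm) monoid_scheme \<Rightarrow> 's \<Rightarrow> 's \<Rightarrow> bool" where
  "green_L T a b \<longleftrightarrow> a \<in> carrier T \<and> b \<in> carrier T \<and> left_ideal1 T a = left_ideal1 T b"

definition green_R :: "('s, 'm) monoid_scheme \<Rightarrow> 's \<Rightarrow> 's \<Rightarrow> bool" where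
  "green_R T a b \<longleftrightarrow> a \<in> carrier T \<and> b \<in> carrier T \<and> right_ideal1 T a = right_ideal1 T b"

definition green_H :: "('s, 'm) monoid_scheme \<Rightarrow> 's \<Rightarrow> 's \<Rightarrow> bool" where
  "green_H T a b \<longleftrightarrow> green_L T a b \<and> green_R T a b"

definition green_D :: "('s, 'm) monoid_scheme \<Rightarrow> 's \<Rightarrow> 's \<Rightarrow> bool" where
  "green_D T a b \<longleftrightarrow> (\<exists>c. green_L T a c \<and> green_R T c b)"

definition finite_index :: "('s, 'm) monoid_scheme \<Rightarrow> 's set \<Rightarrow> bool" where
  "finite_index S e \<longleftrightarrow> finite {f \<in> idems (cd_semigroup S). green_D (cd_semigroup S) e f}"

definition max_subgroup :: "('s, 'm) monoid_scheme \<Rightarrow> 's set \<Rightarrow> 's set monoid" where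
  "max_subgroup S e =
     \<lparr>carrier = {A \<in> carrier (cd_semigroup S). green_H (cd_semigroup S) A e},
      mult = mult (cd_semigroup S),
      one = e\<rparr>"

definition L_class :: "('s, 'm) monoid_scheme \<Rightarrow> 's set \<Rightarrow> 's set set" where
  "L_class S e = {A \<in> carrier (cd_semigroup S). (sinv S ` A) \<otimes>\<^bsub>cd_semigroup S\<^esub> A = e}"


section \<open>Free vector spaces and semigroup algebras\<close>

definition supp :: "('k, 'c) ring_scheme \<Rightarrow> ('b \<Rightarrow> 'k) \<Rightarrow> 'b set" where
  "supp K f = {x. f x \<noteq> \<zero>\<^bsub>K\<^esub>}"

definition basis_vec :: "('k, 'c) ring_scheme \<Rightarrow> 'b \<Rightarrow> 'b \<Rightarrow> 'k" where
  "basis_vec K b = (\<lambda>x. if x = b then \<one>\<^bsub>K\<^esub> else \<zero>\<^bsub>K\<^esub>)"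

text \<open>The vector space with basis \<open>B\<close>: finitely supported functions vanishing outside \<open>B\<close>.\<close>

definition free_space :: "('k, 'c) ring_scheme \<Rightarrow> 'b set \<Rightarrow> ('k, 'b \<Rightarrow> 'k) module" where
  "free_space K B =
     \<lparr>carrier = {f. range f \<subseteq> carrier K \<and> finite (supp K f) \<and> supp K f \<subseteq> B},
      mult = undefined, one = undefined,
      zero = (\<lambda>x. \<zero>\<^bsub>K\<^esub>),
      add = (\<lambda>f g x. f x \<oplus>\<^bsub>K\<^esub> g x),
      smult = (\<lambda>c f x. c \<otimes>\<^bsub>K\<^esub> f x)\<rparr>"

text \<open>(Bi)linear extensions of maps that are given on basis elements and take values in a
  free vector space.\<close>

definition lin_ext :: "('k, 'c) ring_scheme \<Rightarrow> ('a \<Rightarrow> 'b \<Rightarrow> 'k) \<Rightarrow> ('a \<Rightarrow> 'k) \<Rightarrow> 'b \<Rightarrow> 'k" where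
  "lin_ext K m f = (\<lambda>u. \<Oplus>\<^bsub>K\<^esub>s\<in>supp K f. f s \<otimes>\<^bsub>K\<^esub> m s u)"

definition bilin_ext ::
  "('k, 'c) ring_scheme \<Rightarrow> ('a \<Rightarrow> 'b \<Rightarrow> 'd \<Rightarrow> 'k) \<Rightarrow> ('a \<Rightarrow> 'k) \<Rightarrow> ('b \<Rightarrow> 'k) \<Rightarrow> 'd \<Rightarrow> 'k" where
  "bilin_ext K m f g =
     (\<lambda>u. \<Oplus>\<^bsub>K\<^esub>s\<in>supp K f. \<Oplus>\<^bsub>K\<^esub>t\<in>supp K g. f s \<otimes>\<^bsub>K\<^esub> g t \<otimes>\<^bsub>K\<^esub> m s t u)"

text \<open>The field \<open>one\<close> is junk unless \<open>S\<close> is a monoid with unit \<open>\<one>\<^bsub>S\<^esub>\<close>.\<close>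

definition semigroup_algebra ::
  "('k, 'c) ring_scheme \<Rightarrow> ('s, 'm) monoid_scheme \<Rightarrow> ('k, 's \<Rightarrow> 'k) module" where
  "semigroup_algebra K S =
     (free_space K (carrier S))
       \<lparr>mult := bilin_ext K (\<lambda>s t. basis_vec K (s \<otimes>\<^bsub>S\<^esub> t)),
        one := basis_vec K \<one>\<^bsub>S\<^esub>\<rparr>"


section \<open>Unitary modules over possibly non-unital algebras\<close>

text \<open>The record extends a vector space over the ground field by a left action of an algebra.\<close>

record ('k, 'a, 'v) amodule = "('k, 'v) module" +
  act :: "'a \<Rightarrow> 'v \<Rightarrow> 'v"  (infixl \<open>\<rhd>\<index>\<close> 70)

definition with_act ::
  "('k, 'v, 'd) module_scheme \<Rightarrow> ('a \<Rightarrow> 'v \<Rightarrow> 'v) \<Rightarrow> ('k, 'a, 'v) amodule" where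
  "with_act V h =
     \<lparr>carrier = carrier V, mult = mult V, one = one V, zero = zero V, add = add V,
      smult = smult V, act = h\<rparr>"

text \<open>The subspace \<open>AM\<close>. The span over \<open>K\<close> agrees with the additive span of the products, as
  \<open>c(am) = (ca)m\<close>.\<close>

definition acted_part ::
  "('k, 'c) ring_scheme \<Rightarrow> ('k, 'a, 'd) module_scheme \<Rightarrow> ('k, 'a, 'v, 'e) amodule_scheme \<Rightarrow> 'v set"
  where
  "acted_part K A M = module.span K M {a \<rhd>\<^bsub>M\<^esub> v | a v. a \<in> carrier A \<and> v \<in> carrier M}"

locale alg_module = vectorspace K M
  for K :: "('k, 'c) ring_scheme"
    and A :: "('k, 'a, 'd) module_scheme"
    and M :: "('k, 'a, 'v, 'e) amodule_scheme" +
  assumes act_closed: "\<lbrakk>a \<in> carrier A; v \<in> carrier M\<rbrakk> \<Longrightarrow> a \<rhd>\<^bsub>M\<^esub> v \<in> carrier M"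
    and act_add_left: "\<lbrakk>a \<in> carrier A; b \<in> carrier A; v \<in> carrier M\<rbrakk>
      \<Longrightarrow> (a \<oplus>\<^bsub>A\<^esub> b) \<rhd>\<^bsub>M\<^esub> v = a \<rhd>\<^bsub>M\<^esub> v \<oplus>\<^bsub>M\<^esub> b \<rhd>\<^bsub>M\<^esub> v"
    and act_add_right: "\<lbrakk>a \<in> carrier A; v \<in> carrier M; w \<in> carrier M\<rbrakk>
      \<Longrightarrow> a \<rhd>\<^bsub>M\<^esub> (v \<oplus>\<^bsub>M\<^esub> w) = a \<rhd>\<^bsub>M\<^esub> v \<oplus>\<^bsub>M\<^esub> a \<rhd>\<^bsub>M\<^esub> w"
    and act_smult_left: "\<lbrakk>c \<in> carrier K; a \<in> carrier A; v \<in> carrier M\<rbrakk>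
      \<Longrightarrow> (c \<odot>\<^bsub>A\<^esub> a) \<rhd>\<^bsub>M\<^esub> v = c \<odot>\<^bsub>M\<^esub> (a \<rhd>\<^bsub>M\<^esub> v)"
    and act_smult_right: "\<lbrakk>c \<in> carrier K; a \<in> carrier A; v \<in> carrier M\<rbrakk>
      \<Longrightarrow> a \<rhd>\<^bsub>M\<^esub> (c \<odot>\<^bsub>M\<^esub> v) = c \<odot>\<^bsub>M\<^esub> (a \<rhd>\<^bsub>M\<^esub> v)"
    and act_mult: "\<lbrakk>a \<in> carrier A; b \<in> carrier A; v \<in> carrier M\<rbrakk>
      \<Longrightarrow> (a \<otimes>\<^bsub>A\<^esub> b) \<rhd>\<^bsub>M\<^esub> v = a \<rhd>\<^bsub>M\<^esub> (b \<rhd>\<^bsub>M\<^esub> v)"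
    and unitary: "acted_part K A M = carrier M"

definition alg_submodule ::
  "('k, 'c) ring_scheme \<Rightarrow> ('k, 'a, 'd) module_scheme \<Rightarrow> 'v set \<Rightarrow>
   ('k, 'a, 'v, 'e) amodule_scheme \<Rightarrow> bool" where
  "alg_submodule K A W M \<longleftrightarrow>
     subspace K W M \<and> (\<forall>a \<in> carrier A. \<forall>w \<in> W. a \<rhd>\<^bsub>M\<^esub> w \<in> W)"

definition simple_alg_module ::
  "('k, 'c) ring_scheme \<Rightarrow> ('k, 'a, 'd) module_scheme \<Rightarrow> ('k, 'a, 'v, 'e) amodule_scheme \<Rightarrow> bool"
  where
  "simple_alg_module K A M \<longleftrightarrow>
     alg_module K A M \<and> acted_part K A M \<noteq> {\<zero>\<^bsub>M\<^esub>} \<and>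
     (\<forall>W. alg_submodule K A W M \<longrightarrow> W = {\<zero>\<^bsub>M\<^esub>} \<or> W = carrier M)"

definition alg_module_isomorphic ::
  "('k, 'c) ring_scheme \<Rightarrow> ('k, 'a, 'd) module_scheme \<Rightarrow> ('k, 'a, 'v, 'e) amodule_scheme \<Rightarrow>
   ('k, 'a, 'w, 'f) amodule_scheme \<Rightarrow> bool" where
  "alg_module_isomorphic K A M N \<longleftrightarrow>
     (\<exists>h \<in> module_hom K M N. bij_betw h (carrier M) (carrier N) \<and>
        (\<forall>a \<in> carrier A. \<forall>v \<in> carrier M. h (a \<rhd>\<^bsub>M\<^esub> v) = a \<rhd>\<^bsub>N\<^esub> h v))"


section \<open>Tensor products\<close>

definition quotient_space ::
  "('k, 'v, 'd) module_scheme \<Rightarrow> 'v set \<Rightarrow> ('k, 'v set) module" where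
  "quotient_space V W =
     \<lparr>carrier = a_rcosets\<^bsub>V\<^esub> W,
      mult = undefined, one = undefined,
      zero = W,
      add = (\<lambda>C D. C <+>\<^bsub>V\<^esub> D),
      smult = (\<lambda>c C. W <+>\<^bsub>V\<^esub> (\<lambda>v. c \<odot>\<^bsub>V\<^esub> v) ` C)\<rparr>"

text \<open>\<open>X\<close> is a left module in the sense of its record and in addition a right \<open>A\<close>-module via
  the action \<open>r\<close>; \<open>N\<close> is a left \<open>A\<close>-module.\<close>

definition tensor_relations ::
  "('k, 'c) ring_scheme \<Rightarrow> ('k, 'a, 'd) module_scheme \<Rightarrow>
   ('k, 'b, 'x, 'e) amodule_scheme \<Rightarrow> ('x \<Rightarrow> 'a \<Rightarrow> 'x) \<Rightarrow>
   ('k, 'a, 'n, 'f) amodule_scheme \<Rightarrow> ('x \<times> 'n \<Rightarrow> 'k) set" where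
  "tensor_relations K A X r N =
    (let F = free_space K (carrier X \<times> carrier N); \<delta> = (\<lambda>x n. basis_vec K (x, n)) in
       {\<delta> (x \<oplus>\<^bsub>X\<^esub> y) n \<ominus>\<^bsub>F\<^esub> (\<delta> x n \<oplus>\<^bsub>F\<^esub> \<delta> y n) | x y n.
          x \<in> carrier X \<and> y \<in> carrier X \<and> n \<in> carrier N} \<union>
       {\<delta> x (m \<oplus>\<^bsub>N\<^esub> n) \<ominus>\<^bsub>F\<^esub> (\<delta> x m \<oplus>\<^bsub>F\<^esub> \<delta> x n) | x m n.
          x \<in> carrier X \<and> m \<in> carrier N \<and> n \<in> carrier N} \<union>
       {\<delta> (c \<odot>\<^bsub>X\<^esub> x) n \<ominus>\<^bsub>F\<^esub> c \<odot>\<^bsub>F\<^esub> \<delta> x n | c x n.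
          c \<in> carrier K \<and> x \<in> carrier X \<and> n \<in> carrier N} \<union>
       {\<delta> x (c \<odot>\<^bsub>N\<^esub> n) \<ominus>\<^bsub>F\<^esub> c \<odot>\<^bsub>F\<^esub> \<delta> x n | c x n.
          c \<in> carrier K \<and> x \<in> carrier X \<and> n \<in> carrier N} \<union>
       {\<delta> (r x a) n \<ominus>\<^bsub>F\<^esub> \<delta> x (a \<rhd>\<^bsub>N\<^esub> n) | x a n.
          x \<in> carrier X \<and> a \<in> carrier A \<and> n \<in> carrier N})"

text \<open>The left module \<open>X \<otimes>\<^sub>A N\<close>, acted on by \<open>b(x \<otimes> n) = bx \<otimes> n\<close>.\<close>

definition tensor_module ::
  "('k, 'c) ring_scheme \<Rightarrow> ('k, 'a, 'd) module_scheme \<Rightarrow>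
   ('k, 'b, 'x, 'e) amodule_scheme \<Rightarrow> ('x \<Rightarrow> 'a \<Rightarrow> 'x) \<Rightarrow>
   ('k, 'a, 'n, 'f) amodule_scheme \<Rightarrow> ('k, 'b, ('x \<times> 'n \<Rightarrow> 'k) set) amodule" where
  "tensor_module K A X r N =
    (let F = free_space K (carrier X \<times> carrier N);
         W = module.span K F (tensor_relations K A X r N)
     in with_act (quotient_space F W)
          (\<lambda>b C. W <+>\<^bsub>F\<^esub> lin_ext K (\<lambda>(x, n). basis_vec K (b \<rhd>\<^bsub>X\<^esub> x, n)) ` C))"


section \<open>The induced modules\<close>

text \<open>\<open>kL\<^sub>e\<close> with the left Schuetzenberger action of the algebra of \<open>cd_semigroup S\<close>.\<close>

definition kL_module ::
  "('k, 'c) ring_scheme \<Rightarrow> ('s, 'm) monoid_scheme \<Rightarrow> 's set \<Rightarrow>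
   ('k, 's set \<Rightarrow> 'k, 's set \<Rightarrow> 'k) amodule" where
  "kL_module K S e =
     with_act (free_space K (L_class S e))
       (bilin_ext K (\<lambda>B A. let C = B \<otimes>\<^bsub>cd_semigroup S\<^esub> A in
          if C \<in> L_class S e then basis_vec K C else (\<lambda>x. \<zero>\<^bsub>K\<^esub>)))"

definition kL_right_act ::
  "('k, 'c) ring_scheme \<Rightarrow> ('s, 'm) monoid_scheme \<Rightarrow>
   ('s set \<Rightarrow> 'k) \<Rightarrow> ('s set \<Rightarrow> 'k) \<Rightarrow> 's set \<Rightarrow> 'k" where
  "kL_right_act K S = bilin_ext K (\<lambda>A g. basis_vec K (A \<otimes>\<^bsub>cd_semigroup S\<^esub> g))"

abbreviation group_algebra_at ::
  "('k, 'c) ring_scheme \<Rightarrow> ('s, 'm) monoid_scheme \<Rightarrow> 's set \<Rightarrow> ('k, 's set \<Rightarrow> 'k) module" where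
  "group_algebra_at K S e \<equiv> semigroup_algebra K (max_subgroup S e)"

definition iota_alg ::
  "('k, 'c) ring_scheme \<Rightarrow> ('s, 'm) monoid_scheme \<Rightarrow> ('s \<Rightarrow> 'k) \<Rightarrow> 's set \<Rightarrow> 'k" where
  "iota_alg K S = lin_ext K (\<lambda>s. basis_vec K (iota S s))"

definition Ind ::
  "('k, 'c) ring_scheme \<Rightarrow> ('s, 'm) monoid_scheme \<Rightarrow> 's set \<Rightarrow>
   ('k, 's set \<Rightarrow> 'k, 'n, 'f) amodule_scheme \<Rightarrow>
   ('k, 's \<Rightarrow> 'k, (('s set \<Rightarrow> 'k) \<times> 'n \<Rightarrow> 'k) set) amodule" where
  "Ind K S e N =
    (let T = tensor_module K (group_algebra_at K S e) (kL_module K S e) (kL_right_act K S) N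
     in with_act T (\<lambda>a v. iota_alg K S a \<rhd>\<^bsub>T\<^esub> v))"

end

theory Submission
  imports Defs
begin

text \<open>
  An idempotent of \<open>\<L>(S)\<close> is the upward closure of the filter of idempotents of \<open>S\<close> that it
  contains (\<open>cd_idem_below\<close>, \<open>filter_up_closure_idem\<close>). The idempotents of \<open>S\<close> act on any module
  as commuting projections, so these filters are the possible weights of a \<open>kS\<close>-module: a vector
  has weight \<open>f\<close> if the idempotents in \<open>f\<close> fix it and all others kill it.

  Write \<open>B \<star> C\<close> and \<open>B\<^sup>\<star>\<close> for product and inverse in \<open>\<L>(S)\<close>. In \<open>Ind\<^sub>e(N)\<close> the vector
  \<open>B \<otimes> n\<close> has weight \<open>B \<star> B\<^sup>\<star>\<close>. These weights run through the
  idempotents in the \<open>\<D>\<close>-class of \<open>e\<close>, and each weight space is a copy \<open>B \<otimes> N\<close> of \<open>N\<close>,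
  because the members of the \<open>\<L>\<close>-class with the same weight form one orbit of \<open>G\<^sub>e\<close>
  (\<open>L_class_orbit\<close>, \<open>tau_projection\<close>). An idempotent of \<open>S\<close> that separates two weights splits
  every vector involving both, so a nonzero submodule contains some \<open>B \<otimes> n \<noteq> 0\<close>
  (\<open>submodule_contains_generator\<close>). The elements of \<open>S\<close> permute the weight spaces transitively
  (\<open>L_class_transitive\<close>) and act on each of them through \<open>G\<^sub>e\<close>, so if \<open>N\<close> is simple, the
  submodule is everything (\<open>Ind_simple\<close>). Since there is one copy of \<open>N\<close> for each weight, finite
  dimension corresponds to finite index (\<open>Ind_fin_dim\<close>, \<open>finite_index_if_fin_dim\<close>).

  Conversely, let \<open>M\<close> be simple and finite-dimensional, and let \<open>x\<close> be an idempotent of \<open>S\<close> for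
  which \<open>V = xM\<close> is nonzero and as small as possible. By minimality every idempotent acts on \<open>V\<close> as
  the identity or as zero, so \<open>V\<close> is a weight space. The filter \<open>F\<close> of the idempotents acting as the
  identity generates an idempotent \<open>H\<close> of \<open>\<L>(S)\<close>. All elements of a member of the \<open>\<L>\<close>-class of
  \<open>H\<close> act alike on \<open>V\<close> (\<open>L_class_act_eq\<close>), which makes \<open>V\<close> a \<open>kG\<^sub>H\<close>-module. Every element of \<open>S\<close>
  that takes a vector of \<open>V\<close> to a nonzero vector of \<open>V\<close> lies in a member of \<open>G\<^sub>H\<close>
  (\<open>mem_max_subgroup\<close>), so \<open>V\<close> inherits simplicity from \<open>M\<close>. Finally \<open>B \<otimes> v \<mapsto> bv\<close> for
  \<open>b \<in> B\<close> is a nonzero homomorphism \<open>Ind\<^sub>H(V) \<rightarrow> M\<close> between simple modules, hence an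
  isomorphism, and \<open>H\<close> has finite index because \<open>M\<close> has finite dimension.

  The linear algebra before that serves to reduce everything to generators: algebra elements to
  basis elements, and induced modules to the vectors \<open>B \<otimes> n\<close> and the universal property
  \<open>I_universal\<close>, which is all that is used of the tensor product.
\<close>

section \<open>Calculus in inverse semigroups\<close>

context inverse_semigroup
begin

lemma sinv_props:
  assumes "a \<in> carrier S"
  shows "sinv S a \<in> carrier S" "a \<otimes> sinv S a \<otimes> a = a" "sinv S a \<otimes> a \<otimes> sinv S a = sinv S a"
  using theI'[OF unique_inverse[OF assms]] unfolding sinv_def by blast+

lemmas sinv_closed = sinv_props(1)
declare mult_closed[simp, intro] sinv_closed[simp, intro]

lemma sinv_eqI:
  assumes "a \<in> carrier S" "b \<in> carrier S" "a \<otimes> b \<otimes> a = a" "b \<otimes> a \<otimes> b = b"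
  shows "sinv S a = b"
  using unique_inverse[OF assms(1)] assms sinv_props[OF assms(1)] by blast

lemma sinv_sinv [simp]:
  assumes "a \<in> carrier S" shows "sinv S (sinv S a) = a"
  using assms sinv_props[OF assms] by (intro sinv_eqI) auto

lemma idemI: "\<lbrakk>e \<in> carrier S; e \<otimes> e = e\<rbrakk> \<Longrightarrow> e \<in> idems S"
  by (simp add: idems_def)

lemma idem_carrier [simp]: "e \<in> idems S \<Longrightarrow> e \<in> carrier S"
  and idem_mult [simp]: "e \<in> idems S \<Longrightarrow> e \<otimes> e = e"
  by (auto simp: idems_def)

lemma idem_mult_left [simp]: "\<lbrakk>e \<in> idems S; y \<in> carrier S\<rbrakk> \<Longrightarrow> e \<otimes> (e \<otimes> y) = e \<otimes> y"
  by (metis idem_carrier idem_mult mult_assoc)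

lemma sinv_idem [simp]:
  assumes "e \<in> idems S" shows "sinv S e = e"
  by (rule sinv_eqI) (simp_all add: assms)

text \<open>With \<open>x\<close> the inverse of \<open>ef\<close>, the element \<open>fxe\<close> is an inverse of \<open>ef\<close> as well. So
  \<open>x = fxe\<close>, which is visibly idempotent, and then \<open>ef\<close>, being the inverse of \<open>x\<close>, equals \<open>x\<close>.\<close>

lemma idem_prod_idem:
  assumes e: "e \<in> idems S" and f: "f \<in> idems S"
  shows "e \<otimes> f \<in> idems S"
proof -
  have c[simp]: "e \<in> carrier S" "f \<in> carrier S" "e \<otimes> e = e" "f \<otimes> f = f" using e f by auto
  define x where "x = sinv S (e \<otimes> f)"
  have xc[simp]: "x \<in> carrier S" by (simp add: x_def)
  note p = sinv_props[OF mult_closed[OF c(1,2)], folded x_def]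
  have ff: "f \<otimes> (f \<otimes> y) = f \<otimes> y" "e \<otimes> (e \<otimes> y) = e \<otimes> y" if "y \<in> carrier S" for y
    using that by (simp_all add: mult_assoc[symmetric])
  have p1: "e \<otimes> (f \<otimes> (x \<otimes> (e \<otimes> f))) = e \<otimes> f" using p(2) by (simp add: mult_assoc)
  have p2: "x \<otimes> (e \<otimes> (f \<otimes> x)) = x" using p(3) by (simp add: mult_assoc)
  have p2': "x \<otimes> (e \<otimes> (f \<otimes> (x \<otimes> y))) = x \<otimes> y" if "y \<in> carrier S" for y
    using p2 that by (metis c(1,2) mult_assoc mult_closed xc)
  have xe: "x = f \<otimes> x \<otimes> e"
    unfolding x_def
    by (rule sinv_eqI) (simp_all add: mult_assoc ff p1 p2' flip: x_def)
  then have "x \<otimes> x = (f \<otimes> x \<otimes> e) \<otimes> (f \<otimes> x \<otimes> e)" by simp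
  also have "\<dots> = f \<otimes> x \<otimes> e" by (simp add: mult_assoc p2')
  finally have xi: "x \<in> idems S" using xe by (intro idemI) simp_all
  have "e \<otimes> f = sinv S x" by (simp add: x_def)
  with xi show ?thesis by simp
qed

text \<open>Both \<open>ef\<close> and \<open>fe\<close> are inverses of the idempotent \<open>ef\<close>.\<close>

lemma idem_commute:
  assumes e: "e \<in> idems S" and f: "f \<in> idems S"
  shows "e \<otimes> f = f \<otimes> e"
proof -
  have c[simp]: "e \<in> carrier S" "f \<in> carrier S" "e \<otimes> e = e" "f \<otimes> f = f" using e f by auto
  have ff: "f \<otimes> (f \<otimes> y) = f \<otimes> y" "e \<otimes> (e \<otimes> y) = e \<otimes> y" if "y \<in> carrier S" for y
    using that by (simp_all add: mult_assoc[symmetric])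
  have i: "e \<otimes> f \<in> idems S" "f \<otimes> e \<in> idems S" using idem_prod_idem e f by auto
  have "sinv S (e \<otimes> f) = f \<otimes> e"
    using idem_mult[OF i(1)] idem_mult[OF i(2)]
    by (intro sinv_eqI) (simp_all add: mult_assoc ff)
  then show ?thesis using i by simp
qed

lemma dom_idem [simp]: "a \<in> carrier S \<Longrightarrow> sinv S a \<otimes> a \<in> idems S"
  and ran_idem [simp]: "a \<in> carrier S \<Longrightarrow> a \<otimes> sinv S a \<in> idems S"
  using sinv_props[of a] by (auto intro!: idemI simp: mult_assoc[symmetric])

lemma conj_idem:
  assumes "a \<in> carrier S" "e \<in> idems S"
  shows "a \<otimes> e \<otimes> sinv S a \<in> idems S" "a \<otimes> e \<otimes> sinv S a \<otimes> a = a \<otimes> e"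
proof -
  have c[simp]: "a \<in> carrier S" "e \<in> carrier S" using assms by auto
  have "a \<otimes> e \<otimes> sinv S a \<otimes> a = a \<otimes> (e \<otimes> (sinv S a \<otimes> a))" by (simp add: mult_assoc)
  also have "\<dots> = a \<otimes> sinv S a \<otimes> a \<otimes> e"
    using idem_commute[OF assms(2) dom_idem[OF c(1)]] by (simp add: mult_assoc)
  finally show 2: "a \<otimes> e \<otimes> sinv S a \<otimes> a = a \<otimes> e" using sinv_props[OF c(1)] by simp
  have "a \<otimes> e \<otimes> sinv S a \<otimes> (a \<otimes> e \<otimes> sinv S a)
      = (a \<otimes> e \<otimes> sinv S a \<otimes> a) \<otimes> e \<otimes> sinv S a" by (simp add: mult_assoc)
  also have "\<dots> = a \<otimes> (e \<otimes> e) \<otimes> sinv S a" unfolding 2 by (simp add: mult_assoc)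
  finally show "a \<otimes> e \<otimes> sinv S a \<in> idems S" using assms by (intro idemI) simp_all
qed

lemma conj_idem':
  assumes "a \<in> carrier S" "e \<in> idems S"
  shows "sinv S a \<otimes> e \<otimes> a \<in> idems S" "a \<otimes> (sinv S a \<otimes> e \<otimes> a) = e \<otimes> a"
proof -
  have c[simp]: "a \<in> carrier S" "e \<in> carrier S" using assms by auto
  show "sinv S a \<otimes> e \<otimes> a \<in> idems S" using conj_idem(1)[of "sinv S a" e] assms by simp
  have "a \<otimes> (sinv S a \<otimes> e \<otimes> a) = (a \<otimes> sinv S a) \<otimes> e \<otimes> a" by (simp add: mult_assoc)
  also have "\<dots> = e \<otimes> (a \<otimes> sinv S a \<otimes> a)"
    using idem_commute[OF assms(2) ran_idem[OF c(1)]]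
    by (metis c mult_assoc mult_closed sinv_closed)
  finally show "a \<otimes> (sinv S a \<otimes> e \<otimes> a) = e \<otimes> a" using sinv_props[OF c(1)] by simp
qed

lemma sinv_mult:
  assumes [simp]: "a \<in> carrier S" "b \<in> carrier S"
  shows "sinv S (a \<otimes> b) = sinv S b \<otimes> sinv S a"
proof (rule sinv_eqI)
  have *: "x \<otimes> y \<otimes> (sinv S y \<otimes> sinv S x) \<otimes> (x \<otimes> y) = x \<otimes> y"
    if [simp]: "x \<in> carrier S" "y \<in> carrier S" for x y
  proof -
    have "x \<otimes> y \<otimes> (sinv S y \<otimes> sinv S x) \<otimes> (x \<otimes> y)
        = x \<otimes> ((y \<otimes> sinv S y) \<otimes> (sinv S x \<otimes> x)) \<otimes> y" by (simp add: mult_assoc)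
    also have "\<dots> = (x \<otimes> sinv S x \<otimes> x) \<otimes> (y \<otimes> sinv S y \<otimes> y)"
      using idem_commute[of "y \<otimes> sinv S y" "sinv S x \<otimes> x"] by (simp add: mult_assoc)
    finally show ?thesis by (simp add: sinv_props)
  qed
  show "a \<otimes> b \<otimes> (sinv S b \<otimes> sinv S a) \<otimes> (a \<otimes> b) = a \<otimes> b" by (simp add: *)
  show "sinv S b \<otimes> sinv S a \<otimes> (a \<otimes> b) \<otimes> (sinv S b \<otimes> sinv S a) = sinv S b \<otimes> sinv S a"
    using *[of "sinv S b" "sinv S a"] by simp
qed simp_all

subsection \<open>The natural partial order\<close>

lemma nat_leD: "nat_le S a b \<Longrightarrow> a \<in> carrier S" "nat_le S a b \<Longrightarrow> b \<in> carrier S"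
  by (auto simp: nat_le_def)

lemma nat_leI_left: "\<lbrakk>b \<in> carrier S; e \<in> idems S\<rbrakk> \<Longrightarrow> nat_le S (e \<otimes> b) b"
  by (auto simp: nat_le_def)

lemma nat_leI_right:
  assumes "b \<in> carrier S" "e \<in> idems S" shows "nat_le S (b \<otimes> e) b"
  unfolding nat_le_def using assms conj_idem[OF assms] by (auto intro!: bexI[of _ "b \<otimes> e \<otimes> sinv S b"])

text \<open>The next two facts make the idempotent in the definition of the order canonical: it can be
  taken to be the domain of the smaller element on the right, or its range on the left.\<close>

lemma nat_le_dom:
  assumes "nat_le S a b" shows "a = b \<otimes> (sinv S a \<otimes> a)"
proof -
  obtain e where e: "e \<in> idems S" and a: "a = e \<otimes> b" and b[simp]: "b \<in> carrier S"
    using assms by (auto simp: nat_le_def)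
  have [simp]: "e \<in> carrier S" using e by auto
  have "sinv S a \<otimes> a = sinv S b \<otimes> (e \<otimes> e) \<otimes> b" using e by (simp add: a sinv_mult mult_assoc)
  then have "b \<otimes> (sinv S a \<otimes> a) = b \<otimes> (sinv S b \<otimes> e \<otimes> b)" using e by simp
  then show ?thesis using conj_idem'(2)[OF b e] a by simp
qed

lemma nat_le_ran:
  assumes "nat_le S a b" shows "a = (a \<otimes> sinv S a) \<otimes> b"
proof -
  obtain e where e: "e \<in> idems S" and a: "a = e \<otimes> b" and b[simp]: "b \<in> carrier S"
    using assms by (auto simp: nat_le_def)
  have [simp]: "e \<in> carrier S" using e by auto
  have "(a \<otimes> sinv S a) \<otimes> b = e \<otimes> ((b \<otimes> sinv S b) \<otimes> e) \<otimes> b" using e by (simp add: a sinv_mult mult_assoc)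
  also have "\<dots> = e \<otimes> (b \<otimes> (sinv S b \<otimes> e \<otimes> b))" by (simp add: mult_assoc)
  finally show ?thesis using conj_idem'(2)[OF b e] e a by simp
qed

lemma nat_le_refl [simp]: "a \<in> carrier S \<Longrightarrow> nat_le S a a"
  using nat_leI_left[of a "a \<otimes> sinv S a"] sinv_props[of a] by simp

lemma nat_le_trans:
  assumes "nat_le S a b" "nat_le S b c" shows "nat_le S a c"
proof -
  obtain e f where "e \<in> idems S" "f \<in> idems S" "a = e \<otimes> b" "b = f \<otimes> c" "c \<in> carrier S"
    using assms by (auto simp: nat_le_def)
  moreover from this have "a = (e \<otimes> f) \<otimes> c" by (simp add: mult_assoc)
  ultimately show ?thesis using nat_leI_left[OF _ idem_prod_idem, of c e f] by metis
qed

lemma nat_le_mult: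
  assumes "nat_le S a b" "nat_le S c d" shows "nat_le S (a \<otimes> c) (b \<otimes> d)"
proof -
  obtain e where e: "e \<in> idems S" "a = e \<otimes> b" using assms(1) by (auto simp: nat_le_def)
  obtain f where f: "f \<in> idems S" "c = d \<otimes> f"
    using nat_le_dom[OF assms(2)] nat_leD[OF assms(2)] dom_idem by blast
  have cc[simp]: "b \<in> carrier S" "d \<in> carrier S" "e \<in> carrier S" "f \<in> carrier S"
    using assms[THEN nat_leD(2)] e(1) f(1) by auto
  have "a \<otimes> c = e \<otimes> (b \<otimes> d \<otimes> f)" by (simp add: e f mult_assoc)
  then show ?thesis
    using nat_le_trans[OF nat_leI_left[of "b \<otimes> d \<otimes> f" e] nat_leI_right[of "b \<otimes> d" f]] e(1) f(1) cc
    by (metis mult_closed)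
qed

lemma nat_le_sinv:
  assumes "nat_le S a b" shows "nat_le S (sinv S a) (sinv S b)"
proof -
  obtain e where e: "e \<in> idems S" "a = e \<otimes> b" "b \<in> carrier S" using assms by (auto simp: nat_le_def)
  then show ?thesis by (simp add: sinv_mult nat_leI_right)
qed

lemma mult_idem_le: 
  assumes "e \<in> idems S" "f \<in> idems S"
  shows "nat_le S (e \<otimes> f) e" "nat_le S (e \<otimes> f) f"
  using assms nat_leI_left[of f e] nat_leI_right[of e f] by auto

end

text \<open>Two inverses \<open>b\<close> and \<open>c\<close> of \<open>a\<close> are both equal to \<open>cab\<close>, as \<open>ba\<close> commutes with \<open>ca\<close> and
  \<open>ab\<close> with \<open>ac\<close>.\<close>

lemma inverse_semigroupI:
  fixes T (structure)
  assumes closed: "\<And>a b. \<lbrakk>a \<in> carrier T; b \<in> carrier T\<rbrakk> \<Longrightarrow> a \<otimes> b \<in> carrier T"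
    and assoc: "\<And>a b c. \<lbrakk>a \<in> carrier T; b \<in> carrier T; c \<in> carrier T\<rbrakk>
      \<Longrightarrow> (a \<otimes> b) \<otimes> c = a \<otimes> (b \<otimes> c)"
    and ex: "\<And>a. a \<in> carrier T \<Longrightarrow> \<exists>b \<in> carrier T. a \<otimes> b \<otimes> a = a \<and> b \<otimes> a \<otimes> b = b"
    and comm: "\<And>e f. \<lbrakk>e \<in> idems T; f \<in> idems T\<rbrakk> \<Longrightarrow> e \<otimes> f = f \<otimes> e"
  shows "inverse_semigroup T"
proof
  fix a assume a: "a \<in> carrier T"
  have uniq: "b = c" if b: "b \<in> carrier T" "a \<otimes> b \<otimes> a = a" "b \<otimes> a \<otimes> b = b"
    and c: "c \<in> carrier T" "a \<otimes> c \<otimes> a = a" "c \<otimes> a \<otimes> c = c" for b c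
  proof -
    have i: "b \<otimes> a \<in> idems T" "c \<otimes> a \<in> idems T" "a \<otimes> b \<in> idems T" "a \<otimes> c \<in> idems T"
      using a b c closed by (auto simp: idems_def assoc[symmetric])
    have "b = b \<otimes> (a \<otimes> c \<otimes> a) \<otimes> b" using b c by simp
    also have "\<dots> = ((b \<otimes> a) \<otimes> (c \<otimes> a)) \<otimes> b" using a b(1) c(1) closed by (simp add: assoc)
    also have "\<dots> = ((c \<otimes> a) \<otimes> (b \<otimes> a)) \<otimes> b" using comm[OF i(1,2)] by simp
    also have "\<dots> = c \<otimes> (a \<otimes> b \<otimes> a) \<otimes> b" using a b(1) c(1) closed by (simp add: assoc)
    also have "\<dots> = c \<otimes> a \<otimes> b" using b by simp
    finally have 1: "b = c \<otimes> a \<otimes> b" .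
    have "c = c \<otimes> (a \<otimes> b \<otimes> a) \<otimes> c" using b c by simp
    also have "\<dots> = c \<otimes> ((a \<otimes> b) \<otimes> (a \<otimes> c))" using a b(1) c(1) closed by (simp add: assoc)
    also have "\<dots> = c \<otimes> ((a \<otimes> c) \<otimes> (a \<otimes> b))" using comm[OF i(3,4)] by simp
    also have "\<dots> = c \<otimes> (a \<otimes> c \<otimes> a) \<otimes> b" using a b(1) c(1) closed by (simp add: assoc)
    also have "\<dots> = c \<otimes> a \<otimes> b" using c by simp
    finally show ?thesis using 1 by simp
  qed
  with ex[OF a] show "\<exists>!b. b \<in> carrier T \<and> a \<otimes> b \<otimes> a = a \<and> b \<otimes> a \<otimes> b = b" by blast
qed (use closed assoc in auto)

section \<open>Green's relations\<close>

context inverse_semigroup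
begin

lemma mult_sinv_mult [simp]:
  assumes "a \<in> carrier S"
  shows "a \<otimes> (sinv S a \<otimes> a) = a" "sinv S a \<otimes> (a \<otimes> sinv S a) = sinv S a"
    "x \<in> carrier S \<Longrightarrow> a \<otimes> (sinv S a \<otimes> (a \<otimes> x)) = a \<otimes> x"
    "x \<in> carrier S \<Longrightarrow> sinv S a \<otimes> (a \<otimes> (sinv S a \<otimes> x)) = sinv S a \<otimes> x"
  using sinv_props[OF assms] assms by (simp_all flip: mult_assoc)

lemma left_ideal_mono:
  assumes "a \<in> carrier S" "b \<in> carrier S" "a = a \<otimes> (sinv S b \<otimes> b)"
  shows "left_ideal1 S a \<subseteq> left_ideal1 S b"
proof -
  have "x \<otimes> a = x \<otimes> (a \<otimes> sinv S b) \<otimes> b" if "x \<in> carrier S" for x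
    using assms that by (metis mult_assoc mult_closed sinv_closed)
  moreover have "a = (a \<otimes> sinv S b) \<otimes> b" using assms by (metis mult_assoc sinv_closed)
  ultimately show ?thesis using assms unfolding left_ideal1_def by blast
qed

lemma left_ideal_memD:
  assumes "a \<in> carrier S" "b \<in> carrier S" "a \<in> left_ideal1 S b"
  shows "sinv S a \<otimes> a \<otimes> (sinv S b \<otimes> b) = sinv S a \<otimes> a"
  using assms by (auto simp: left_ideal1_def mult_assoc)

text \<open>If \<open>a\<close> and \<open>b\<close> are left multiples of each other, each of the idempotents \<open>a\<inverse>a\<close> and
  \<open>b\<inverse>b\<close> absorbs the other, and they commute.\<close>

lemma green_L_iff:
  "green_L S a b \<longleftrightarrow> a \<in> carrier S \<and> b \<in> carrier S \<and> sinv S a \<otimes> a = sinv S b \<otimes> b"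
proof -
  have "sinv S a \<otimes> a = sinv S b \<otimes> b"
    if c: "a \<in> carrier S" "b \<in> carrier S" and eq: "left_ideal1 S a = left_ideal1 S b"
  proof -
    have "a \<in> left_ideal1 S b" "b \<in> left_ideal1 S a" using eq by (auto simp: left_ideal1_def)
    then show ?thesis
      using c left_ideal_memD idem_commute[of "sinv S a \<otimes> a" "sinv S b \<otimes> b"] dom_idem by metis
  qed
  moreover have "left_ideal1 S a = left_ideal1 S b"
    if c: "a \<in> carrier S" "b \<in> carrier S" and eq: "sinv S a \<otimes> a = sinv S b \<otimes> b"
    using left_ideal_mono[of a b] left_ideal_mono[of b a] c eq
    by (metis mult_sinv_mult(1) subset_antisym)
  ultimately show ?thesis unfolding green_L_def by blast
qed

lemma right_ideal_mono:
  assumes "a \<in> carrier S" "b \<in> carrier S" "a = (b \<otimes> sinv S b) \<otimes> a"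
  shows "right_ideal1 S a \<subseteq> right_ideal1 S b"
proof -
  have "a \<otimes> x = b \<otimes> (sinv S b \<otimes> a \<otimes> x)" if "x \<in> carrier S" for x
    using assms that by (metis mult_assoc mult_closed sinv_closed)
  moreover have "a = b \<otimes> (sinv S b \<otimes> a)" using assms by (metis mult_assoc sinv_closed)
  ultimately show ?thesis using assms unfolding right_ideal1_def by blast
qed

lemma right_ideal_memD:
  assumes "a \<in> carrier S" "b \<in> carrier S" "a \<in> right_ideal1 S b"
  shows "(b \<otimes> sinv S b) \<otimes> (a \<otimes> sinv S a) = a \<otimes> sinv S a"
  using assms by (auto simp: right_ideal1_def mult_assoc)

lemma green_R_iff:
  "green_R S a b \<longleftrightarrow> a \<in> carrier S \<and> b \<in> carrier S \<and> a \<otimes> sinv S a = b \<otimes> sinv S b"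
proof -
  have "a \<otimes> sinv S a = b \<otimes> sinv S b"
    if c: "a \<in> carrier S" "b \<in> carrier S" and eq: "right_ideal1 S a = right_ideal1 S b"
  proof -
    have "a \<in> right_ideal1 S b" "b \<in> right_ideal1 S a" using eq by (auto simp: right_ideal1_def)
    then show ?thesis
      using c right_ideal_memD idem_commute[of "a \<otimes> sinv S a" "b \<otimes> sinv S b"] ran_idem by metis
  qed
  moreover have "right_ideal1 S a = right_ideal1 S b"
    if c: "a \<in> carrier S" "b \<in> carrier S" and eq: "a \<otimes> sinv S a = b \<otimes> sinv S b"
    using right_ideal_mono[of a b] right_ideal_mono[of b a] c eq
    by (metis sinv_props(2) subset_antisym)
  ultimately show ?thesis unfolding green_R_def by blast
qed

end


section \<open>The inverse semigroup of closed directed subsets\<close>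


context inverse_semigroup
begin

abbreviation cd_times (infixl \<open>\<star>\<close> 70) where
  "A \<star> B \<equiv> A \<otimes>\<^bsub>cd_semigroup S\<^esub> B"

abbreviation cd_inv (\<open>_\<^sup>\<star>\<close> [1000] 999) where
  "A\<^sup>\<star> \<equiv> sinv (cd_semigroup S) A"

lemma cd_carrier: "A \<in> carrier (cd_semigroup S) \<longleftrightarrow> closed_directed S A"
  by (simp add: cd_semigroup_def)

lemma cd_sub: "closed_directed S A \<Longrightarrow> a \<in> A \<Longrightarrow> a \<in> carrier S"
  and cd_up: "closed_directed S A \<Longrightarrow> a \<in> A \<Longrightarrow> nat_le S a b \<Longrightarrow> b \<in> A"
  and cd_ne: "closed_directed S A \<Longrightarrow> \<exists>a. a \<in> A"
  and cd_dir: "closed_directed S A \<Longrightarrow> a \<in> A \<Longrightarrow> b \<in> A \<Longrightarrow> \<exists>c \<in> A. nat_le S c a \<and> nat_le S c b"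
  unfolding closed_directed_def up_closure_def using nat_leD(2) by blast+

lemma cd_dir3:
  assumes "closed_directed S A" "a \<in> A" "b \<in> A" "c \<in> A"
  shows "\<exists>d \<in> A. nat_le S d a \<and> nat_le S d b \<and> nat_le S d c"
  using assms by (meson cd_dir nat_le_trans)

lemma cd_up_closure:
  assumes "X \<subseteq> carrier S" "X \<noteq> {}"
    and "\<And>a b. \<lbrakk>a \<in> X; b \<in> X\<rbrakk> \<Longrightarrow> \<exists>c \<in> X. nat_le S c a \<and> nat_le S c b"
  shows "closed_directed S (up_closure S X)"
proof -
  have sub: "X \<subseteq> up_closure S X" using assms(1) nat_le_refl unfolding up_closure_def by blast
  have "up_closure S (up_closure S X) = up_closure S X"
    using sub nat_le_trans unfolding up_closure_def by blast
  moreover have "\<exists>c \<in> up_closure S X. nat_le S c a \<and> nat_le S c b"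
    if ab: "a \<in> up_closure S X" "b \<in> up_closure S X" for a b
  proof -
    obtain x y where "x \<in> X" "y \<in> X" "nat_le S x a" "nat_le S y b"
      using ab by (auto simp: up_closure_def)
    moreover then obtain z where "z \<in> X" "nat_le S z x" "nat_le S z y" using assms(3) by blast
    ultimately show ?thesis using sub nat_le_trans by blast
  qed
  ultimately show ?thesis using assms(2) sub unfolding closed_directed_def
    by (auto simp: up_closure_def)
qed

lemma mem_cd_mult:
  "x \<in> A \<star> B \<longleftrightarrow> (\<exists>a \<in> A. \<exists>b \<in> B. nat_le S (a \<otimes> b) x)"
  by (auto simp: cd_semigroup_def up_closure_def set_mult_def dest: nat_leD)

lemma mult_mem_cd_mult:
  assumes "closed_directed S A" "closed_directed S B" "a \<in> A" "b \<in> B"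
  shows "a \<otimes> b \<in> A \<star> B"
  using assms cd_sub[of A a] cd_sub[of B b] nat_le_refl unfolding mem_cd_mult by blast

lemma cd_mult_closed:
  assumes A: "closed_directed S A" and B: "closed_directed S B"
  shows "closed_directed S (A \<star> B)"
proof -
  have "closed_directed S (up_closure S (A <#> B))"
  proof (rule cd_up_closure)
    show "A <#> B \<subseteq> carrier S" using cd_sub A B by (auto simp: set_mult_def)
    show "A <#> B \<noteq> {}" using cd_ne A B by (auto simp: set_mult_def)
    fix x y assume "x \<in> A <#> B" "y \<in> A <#> B"
    then obtain a b c d where *: "a \<in> A" "c \<in> A" "b \<in> B" "d \<in> B" "x = a \<otimes> b" "y = c \<otimes> d"
      by (auto simp: set_mult_def)
    obtain p q where "p \<in> A" "nat_le S p a" "nat_le S p c" "q \<in> B" "nat_le S q b" "nat_le S q d"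
      using cd_dir[OF A, of a c] cd_dir[OF B, of b d] * by blast
    then show "\<exists>z \<in> A <#> B. nat_le S z x \<and> nat_le S z y"
      using * nat_le_mult[of p a q b] nat_le_mult[of p c q d] unfolding set_mult_def by blast
  qed
  then show ?thesis by (simp add: cd_semigroup_def)
qed

lemma cd_mult_assoc:
  assumes A: "closed_directed S A" and B: "closed_directed S B" and C: "closed_directed S C"
  shows "(A \<star> B) \<star> C
       = A \<star> (B \<star> C)" (is "?l = ?r")
proof -
  have "x \<in> ?l \<longleftrightarrow> (\<exists>a \<in> A. \<exists>b \<in> B. \<exists>c \<in> C. nat_le S (a \<otimes> b \<otimes> c) x)" for x
  proof
    assume "x \<in> ?l"
    then obtain a b y c where *: "a \<in> A" "b \<in> B" "c \<in> C" "nat_le S (a \<otimes> b) y" "nat_le S (y \<otimes> c) x"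
      by (auto simp: mem_cd_mult)
    then have "nat_le S (a \<otimes> b \<otimes> c) (y \<otimes> c)" using nat_le_mult cd_sub[OF C] nat_le_refl by blast
    then show "\<exists>a \<in> A. \<exists>b \<in> B. \<exists>c \<in> C. nat_le S (a \<otimes> b \<otimes> c) x" using * nat_le_trans by blast
  next
    assume "\<exists>a \<in> A. \<exists>b \<in> B. \<exists>c \<in> C. nat_le S (a \<otimes> b \<otimes> c) x"
    then show "x \<in> ?l" using mult_mem_cd_mult[OF A B] by (auto simp: mem_cd_mult[of _ _ C])
  qed
  moreover have "x \<in> ?r \<longleftrightarrow> (\<exists>a \<in> A. \<exists>b \<in> B. \<exists>c \<in> C. nat_le S (a \<otimes> b \<otimes> c) x)" for x
  proof
    assume "x \<in> ?r"
    then obtain a b y c where *: "a \<in> A" "b \<in> B" "c \<in> C" "nat_le S (b \<otimes> c) y" "nat_le S (a \<otimes> y) x"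
      by (auto simp: mem_cd_mult)
    then have "nat_le S (a \<otimes> (b \<otimes> c)) (a \<otimes> y)" using nat_le_mult cd_sub[OF A] nat_le_refl by blast
    then have "nat_le S (a \<otimes> (b \<otimes> c)) x" using * nat_le_trans by blast
    then show "\<exists>a \<in> A. \<exists>b \<in> B. \<exists>c \<in> C. nat_le S (a \<otimes> b \<otimes> c) x"
      using * mult_assoc cd_sub A B C by metis
  next
    assume "\<exists>a \<in> A. \<exists>b \<in> B. \<exists>c \<in> C. nat_le S (a \<otimes> b \<otimes> c) x"
    then obtain a b c where *: "a \<in> A" "b \<in> B" "c \<in> C" "nat_le S (a \<otimes> (b \<otimes> c)) x"
      using mult_assoc cd_sub A B C by metis
    then show "x \<in> ?r" using mult_mem_cd_mult[OF B C] by (auto simp: mem_cd_mult[of _ A])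
  qed
  ultimately show ?thesis by blast
qed

lemma cd_sinv_image:
  assumes A: "closed_directed S A" shows "closed_directed S (sinv S ` A)"
proof -
  have "sinv S ` A = up_closure S (sinv S ` A)"
  proof
    show "sinv S ` A \<subseteq> up_closure S (sinv S ` A)" using cd_sub[OF A] nat_le_refl unfolding up_closure_def by blast
    show "up_closure S (sinv S ` A) \<subseteq> sinv S ` A"
    proof
      fix x assume "x \<in> up_closure S (sinv S ` A)"
      then obtain a where *: "a \<in> A" "nat_le S (sinv S a) x" "x \<in> carrier S" by (auto simp: up_closure_def)
      then have "sinv S x \<in> A" using nat_le_sinv[of "sinv S a" x] cd_up[OF A, of a] cd_sub[OF A, of a] sinv_sinv by metis
      then show "x \<in> sinv S ` A" using * by (metis image_eqI sinv_sinv)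
    qed
  qed
  moreover have "closed_directed S (up_closure S (sinv S ` A))"
  proof (rule cd_up_closure)
    fix x y assume "x \<in> sinv S ` A" "y \<in> sinv S ` A"
    then obtain a b where ab: "a \<in> A" "b \<in> A" "x = sinv S a" "y = sinv S b" by blast
    obtain c where "c \<in> A" "nat_le S c a" "nat_le S c b" using cd_dir[OF A ab(1,2)] by blast
    then show "\<exists>c \<in> sinv S ` A. nat_le S c x \<and> nat_le S c y" using ab nat_le_sinv by blast
  qed (use cd_ne[OF A] cd_sub[OF A] sinv_closed in blast)+
  ultimately show ?thesis by simp
qed

text \<open>A lower bound \<open>d\<close> of \<open>a\<close>, \<open>b\<close>, \<open>c\<close> in \<open>A\<close> satisfies \<open>d = d d\<inverse> d \<le> a b\<inverse> c\<close>: a closed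
  directed set behaves like a coset.\<close>

lemma cd_ternary:
  assumes A: "closed_directed S A" and "a \<in> A" "b \<in> A" "c \<in> A"
  shows "a \<otimes> sinv S b \<otimes> c \<in> A"
proof -
  obtain d where d: "d \<in> A" "nat_le S d a" "nat_le S d b" "nat_le S d c"
    using cd_dir3[OF A] assms by blast
  have "nat_le S (d \<otimes> sinv S d \<otimes> d) (a \<otimes> sinv S b \<otimes> c)"
    using d by (intro nat_le_mult nat_le_sinv)
  then show ?thesis using cd_up[OF A d(1)] sinv_props(2)[of d] cd_sub[OF A d(1)] by metis
qed

lemma cd_regular:
  assumes A: "closed_directed S A"
  shows "A \<star> (sinv S ` A) \<star> A = A" (is "?l = A")
proof
  have A': "closed_directed S (sinv S ` A)" using cd_sinv_image[OF A] .
  show "A \<subseteq> ?l"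
  proof
    fix a assume a: "a \<in> A"
    have "a \<otimes> sinv S a \<otimes> a \<in> ?l" using a A A' by (intro mult_mem_cd_mult cd_mult_closed) auto
    then show "a \<in> ?l" using sinv_props(2) cd_sub[OF A a] by simp
  qed
  show "?l \<subseteq> A"
  proof
    fix x assume "x \<in> ?l"
    then obtain a b y c where *: "a \<in> A" "b \<in> A" "c \<in> A" "nat_le S (a \<otimes> sinv S b) y" "nat_le S (y \<otimes> c) x"
      by (auto simp: mem_cd_mult)
    then have "nat_le S (a \<otimes> sinv S b \<otimes> c) (y \<otimes> c)" using nat_le_mult cd_sub[OF A] nat_le_refl by blast
    then show "x \<in> A" using * nat_le_trans cd_ternary[OF A, of a b c] cd_up[OF A] by blast
  qed
qed

text \<open>An idempotent \<open>E\<close> of the semigroup of closed directed subsets contains \<open>x\<^sup>2\<close> along with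
  \<open>x\<close>, and any common lower bound \<open>f\<close> of \<open>x\<close> and \<open>x\<^sup>2\<close> is an idempotent of \<open>S\<close>: it equals
  \<open>x f\<close>, from which its domain \<open>p\<close> satisfies \<open>p \<le> f\<close>, so that \<open>f = p\<close>.\<close>

lemma cd_idem_below:
  assumes E: "E \<in> idems (cd_semigroup S)" and x: "x \<in> E"
  shows "\<exists>f \<in> E. f \<in> idems S \<and> nat_le S f x"
proof -
  have cE: "closed_directed S E" and EE: "E \<star> E = E"
    using E by (auto simp: idems_def cd_carrier)
  have "x \<otimes> x \<in> E" using mult_mem_cd_mult[OF cE cE x x] EE by simp
  then obtain f where f: "f \<in> E" "nat_le S f x" "nat_le S f (x \<otimes> x)" using cd_dir[OF cE] x by blast
  have c[simp]: "x \<in> carrier S" "f \<in> carrier S" using f nat_leD by blast+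
  define p where "p = sinv S f \<otimes> f"
  define q where "q = sinv S x \<otimes> x"
  have p: "p \<in> idems S" "q \<in> idems S" and [simp]: "p \<in> carrier S" "q \<in> carrier S"
    by (simp_all add: p_def q_def)
  have fp: "f = x \<otimes> p" "f = x \<otimes> x \<otimes> p"
    using nat_le_dom[OF f(2)] nat_le_dom[OF f(3)] by (simp_all add: p_def)
  then have xf: "f = x \<otimes> f" by (metis c(1) mult_assoc \<open>p \<in> carrier S\<close>)
  have "nat_le S p q" unfolding p_def q_def using f(2) by (intro nat_le_mult nat_le_sinv)
  then have "p = q \<otimes> p"
    using nat_le_ran[of p q] p idem_commute[of p q] by simp
  also have "\<dots> = sinv S x \<otimes> (x \<otimes> p)" by (simp add: q_def mult_assoc)
  also have "\<dots> = sinv S x \<otimes> (x \<otimes> f)" using fp(1) xf by metis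
  also have "\<dots> = q \<otimes> f" by (simp add: q_def mult_assoc)
  finally have "nat_le S p f" using nat_leI_left[of f q] p by simp
  then have "p = f \<otimes> (sinv S p \<otimes> p)" by (rule nat_le_dom)
  also have "\<dots> = f" using p by (simp, simp add: p_def)
  finally show ?thesis using f p by metis
qed

text \<open>By \<open>cd_idem_below\<close> both products are generated by products of commuting idempotents
  of \<open>S\<close>.\<close>

lemma cd_idem_commute:
  assumes E: "E \<in> idems (cd_semigroup S)" and F: "F \<in> idems (cd_semigroup S)"
  shows "E \<star> F = F \<star> E"
proof -
  have "E \<star> F \<subseteq> F \<star> E"
    if E: "E \<in> idems (cd_semigroup S)" and F: "F \<in> idems (cd_semigroup S)" for E F
  proof
    fix x assume "x \<in> E \<star> F"
    then obtain a b where ab: "a \<in> E" "b \<in> F" "nat_le S (a \<otimes> b) x" by (auto simp: mem_cd_mult)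
    obtain a' b' where *: "a' \<in> E" "a' \<in> idems S" "nat_le S a' a" "b' \<in> F" "b' \<in> idems S" "nat_le S b' b"
      using cd_idem_below[OF E ab(1)] cd_idem_below[OF F ab(2)] by blast
    have "nat_le S (b' \<otimes> a') (a \<otimes> b)" using nat_le_mult[OF *(3,6)] idem_commute[OF *(2,5)] by simp
    then show "x \<in> F \<star> E" using * ab nat_le_trans unfolding mem_cd_mult by blast
  qed
  then show ?thesis using E F by blast
qed

lemma image_sinv_sinv: "A \<subseteq> carrier S \<Longrightarrow> sinv S ` sinv S ` A = A"
  by (force simp: image_image)

lemma cd_inverse_semigroup: "inverse_semigroup (cd_semigroup S)"
proof (rule inverse_semigroupI)
  fix A assume "A \<in> carrier (cd_semigroup S)"
  then have A: "closed_directed S A" by (simp add: cd_carrier)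
  then have "A \<star> (sinv S ` A) \<star> A = A" "sinv S ` A \<in> carrier (cd_semigroup S)"
    "(sinv S ` A) \<star> A \<star> (sinv S ` A) = sinv S ` A"
    using cd_regular[OF A] cd_regular[OF cd_sinv_image[OF A]] cd_sinv_image[OF A] cd_sub[OF A]
    by (auto simp: cd_carrier image_sinv_sinv subsetI)
  then show "\<exists>B \<in> carrier (cd_semigroup S). A \<star> B \<star> A = A \<and>
      B \<star> A \<star> B = B" by blast
qed (simp_all add: cd_carrier cd_mult_closed cd_mult_assoc, rule cd_idem_commute)

lemma sinv_cd:
  assumes A: "A \<in> carrier (cd_semigroup S)"
  shows "sinv (cd_semigroup S) A = sinv S ` A"
proof -
  interpret T: inverse_semigroup "cd_semigroup S" by (rule cd_inverse_semigroup)
  have A: "closed_directed S A" using A by (simp add: cd_carrier)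
  show ?thesis using cd_regular[OF A] cd_regular[OF cd_sinv_image[OF A]] cd_sinv_image[OF A] cd_sub[OF A] A
    by (intro T.sinv_eqI) (auto simp: cd_carrier image_sinv_sinv subsetI)
qed

interpretation cd: inverse_semigroup "cd_semigroup S" by (rule cd_inverse_semigroup)

subsection \<open>The principal closed directed subsets\<close>

lemma mem_iota: "x \<in> iota S s \<longleftrightarrow> nat_le S s x"
  by (auto simp: iota_def up_closure_def dest: nat_leD)

lemma mem_iotaD: "x \<in> iota S s \<Longrightarrow> nat_le S s x"
  by (simp add: mem_iota)

lemma self_mem_iota: "s \<in> carrier S \<Longrightarrow> s \<in> iota S s"
  by (simp add: mem_iota)

lemma iota_closed [simp]:
  assumes "s \<in> carrier S" shows "iota S s \<in> carrier (cd_semigroup S)"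
  unfolding iota_def cd_carrier using assms by (intro cd_up_closure) auto

lemma iota_mult:
  assumes [simp]: "s \<in> carrier S" "t \<in> carrier S"
  shows "iota S (s \<otimes> t) = iota S s \<star> iota S t"
proof -
  have "x \<in> iota S s \<star> iota S t" if "nat_le S (s \<otimes> t) x" for x
    using that self_mem_iota[of s] self_mem_iota[of t] assms unfolding mem_cd_mult by blast
  moreover have "nat_le S (s \<otimes> t) x" if "x \<in> iota S s \<star> iota S t" for x
    using that nat_le_mult nat_le_trans using mem_iotaD unfolding mem_cd_mult by blast
  ultimately show ?thesis by (auto simp: mem_iota)
qed

lemma sinv_iota:
  assumes "s \<in> carrier S" shows "(iota S s)\<^sup>\<star> = iota S (sinv S s)"
proof (rule cd.sinv_eqI)
  show "iota S s \<star> iota S (sinv S s) \<star> iota S s = iota S s"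
    using assms by (simp add: mult_assoc flip: iota_mult)
  show "iota S (sinv S s) \<star> iota S s \<star> iota S (sinv S s) = iota S (sinv S s)"
    using assms by (simp add: mult_assoc flip: iota_mult)
qed (use assms in auto)

lemma iota_idem: "q \<in> idems S \<Longrightarrow> iota S q \<in> idems (cd_semigroup S)"
  by (intro cd.idemI) (simp_all flip: iota_mult)

text \<open>A closed directed subset is recovered from each of its elements and its domain: a common
  lower bound \<open>z\<close> of \<open>s, c, d\<close> satisfies \<open>z = z z\<inverse> z \<le> s c\<inverse> d\<close>.\<close>

lemma iota_absorb:
  assumes C: "C \<in> carrier (cd_semigroup S)" and s: "s \<in> C"
  shows "iota S s \<star> (C\<^sup>\<star> \<star> C) = C"
proof -
  have cC: "closed_directed S C" using C by (simp add: cd_carrier)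
  have sc[simp]: "s \<in> carrier S" using cd_sub[OF cC s] .
  have "x \<in> C" if x: "x \<in> iota S s \<star> (C\<^sup>\<star> \<star> C)" for x
  proof -
    obtain s' y where 1: "nat_le S s s'" "y \<in> C\<^sup>\<star> \<star> C" "nat_le S (s' \<otimes> y) x"
      using x mem_iotaD unfolding mem_cd_mult[of _ "iota S s"] by blast
    obtain c d where 2: "c \<in> C" "d \<in> C" "nat_le S (sinv S c \<otimes> d) y"
      using 1(2) unfolding mem_cd_mult sinv_cd[OF C] by blast
    have c: "c \<in> carrier S" "d \<in> carrier S" using 2 cd_sub[OF cC] by auto
    have "nat_le S (s \<otimes> sinv S c \<otimes> d) (s' \<otimes> y)"
      using nat_le_mult[OF 1(1) 2(3)] c by (simp add: mult_assoc)
    then show "x \<in> C" using cd_up[OF cC cd_ternary[OF cC s 2(1,2)]] 1(3) nat_le_trans by blast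
  qed
  moreover have "x \<in> iota S s \<star> (C\<^sup>\<star> \<star> C)" if x: "x \<in> C" for x
  proof -
    obtain d where d: "d \<in> C" "nat_le S d x" "nat_le S d s" using cd_dir[OF cC x s] by blast
    have "sinv S d \<otimes> d \<in> C\<^sup>\<star> \<star> C"
      using d cC C by (intro mult_mem_cd_mult) (auto simp: sinv_cd cd_sinv_image)
    then have "nat_le S (s \<otimes> (sinv S d \<otimes> d)) x" using nat_le_dom[OF d(3)] d(2) by simp
    then show ?thesis using \<open>sinv S d \<otimes> d \<in> _\<close> self_mem_iota[OF sc] unfolding mem_cd_mult[of _ "iota S s"] by blast
  qed
  ultimately show ?thesis by blast
qed

lemma cd_idemD:
  assumes "f \<in> idems (cd_semigroup S)"
  shows "closed_directed S f" "x \<in> f \<Longrightarrow> y \<in> f \<Longrightarrow> x \<otimes> y \<in> f" "x \<in> f \<Longrightarrow> sinv S x \<in> f"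
proof -
  show c: "closed_directed S f" using cd.idem_carrier[OF assms] cd_carrier by blast
  show "x \<in> f \<Longrightarrow> y \<in> f \<Longrightarrow> x \<otimes> y \<in> f" using mult_mem_cd_mult[OF c c] cd.idem_mult[OF assms] by metis
  have "sinv S ` f = f" using sinv_cd[of f] cd.sinv_idem[OF assms] cd.idem_carrier[OF assms] by simp
  then show "x \<in> f \<Longrightarrow> sinv S x \<in> f" by blast
qed

lemma iota_idem_absorb_iff:
  assumes q: "q \<in> idems S" and f: "f \<in> idems (cd_semigroup S)"
  shows "iota S q \<star> f = f \<longleftrightarrow> q \<in> f"
proof
  assume "q \<in> f"
  then show "iota S q \<star> f = f" using iota_absorb[of f q] f by simp
next
  assume *: "iota S q \<star> f = f"
  have c: "closed_directed S f" using cd_idemD[OF f] by blast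
  obtain x where x: "x \<in> f" "x \<in> idems S" using cd_ne[OF c] cd_idem_below[OF f] by blast
  have "x \<in> iota S q \<star> f" using * x by simp
  then obtain q' z where z: "nat_le S q q'" "z \<in> f" "nat_le S (q' \<otimes> z) x" using mem_iotaD unfolding mem_cd_mult by blast
  obtain y where y: "y \<in> f" "y \<in> idems S" "nat_le S y z" using cd_idem_below[OF f z(2)] by blast
  have "q \<otimes> y \<in> iota S q \<star> f"
    using y q by (intro mult_mem_cd_mult[OF _ c]) (auto simp: mem_iota simp flip: cd_carrier)
  then have "q \<otimes> y \<in> f" using * by simp
  then show "q \<in> f" using cd_up[OF c] mult_idem_le(1)[OF q y(2)] by blast
qed

text \<open>Idempotents of \<open>\<L>(S)\<close> are generated by the idempotents of \<open>S\<close> that they contain. This is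
  what allows elements of \<open>S\<close> to separate the weights of an induced module.\<close>

lemma cd_idem_separate:
  assumes f: "f \<in> idems (cd_semigroup S)" and g: "g \<in> idems (cd_semigroup S)" and ne: "f \<noteq> g"
  shows "\<exists>x \<in> idems S. (x \<in> f) \<noteq> (x \<in> g)"
proof (rule ccontr)
  assume *: "\<not> ?thesis"
  have "f' \<subseteq> g'" if "f' \<in> idems (cd_semigroup S)" "g' \<in> idems (cd_semigroup S)"
    "\<And>x. x \<in> idems S \<Longrightarrow> x \<in> f' \<Longrightarrow> x \<in> g'" for f' g'
    using cd_idem_below[OF that(1)] cd_idemD(1)[OF that(2)] cd_up that(3) by blast
  then show False using * f g ne by blast
qed

subsection \<open>The \<open>\<L>\<close>-class and the maximal subgroup of an idempotent\<close>

lemma L_class_iff: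
  "A \<in> L_class S e \<longleftrightarrow> A \<in> carrier (cd_semigroup S) \<and> A\<^sup>\<star> \<star> A = e"
  by (auto simp: L_class_def sinv_cd)

lemma max_subgroup_iff:
  assumes e: "e \<in> idems (cd_semigroup S)"
  shows "g \<in> carrier (max_subgroup S e)
    \<longleftrightarrow> g \<in> carrier (cd_semigroup S) \<and> g\<^sup>\<star> \<star> g = e \<and> g \<star> g\<^sup>\<star> = e"
  using cd.sinv_idem[OF e] cd.idem_mult[OF e] cd.idem_carrier[OF e]
  by (auto simp: max_subgroup_def green_H_def cd.green_L_iff cd.green_R_iff)

lemma green_D_iff:
  assumes e: "e \<in> idems (cd_semigroup S)" and f: "f \<in> idems (cd_semigroup S)"
  shows "green_D (cd_semigroup S) e f \<longleftrightarrow> (\<exists>A \<in> L_class S e. A \<star> A\<^sup>\<star> = f)"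
  using e f by (auto simp: green_D_def cd.green_L_iff cd.green_R_iff L_class_iff)

lemma L_class_carrier: "A \<in> L_class S e \<Longrightarrow> A \<in> carrier (cd_semigroup S)"
  and L_class_dom: "A \<in> L_class S e \<Longrightarrow> A\<^sup>\<star> \<star> A = e"
  by (auto simp: L_class_iff)

lemma L_class_ran: "A \<in> L_class S e \<Longrightarrow> A \<star> A\<^sup>\<star> \<in> idems (cd_semigroup S)"
  by (simp add: L_class_iff)

lemma L_class_unit: "A \<in> L_class S e \<Longrightarrow> A \<star> e = A"
  by (auto simp: L_class_iff)

lemma L_class_idem: "e \<in> idems (cd_semigroup S) \<Longrightarrow> e \<in> L_class S e"
  by (simp add: L_class_iff)

lemma max_subgroup_L_class:
  "\<lbrakk>e \<in> idems (cd_semigroup S); g \<in> carrier (max_subgroup S e)\<rbrakk> \<Longrightarrow> g \<in> L_class S e"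
  by (simp add: L_class_iff max_subgroup_iff)

lemma max_subgroup_one: "e \<in> idems (cd_semigroup S) \<Longrightarrow> e \<in> carrier (max_subgroup S e)"
  by (simp add: max_subgroup_iff)

lemma max_subgroup_unit:
  assumes "e \<in> idems (cd_semigroup S)" "g \<in> carrier (max_subgroup S e)"
  shows "g \<star> e = g" "e \<star> g = g"
  using assms cd.mult_sinv_mult(1)[of g] cd.sinv_props(2)[of g] by (auto simp: max_subgroup_iff)

lemma L_class_mult_subgroup:
  assumes e: "e \<in> idems (cd_semigroup S)" and A: "A \<in> L_class S e" and g: "g \<in> carrier (max_subgroup S e)"
  shows "A \<star> g \<in> L_class S e" "A \<star> g \<star> (A \<star> g)\<^sup>\<star> = A \<star> A\<^sup>\<star>"
proof -
  have c[simp]: "A \<in> carrier (cd_semigroup S)" "g \<in> carrier (cd_semigroup S)" "e \<in> carrier (cd_semigroup S)"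
    using A g e by (auto simp: L_class_iff max_subgroup_iff)
  have "(A \<star> g)\<^sup>\<star> \<star> (A \<star> g) = g\<^sup>\<star> \<star> ((A\<^sup>\<star> \<star> A) \<star> g)" by (simp add: cd.sinv_mult cd.mult_assoc)
  also have "\<dots> = e"
    using g max_subgroup_unit[OF e g] L_class_dom[OF A] by (simp add: max_subgroup_iff[OF e])
  finally show "A \<star> g \<in> L_class S e" by (simp add: L_class_iff)
  have "A \<star> g \<star> (A \<star> g)\<^sup>\<star> = A \<star> (g \<star> g\<^sup>\<star>) \<star> A\<^sup>\<star>" by (simp add: cd.sinv_mult cd.mult_assoc)
  then show "A \<star> g \<star> (A \<star> g)\<^sup>\<star> = A \<star> A\<^sup>\<star>" using g L_class_unit[OF A] by (simp add: max_subgroup_iff[OF e])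
qed

lemma max_subgroup_mult:
  assumes e: "e \<in> idems (cd_semigroup S)"
    and g: "g \<in> carrier (max_subgroup S e)" and h: "h \<in> carrier (max_subgroup S e)"
  shows "g \<star> h \<in> carrier (max_subgroup S e)"
  using L_class_mult_subgroup[OF e max_subgroup_L_class[OF e g] h] g h e
  by (simp add: max_subgroup_iff L_class_iff)

text \<open>Members of the \<open>\<L>\<close>-class with the same weight \<open>A \<star> A\<^sup>\<star>\<close> lie in one orbit of the
  maximal subgroup. So \<open>kL\<^sub>e\<close> is free over \<open>kG\<^sub>e\<close> with one generator for each weight.\<close>

lemma L_class_orbit:
  assumes e: "e \<in> idems (cd_semigroup S)" and A: "A \<in> L_class S e" and B: "B \<in> L_class S e"
    and eq: "A \<star> A\<^sup>\<star> = B \<star> B\<^sup>\<star>"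
  shows "A\<^sup>\<star> \<star> B \<in> carrier (max_subgroup S e)" "A \<star> (A\<^sup>\<star> \<star> B) = B"
proof -
  have c[simp]: "A \<in> carrier (cd_semigroup S)" "B \<in> carrier (cd_semigroup S)" "e \<in> carrier (cd_semigroup S)"
    using A B e by (auto simp: L_class_iff)
  have "A \<star> (A\<^sup>\<star> \<star> B) = (A \<star> A\<^sup>\<star>) \<star> B" by (simp add: cd.mult_assoc)
  then show AB: "A \<star> (A\<^sup>\<star> \<star> B) = B" unfolding eq by (simp add: cd.mult_assoc)
  have "(A\<^sup>\<star> \<star> B)\<^sup>\<star> \<star> (A\<^sup>\<star> \<star> B) = B\<^sup>\<star> \<star> (A \<star> (A\<^sup>\<star> \<star> B))" by (simp add: cd.sinv_mult cd.mult_assoc)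
  then have 1: "(A\<^sup>\<star> \<star> B)\<^sup>\<star> \<star> (A\<^sup>\<star> \<star> B) = e" unfolding AB using L_class_dom[OF B] by simp
  have "(A\<^sup>\<star> \<star> B) \<star> (A\<^sup>\<star> \<star> B)\<^sup>\<star> = A\<^sup>\<star> \<star> (B \<star> B\<^sup>\<star>) \<star> A" by (simp add: cd.sinv_mult cd.mult_assoc)
  also have "\<dots> = A\<^sup>\<star> \<star> A" unfolding eq[symmetric] by (simp add: cd.mult_assoc)
  finally show "A\<^sup>\<star> \<star> B \<in> carrier (max_subgroup S e)"
    using 1 L_class_dom[OF A] by (simp add: max_subgroup_iff[OF e])
qed

text \<open>Let \<open>q\<close> be the domain of \<open>s\<close>. The condition on the left says \<open>A\<^sup>\<star> \<star> \<iota>(q) \<star> A = A\<^sup>\<star> \<star> A\<close>,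
  and multiplying by \<open>A\<close> and \<open>A\<^sup>\<star>\<close> turns it into \<open>\<iota>(q) \<star> f = f\<close> for \<open>f = A \<star> A\<^sup>\<star>\<close>, that is,
  \<open>q \<in> f\<close>. For idempotent \<open>s\<close> this determines the weight of \<open>A\<close>.\<close>

lemma iota_mult_L_class_iff:
  assumes s: "s \<in> carrier S" and A: "A \<in> L_class S e"
  shows "iota S s \<star> A \<in> L_class S e \<longleftrightarrow> sinv S s \<otimes> s \<in> A \<star> A\<^sup>\<star>"
proof -
  let ?q = "iota S (sinv S s \<otimes> s)" and ?f = "A \<star> A\<^sup>\<star>"
  have c[simp]: "A \<in> carrier (cd_semigroup S)" "s \<in> carrier S" using A s by (auto simp: L_class_iff)
  have q: "?q \<in> idems (cd_semigroup S)" using iota_idem dom_idem s by blast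
  have f: "?f \<in> idems (cd_semigroup S)" using L_class_ran[OF A] .
  have eq: "(iota S s \<star> A)\<^sup>\<star> \<star> (iota S s \<star> A) = A\<^sup>\<star> \<star> (?q \<star> A)"
    by (simp add: cd.sinv_mult sinv_iota iota_mult cd.mult_assoc)
  have "A\<^sup>\<star> \<star> (?q \<star> A) = A\<^sup>\<star> \<star> A" if "?q \<star> ?f = ?f"
  proof -
    have "?q \<star> A = (?q \<star> ?f) \<star> A" by (simp add: cd.mult_assoc)
    then show ?thesis unfolding that by (simp add: cd.mult_assoc)
  qed
  moreover have "?q \<star> ?f = ?f" if "A\<^sup>\<star> \<star> (?q \<star> A) = A\<^sup>\<star> \<star> A"
  proof -
    have "?q \<star> ?f = ?q \<star> (?f \<star> ?f)" using f by simp
    also have "\<dots> = (?q \<star> ?f) \<star> ?f" by (simp add: cd.mult_assoc)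
    also have "\<dots> = (?f \<star> ?q) \<star> ?f" using cd.idem_commute[OF q f] by simp
    also have "\<dots> = A \<star> (A\<^sup>\<star> \<star> (?q \<star> A)) \<star> A\<^sup>\<star>" by (simp add: cd.mult_assoc)
    also have "\<dots> = ?f" unfolding that by (simp add: cd.mult_assoc)
    finally show ?thesis .
  qed
  ultimately have "iota S s \<star> A \<in> L_class S e \<longleftrightarrow> ?q \<star> ?f = ?f"
    unfolding L_class_iff eq using L_class_dom[OF A] by auto
  then show ?thesis using iota_idem_absorb_iff[OF _ f] s by simp
qed

text \<open>Any \<open>s\<close> in the closed directed set \<open>B \<star> A\<^sup>\<star>\<close> will do, since by \<open>iota_absorb\<close> it recovers
  all of \<open>B \<star> A\<^sup>\<star>\<close>.\<close>

lemma L_class_transitive: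
  assumes e: "e \<in> idems (cd_semigroup S)" and A: "A \<in> L_class S e" and B: "B \<in> L_class S e"
  shows "\<exists>s \<in> carrier S. iota S s \<star> A = B"
proof -
  have c[simp]: "A \<in> carrier (cd_semigroup S)" "B \<in> carrier (cd_semigroup S)" "e \<in> carrier (cd_semigroup S)"
    using A B e by (auto simp: L_class_iff)
  define C where "C = B \<star> A\<^sup>\<star>"
  have C: "C \<in> carrier (cd_semigroup S)" by (simp add: C_def)
  then obtain s where s: "s \<in> C" using cd_ne cd_carrier by blast
  have sc[simp]: "s \<in> carrier S" using cd_sub s C cd_carrier by blast
  have CA: "C \<star> A = B"
    using L_class_dom[OF A] L_class_unit[OF B] by (simp add: C_def cd.mult_assoc)
  have "C\<^sup>\<star> \<star> C = A \<star> ((B\<^sup>\<star> \<star> B) \<star> A\<^sup>\<star>)" by (simp add: C_def cd.sinv_mult cd.mult_assoc)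
  also have "\<dots> = (A \<star> (A\<^sup>\<star> \<star> A)) \<star> A\<^sup>\<star>"
    unfolding L_class_dom[OF A] L_class_dom[OF B] by (simp add: cd.mult_assoc)
  finally have "C\<^sup>\<star> \<star> C = A \<star> A\<^sup>\<star>" by simp
  then have "iota S s \<star> (A \<star> A\<^sup>\<star>) = C" using iota_absorb[OF C s] by simp
  then have "iota S s \<star> (A \<star> A\<^sup>\<star>) \<star> A = B" using CA by simp
  then show ?thesis using sc by (intro bexI[of _ s]) (simp_all add: cd.mult_assoc)
qed

lemma iota_idem_fix:
  assumes x: "x \<in> idems S" and A: "A \<in> L_class S e" and "x \<in> A \<star> A\<^sup>\<star>"
  shows "iota S x \<star> A = A"
proof -
  have c[simp]: "A \<in> carrier (cd_semigroup S)" "x \<in> carrier S" using A x by (auto simp: L_class_iff)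
  have "iota S x \<star> (A \<star> A\<^sup>\<star>) \<star> A = (A \<star> A\<^sup>\<star>) \<star> A"
    using iota_idem_absorb_iff[OF x L_class_ran[OF A]] assms(3) by simp
  then show ?thesis by (simp add: cd.mult_assoc)
qed

lemma max_subgroup_inv:
  assumes "e \<in> idems (cd_semigroup S)" "g \<in> carrier (max_subgroup S e)"
  shows "g\<^sup>\<star> \<in> carrier (max_subgroup S e)"
  using assms by (auto simp: max_subgroup_iff)

lemma mult_L_class_orbit_iff:
  assumes e: "e \<in> idems (cd_semigroup S)" and B: "B \<in> carrier (cd_semigroup S)"
    and A: "A \<in> L_class S e" and g: "g \<in> carrier (max_subgroup S e)"
  shows "B \<star> (A \<star> g) \<in> L_class S e \<longleftrightarrow> B \<star> A \<in> L_class S e"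
proof
  have c[simp]: "A \<in> carrier (cd_semigroup S)" "g \<in> carrier (cd_semigroup S)" "B \<in> carrier (cd_semigroup S)"
    using A g e B by (auto simp: L_class_iff max_subgroup_iff)
  assume "B \<star> A \<in> L_class S e"
  from L_class_mult_subgroup(1)[OF e this g] show "B \<star> (A \<star> g) \<in> L_class S e"
    by (simp add: cd.mult_assoc)
next
  have c[simp]: "A \<in> carrier (cd_semigroup S)" "g \<in> carrier (cd_semigroup S)" "B \<in> carrier (cd_semigroup S)"
    using A g e B by (auto simp: L_class_iff max_subgroup_iff)
  assume "B \<star> (A \<star> g) \<in> L_class S e"
  from L_class_mult_subgroup(1)[OF e this max_subgroup_inv[OF e g]]
  have "B \<star> (A \<star> (g \<star> g\<^sup>\<star>)) \<in> L_class S e" by (simp add: cd.mult_assoc)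
  then show "B \<star> A \<in> L_class S e" using g L_class_unit[OF A] by (simp add: max_subgroup_iff[OF e])
qed

text \<open>The domain of \<open>st\<close> lies below the domain of \<open>t\<close>. With this the Schuetzenberger action is
  associative also where products leave the \<open>\<L>\<close>-class.\<close>

lemma iota_mult_L_class_cancel:
  assumes s: "s \<in> carrier S" and t: "t \<in> carrier S" and A: "A \<in> L_class S e"
    and st: "iota S (s \<otimes> t) \<star> A \<in> L_class S e"
  shows "iota S t \<star> A \<in> L_class S e"
proof -
  have "sinv S (s \<otimes> t) \<otimes> (s \<otimes> t) \<in> A \<star> A\<^sup>\<star>"
    using st iota_mult_L_class_iff[OF _ A] s t by simp
  moreover have "sinv S (s \<otimes> t) \<otimes> (s \<otimes> t) = sinv S t \<otimes> (sinv S s \<otimes> s) \<otimes> t"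
    using s t by (simp add: sinv_mult mult_assoc)
  moreover have "nat_le S (sinv S t \<otimes> (sinv S s \<otimes> s) \<otimes> t) (sinv S t \<otimes> t)"
    using s t nat_le_mult[OF nat_leI_right[of "sinv S t" "sinv S s \<otimes> s"] nat_le_refl[of t]] by simp
  ultimately have "sinv S t \<otimes> t \<in> A \<star> A\<^sup>\<star>"
    using cd_up[OF cd_idemD(1)[OF L_class_ran[OF A]]] by metis
  then show ?thesis using iota_mult_L_class_iff[OF t A] by blast
qed

subsection \<open>Filters of idempotents\<close>

text \<open>This is how a weight of a module, given as a filter of idempotents of \<open>S\<close>, becomes an
  idempotent of \<open>\<L>(S)\<close>.\<close>

lemma filter_up_closure_idem:
  assumes F: "F \<subseteq> idems S" "F \<noteq> {}"
    and mult: "\<And>x y. \<lbrakk>x \<in> F; y \<in> F\<rbrakk> \<Longrightarrow> x \<otimes> y \<in> F"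
  shows "up_closure S F \<in> idems (cd_semigroup S)"
proof -
  have mem: "x \<in> up_closure S F \<longleftrightarrow> (\<exists>f \<in> F. nat_le S f x)" for x
    by (auto simp: up_closure_def dest: nat_leD)
  have c: "closed_directed S (up_closure S F)"
  proof (rule cd_up_closure)
    fix a b assume "a \<in> F" "b \<in> F"
    then show "\<exists>c \<in> F. nat_le S c a \<and> nat_le S c b"
      using mult F(1) mult_idem_le[of a b] by (intro bexI[of _ "a \<otimes> b"]) auto
  qed (use F idem_carrier in blast)+
  have "up_closure S F \<star> up_closure S F = up_closure S F"
  proof (intro equalityI subsetI)
    fix x assume "x \<in> up_closure S F \<star> up_closure S F"
    then obtain a b f g where *: "f \<in> F" "g \<in> F" "nat_le S f a" "nat_le S g b" "nat_le S (a \<otimes> b) x"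
      using mem unfolding mem_cd_mult by metis
    then have "nat_le S (f \<otimes> g) x" using nat_le_mult nat_le_trans by blast
    then show "x \<in> up_closure S F" using mult * mem by blast
  next
    fix x assume "x \<in> up_closure S F"
    then obtain f where f: "f \<in> F" "nat_le S f x" using mem by blast
    then have "f \<in> idems S" using F(1) by blast
    then have "f \<otimes> f = f" "f \<in> up_closure S F"
      using f(1) mem nat_le_refl[OF idem_carrier, of f] by (simp, blast)
    then show "x \<in> up_closure S F \<star> up_closure S F" unfolding mem_cd_mult using f(2) by metis
  qed
  then show ?thesis using c by (intro cd.idemI) (auto simp: cd_carrier)
qed

lemma filter_up_closure_mem:
  assumes F: "F \<subseteq> idems S" and up: "\<And>x y. \<lbrakk>x \<in> F; y \<in> idems S; nat_le S x y\<rbrakk> \<Longrightarrow> y \<in> F"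
    and x: "x \<in> idems S"
  shows "x \<in> up_closure S F \<longleftrightarrow> x \<in> F"
  using assms nat_le_refl[OF idem_carrier[OF x]] idem_carrier[OF x] unfolding up_closure_def by blast

end

section \<open>Linear maps, spans and bilinear maps\<close>

lemma subspaceI:
  assumes "vectorspace K V" "W \<subseteq> carrier V" "\<zero>\<^bsub>V\<^esub> \<in> W"
    and "\<And>v w. \<lbrakk>v \<in> W; w \<in> W\<rbrakk> \<Longrightarrow> v \<oplus>\<^bsub>V\<^esub> w \<in> W"
    and "\<And>c v. \<lbrakk>c \<in> carrier K; v \<in> W\<rbrakk> \<Longrightarrow> c \<odot>\<^bsub>V\<^esub> v \<in> W"
  shows "subspace K W V"
  using assms by (auto intro!: subspace.intro submodule.intro simp: vectorspace_def)

lemma subspaceD: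
  assumes "subspace K W V"
  shows "vectorspace K V" "W \<subseteq> carrier V" "\<zero>\<^bsub>V\<^esub> \<in> W"
    and "\<And>v w. \<lbrakk>v \<in> W; w \<in> W\<rbrakk> \<Longrightarrow> v \<oplus>\<^bsub>V\<^esub> w \<in> W"
    and "\<And>c v. \<lbrakk>c \<in> carrier K; v \<in> W\<rbrakk> \<Longrightarrow> c \<odot>\<^bsub>V\<^esub> v \<in> W"
proof -
  interpret subspace K W V by fact
  interpret submodule K W V by (rule submod)
  show "vectorspace K V" "W \<subseteq> carrier V" "\<zero>\<^bsub>V\<^esub> \<in> W"
    "\<And>v w. \<lbrakk>v \<in> W; w \<in> W\<rbrakk> \<Longrightarrow> v \<oplus>\<^bsub>V\<^esub> w \<in> W"
    "\<And>c v. \<lbrakk>c \<in> carrier K; v \<in> W\<rbrakk> \<Longrightarrow> c \<odot>\<^bsub>V\<^esub> v \<in> W"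
    using vs subset by auto
qed

lemma module_homI:
  assumes "\<And>v. v \<in> carrier V \<Longrightarrow> h v \<in> carrier W"
    and "\<And>v w. \<lbrakk>v \<in> carrier V; w \<in> carrier V\<rbrakk> \<Longrightarrow> h (v \<oplus>\<^bsub>V\<^esub> w) = h v \<oplus>\<^bsub>W\<^esub> h w"
    and "\<And>c v. \<lbrakk>c \<in> carrier K; v \<in> carrier V\<rbrakk> \<Longrightarrow> h (c \<odot>\<^bsub>V\<^esub> v) = c \<odot>\<^bsub>W\<^esub> h v"
  shows "h \<in> module_hom K V W"
  using assms by (auto simp: module_hom_def)

lemma module_homD:
  assumes "h \<in> module_hom K V W"
  shows "v \<in> carrier V \<Longrightarrow> h v \<in> carrier W"
    and "\<lbrakk>v \<in> carrier V; w \<in> carrier V\<rbrakk> \<Longrightarrow> h (v \<oplus>\<^bsub>V\<^esub> w) = h v \<oplus>\<^bsub>W\<^esub> h w"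
    and "\<lbrakk>c \<in> carrier K; v \<in> carrier V\<rbrakk> \<Longrightarrow> h (c \<odot>\<^bsub>V\<^esub> v) = c \<odot>\<^bsub>W\<^esub> h v"
  using assms by (auto simp: module_hom_def)

lemma module_hom_zero:
  assumes "vectorspace K V" "vectorspace K W" "h \<in> module_hom K V W"
  shows "h \<zero>\<^bsub>V\<^esub> = \<zero>\<^bsub>W\<^esub>"
proof -
  interpret V: vectorspace K V by fact
  interpret W: vectorspace K W by fact
  have "h (\<zero>\<^bsub>K\<^esub> \<odot>\<^bsub>V\<^esub> \<zero>\<^bsub>V\<^esub>) = \<zero>\<^bsub>K\<^esub> \<odot>\<^bsub>W\<^esub> h \<zero>\<^bsub>V\<^esub>"
    using module_homD(3)[OF assms(3), of "\<zero>\<^bsub>K\<^esub>" "\<zero>\<^bsub>V\<^esub>"] by simp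
  then show ?thesis using module_homD(1)[OF assms(3)] by simp
qed

lemma module_hom_compose:
  assumes "g \<in> module_hom K U V" "h \<in> module_hom K V W"
  shows "(\<lambda>u. h (g u)) \<in> module_hom K U W"
  using assms by (auto simp: module_hom_def Pi_def)

lemma module_hom_cong:
  assumes "vectorspace K V" "h \<in> module_hom K V W" "\<And>v. v \<in> carrier V \<Longrightarrow> g v = h v"
  shows "g \<in> module_hom K V W"
proof -
  interpret vectorspace K V by fact
  show ?thesis using module_homD[OF assms(2)] by (intro module_homI) (simp_all add: assms(3))
qed

lemma module_hom_add:
  assumes "vectorspace K V" "g \<in> module_hom K U V" "h \<in> module_hom K U V"
  shows "(\<lambda>u. g u \<oplus>\<^bsub>V\<^esub> h u) \<in> module_hom K U V"
proof -
  interpret vectorspace K V by fact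
  show ?thesis
    using module_homD[OF assms(2)] module_homD[OF assms(3)]
    by (intro module_homI) (simp_all add: M.a_ac smult_r_distr)
qed

lemma module_hom_smult:
  assumes "vectorspace K V" "c \<in> carrier K" shows "smult V c \<in> module_hom K V V"
proof -
  interpret vectorspace K V by fact
  show ?thesis
  proof (rule module_homI)
    fix d v assume "d \<in> carrier K" "v \<in> carrier V"
    then show "c \<odot>\<^bsub>V\<^esub> (d \<odot>\<^bsub>V\<^esub> v) = d \<odot>\<^bsub>V\<^esub> (c \<odot>\<^bsub>V\<^esub> v)"
      using assms(2) by (metis smult_assoc1 R.m_comm)
  qed (use assms(2) smult_r_distr in auto)
qed

lemma vimage_subspace:
  assumes "vectorspace K V" "h \<in> module_hom K V W" "subspace K U W"
  shows "subspace K {v \<in> carrier V. h v \<in> U} V"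
proof -
  interpret V: vectorspace K V by fact
  note U = subspaceD[OF assms(3)]
  show ?thesis
    using module_homD[OF assms(2)] module_hom_zero[OF assms(1) U(1) assms(2)] U(3-)
    by (intro subspaceI[OF assms(1)]) auto
qed

lemma zero_subspace:
  assumes "vectorspace K V" shows "subspace K {\<zero>\<^bsub>V\<^esub>} V"
proof -
  interpret vectorspace K V by fact
  show ?thesis by (rule subspaceI) (auto simp: assms)
qed

lemma carrier_subspace:
  assumes "vectorspace K V" shows "subspace K (carrier V) V"
proof -
  interpret vectorspace K V by fact
  show ?thesis by (rule subspaceI) (auto simp: assms)
qed

lemma span_subset_subspace:
  assumes "subspace K W V" "X \<subseteq> W" shows "module.span K V X \<subseteq> W"
proof -
  interpret subspace K W V by fact
  interpret vectorspace K V by (rule vs)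
  show ?thesis using span_is_subset[OF assms(2) submod] .
qed

lemma span_superset:
  assumes "vectorspace K V" "X \<subseteq> carrier V" "x \<in> X" shows "x \<in> module.span K V X"
proof -
  interpret vectorspace K V by fact
  show ?thesis using in_own_span[OF assms(2)] assms(3) by blast
qed

lemma span_subspace:
  assumes "vectorspace K V" "X \<subseteq> carrier V" shows "subspace K (module.span K V X) V"
  using vectorspace.span_is_subspace[OF assms] .

lemma span_carrier:
  assumes "vectorspace K V" shows "module.span K V (carrier V) = carrier V"
  using subspaceD(2)[OF span_subspace[OF assms subset_refl]] span_superset[OF assms subset_refl] by blast

lemma vectorspace_cong:
  assumes "vectorspace K V"
    and eq: "carrier V' = carrier V" "zero V' = zero V" "add V' = add V" "smult V' = smult V"
  shows "vectorspace K V'"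
proof -
  interpret V: vectorspace K V by fact
  show ?thesis
  proof (rule vs_criteria[OF V.field_axioms])
    show "\<forall>v \<in> carrier V'. \<exists>w \<in> carrier V'. v \<oplus>\<^bsub>V'\<^esub> w = \<zero>\<^bsub>V'\<^esub>"
      unfolding eq using V.M.r_neg V.M.a_inv_closed by blast
  qed (auto simp: eq V.M.a_ac V.smult_l_distr V.smult_r_distr V.smult_assoc1)
qed

text \<open>A record such as \<open>Ind K S e N\<close> differs from the space it is built from only in its action;
  this and the previous fact carry the linear structure over.\<close>

lemma span_cong:
  assumes V: "vectorspace K V"
    and eq: "carrier V' = carrier V" "zero V' = zero V" "add V' = add V" "smult V' = smult V"
    and X: "X \<subseteq> carrier V"
  shows "module.span K V' X = module.span K V X"
proof -
  have V': "vectorspace K V'" by (rule vectorspace_cong[OF V eq])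
  have X': "X \<subseteq> carrier V'" using X eq by simp
  note s = span_subspace[OF V X] and s' = span_subspace[OF V' X']
  note sup = span_superset[OF V X] and sup' = span_superset[OF V' X']
  have "subspace K (module.span K V X) V'" using subspaceD[OF s] by (intro subspaceI[OF V']) (simp_all add: eq)
  moreover have "subspace K (module.span K V' X) V" using subspaceD[OF s'] by (intro subspaceI[OF V]) (simp_all add: eq)
  ultimately show ?thesis
    using span_subset_subspace[of K "module.span K V X" V' X] span_subset_subspace[of K "module.span K V' X" V X]
      sup sup' by blast
qed

lemma module_hom_eq_on_span:
  assumes V: "vectorspace K V" and W: "vectorspace K W"
    and g: "g \<in> module_hom K V W" and h: "h \<in> module_hom K V W"
    and X: "X \<subseteq> carrier V" "module.span K V X = carrier V"
    and eq: "\<And>x. x \<in> X \<Longrightarrow> g x = h x" and v: "v \<in> carrier V"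
  shows "g v = h v"
proof -
  interpret V: vectorspace K V by fact
  have "subspace K {v \<in> carrier V. g v = h v} V"
    using module_homD[OF g] module_homD[OF h] module_hom_zero[OF V W g] module_hom_zero[OF V W h]
    by (intro subspaceI[OF V]) auto
  from span_subset_subspace[OF this, of X] X eq v show ?thesis by auto
qed

definition bilinear ::
  "('k, 'c) ring_scheme \<Rightarrow> ('k, 'u, 'd) module_scheme \<Rightarrow> ('k, 'v, 'e) module_scheme \<Rightarrow>
   ('k, 'w, 'f) module_scheme \<Rightarrow> ('u \<Rightarrow> 'v \<Rightarrow> 'w) \<Rightarrow> bool" where
  "bilinear K U V W b \<longleftrightarrow>
     (\<forall>u \<in> carrier U. b u \<in> module_hom K V W) \<and>
     (\<forall>v \<in> carrier V. (\<lambda>u. b u v) \<in> module_hom K U W)"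

lemma bilinear_left: "\<lbrakk>bilinear K U V W b; u \<in> carrier U\<rbrakk> \<Longrightarrow> b u \<in> module_hom K V W"
  and bilinear_right: "\<lbrakk>bilinear K U V W b; v \<in> carrier V\<rbrakk> \<Longrightarrow> (\<lambda>u. b u v) \<in> module_hom K U W"
  by (auto simp: bilinear_def)

lemma bilinear_closed: "\<lbrakk>bilinear K U V W b; u \<in> carrier U; v \<in> carrier V\<rbrakk> \<Longrightarrow> b u v \<in> carrier W"
  by (auto simp: bilinear_def module_hom_def)

lemma bilinear_compose_hom:
  assumes "bilinear K U V W b" "h \<in> module_hom K W Z"
  shows "bilinear K U V Z (\<lambda>u v. h (b u v))"
  using module_hom_compose[OF bilinear_left[OF assms(1)] assms(2)]
    module_hom_compose[OF bilinear_right[OF assms(1)] assms(2)]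
  by (simp add: bilinear_def)

lemma bilinear_compose_left:
  assumes "bilinear K U V W b" "g \<in> module_hom K U' U"
  shows "bilinear K U' V W (\<lambda>u v. b (g u) v)"
  using module_hom_compose[OF assms(2) bilinear_right[OF assms(1)]]
    bilinear_left[OF assms(1) module_homD(1)[OF assms(2)]]
  by (simp add: bilinear_def)

lemma bilinear_compose_right:
  assumes "bilinear K U V W b" "g \<in> module_hom K V' V"
  shows "bilinear K U V' W (\<lambda>u v. b u (g v))"
  using module_hom_compose[OF assms(2) bilinear_left[OF assms(1)]]
    bilinear_right[OF assms(1) module_homD(1)[OF assms(2)]]
  by (simp add: bilinear_def)

lemma bilinear_zero:
  assumes "bilinear K U V W b" "vectorspace K U" "vectorspace K V" "vectorspace K W"
  shows "v \<in> carrier V \<Longrightarrow> b \<zero>\<^bsub>U\<^esub> v = \<zero>\<^bsub>W\<^esub>" "u \<in> carrier U \<Longrightarrow> b u \<zero>\<^bsub>V\<^esub> = \<zero>\<^bsub>W\<^esub>"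
  using module_hom_zero[OF assms(2,4) bilinear_right[OF assms(1)]]
    module_hom_zero[OF assms(3,4) bilinear_left[OF assms(1)]] by auto

lemma bilinear_eq_on_spans:
  assumes U: "vectorspace K U" and V: "vectorspace K V" and W: "vectorspace K W"
    and b: "bilinear K U V W b" and c: "bilinear K U V W c"
    and X: "X \<subseteq> carrier U" "module.span K U X = carrier U"
    and Y: "Y \<subseteq> carrier V" "module.span K V Y = carrier V"
    and eq: "\<And>x y. \<lbrakk>x \<in> X; y \<in> Y\<rbrakk> \<Longrightarrow> b x y = c x y"
    and u: "u \<in> carrier U" and v: "v \<in> carrier V"
  shows "b u v = c u v"
proof -
  have "b x v = c x v" if "x \<in> X" for x
    using module_hom_eq_on_span[OF V W bilinear_left[OF b] bilinear_left[OF c] Y eq[OF that] v] that X(1)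
    by blast
  then show ?thesis
    using module_hom_eq_on_span[OF U W bilinear_right[OF b v] bilinear_right[OF c v] X _ u] by blast
qed

lemma finsum_module_hom:
  assumes V: "vectorspace K V" and W: "vectorspace K W"
    and X: "finite X" and h: "\<And>x. x \<in> X \<Longrightarrow> h x \<in> module_hom K V W"
  shows "(\<lambda>v. \<Oplus>\<^bsub>W\<^esub>x\<in>X. h x v) \<in> module_hom K V W"
  using X h
proof (induction X)
  case empty
  interpret V: vectorspace K V by fact
  interpret W: vectorspace K W by fact
  show ?case by (rule module_homI) auto
next
  case (insert x X)
  interpret V: vectorspace K V by fact
  interpret W: vectorspace K W by fact
  let ?s = "\<lambda>v. \<Oplus>\<^bsub>W\<^esub>x\<in>X. h x v"
  have s: "?s \<in> module_hom K V W" using insert by blast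
  have x: "h x \<in> module_hom K V W" using insert by blast
  have eq: "(\<Oplus>\<^bsub>W\<^esub>x\<in>insert x X. h x v) = h x v \<oplus>\<^bsub>W\<^esub> ?s v" if "v \<in> carrier V" for v
    using insert that module_homD(1)[of _ K V W] by (intro W.finsum_insert) auto
  note c = module_homD(1)[OF s] module_homD(1)[OF x]
  show ?case
  proof (rule module_homI)
    fix v w assume vw: "v \<in> carrier V" "w \<in> carrier V"
    then show "(\<Oplus>\<^bsub>W\<^esub>x\<in>insert x X. h x (v \<oplus>\<^bsub>V\<^esub> w))
        = (\<Oplus>\<^bsub>W\<^esub>x\<in>insert x X. h x v) \<oplus>\<^bsub>W\<^esub> (\<Oplus>\<^bsub>W\<^esub>x\<in>insert x X. h x w)"
      using eq module_homD(2)[OF s] module_homD(2)[OF x] c by (simp add: W.a_ac)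
  next
    fix k v assume "k \<in> carrier K" "v \<in> carrier V"
    then show "(\<Oplus>\<^bsub>W\<^esub>x\<in>insert x X. h x (k \<odot>\<^bsub>V\<^esub> v)) = k \<odot>\<^bsub>W\<^esub> (\<Oplus>\<^bsub>W\<^esub>x\<in>insert x X. h x v)"
      using eq module_homD(3)[OF s] module_homD(3)[OF x] c by (simp add: W.smult_r_distr)
  qed (use eq c in auto)
qed


section \<open>Finite dimension\<close>

lemma fin_dimI:
  assumes "vectorspace K V" "finite X" "X \<subseteq> carrier V" "module.span K V X = carrier V"
  shows "vectorspace.fin_dim K V"
  using assms by (auto simp: vectorspace.fin_dim_def)

lemma fin_dimE:
  assumes "vectorspace K V" "vectorspace.fin_dim K V"
  obtains X where "finite X" "X \<subseteq> carrier V" "module.span K V X = carrier V"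
  using assms by (auto simp: vectorspace.fin_dim_def)

lemma fin_dim_surj_image:
  assumes V: "vectorspace K V" and W: "vectorspace K W" and h: "h \<in> module_hom K V W"
    and surj: "h ` carrier V = carrier W" and fd: "vectorspace.fin_dim K V"
  shows "vectorspace.fin_dim K W"
proof -
  obtain X where X: "finite X" "X \<subseteq> carrier V" "module.span K V X = carrier V"
    by (rule fin_dimE[OF V fd])
  have hX: "h ` X \<subseteq> carrier W" unfolding surj[symmetric] using X(2) by (rule image_mono)
  note sX = span_subspace[OF W hX]
  have "X \<subseteq> {v \<in> carrier V. h v \<in> module.span K W (h ` X)}"
    using X(2) span_superset[OF W hX] by blast
  from span_subset_subspace[OF vimage_subspace[OF V h sX] this, unfolded X(3)]
  have "h ` carrier V \<subseteq> module.span K W (h ` X)" by blast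
  then have "module.span K W (h ` X) = carrier W"
    unfolding surj by (rule equalityI[OF subspaceD(2)[OF sX]])
  then show ?thesis using X(1) hX by (intro fin_dimI[OF W, of "h ` X"]) auto
qed

text \<open>The measure is the largest size of a linearly independent subset: such a subset of \<open>U\<close> stays
  independent when a vector outside \<open>U\<close> is added. It makes descent along subspaces possible.\<close>

lemma subspace_measure:
  fixes V :: "('k, 'v, 'd) module_scheme"
  assumes V: "vectorspace K V" and fd: "vectorspace.fin_dim K V"
  shows "\<exists>d :: 'v set \<Rightarrow> nat. \<forall>U U'. subspace K U V \<and> subspace K U' V \<and> U \<subset> U' \<longrightarrow> d U < d U'"
proof -
  interpret vectorspace K V by fact
  define Q where "Q U = {card B | B. B \<subseteq> U \<and> B \<subseteq> carrier V \<and> lin_indpt B}" for U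
  have Q: "finite (Q U)" for U
    by (rule finite_subset[of _ "{..dim}"]) (auto simp: Q_def dest: li_le_dim(2)[OF fd])
  have "lin_indpt {}" unfolding lin_dep_def by simp
  then have ne: "Q U \<noteq> {}" for U unfolding Q_def by blast
  have "Max (Q U) < Max (Q U')" if U: "subspace K U V" and U': "subspace K U' V" and sub: "U \<subset> U'" for U U'
  proof -
    from Max_in[OF Q ne, of U] obtain B where
      B: "Max (Q U) = card B" "B \<subseteq> U" "B \<subseteq> carrier V" "lin_indpt B" by (auto simp: Q_def)
    obtain v where v: "v \<in> U'" "v \<notin> U" using sub by blast
    have vV: "v \<in> carrier V" using subspaceD(2)[OF U'] v by blast
    have nv: "v \<notin> span B" using span_subset_subspace[OF U B(2)] v by blast
    have vB: "v \<notin> B" using B(2) v(2) by (rule contra_subsetD)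
    have "lin_indpt (B \<union> {v})"
      using lin_dep_iff_in_span[OF B(3,4) vV vB] nv by simp
    moreover have "B \<union> {v} \<subseteq> U'" "B \<union> {v} \<subseteq> carrier V" using B(2,3) v(1) sub vV by auto
    ultimately have "card (B \<union> {v}) \<in> Q U'" unfolding Q_def by blast
    then have "card (B \<union> {v}) \<le> Max (Q U')" by (rule Max_ge[OF Q])
    moreover have "card (B \<union> {v}) = Suc (card B)"
      using li_le_dim(1)[OF fd B(3,4)] vB by simp
    ultimately show ?thesis using B(1) by simp
  qed
  then show ?thesis by (intro exI[of _ "\<lambda>U. Max (Q U)"] allI impI) blast
qed


section \<open>Free vector spaces\<close>

lemma free_space_simps [simp]:
  "f \<in> carrier (free_space K B) \<longleftrightarrow> (\<forall>x. f x \<in> carrier K) \<and> finite (supp K f) \<and> supp K f \<subseteq> B"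
  "\<zero>\<^bsub>free_space K B\<^esub> = (\<lambda>x. \<zero>\<^bsub>K\<^esub>)"
  "f \<oplus>\<^bsub>free_space K B\<^esub> g = (\<lambda>x. f x \<oplus>\<^bsub>K\<^esub> g x)"
  "c \<odot>\<^bsub>free_space K B\<^esub> f = (\<lambda>x. c \<otimes>\<^bsub>K\<^esub> f x)"
  by (auto simp: free_space_def)

lemma free_space_vectorspace:
  assumes "field K" shows "vectorspace K (free_space K B)"
proof -
  interpret field K by fact
  have fs: "finite (supp K h)" "supp K h \<subseteq> B"
    if "supp K h \<subseteq> supp K f \<union> supp K g" "f \<in> carrier (free_space K B)" "g \<in> carrier (free_space K B)"
    for f g h :: "_ \<Rightarrow> _"
    using that finite_subset[OF that(1)] by auto
  have neg: "\<exists>g \<in> carrier (free_space K B). f \<oplus>\<^bsub>free_space K B\<^esub> g = \<zero>\<^bsub>free_space K B\<^esub>"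
    if "f \<in> carrier (free_space K B)" for f
    using that fs[of "\<lambda>x. \<ominus>\<^bsub>K\<^esub> f x" f f]
    by (intro bexI[of _ "\<lambda>x. \<ominus>\<^bsub>K\<^esub> f x"]) (auto simp: r_neg supp_def)
  show ?thesis
  proof (rule vs_criteria, rule assms)
    show "\<forall>v w. v \<in> carrier (free_space K B) \<and> w \<in> carrier (free_space K B) \<longrightarrow>
        v \<oplus>\<^bsub>free_space K B\<^esub> w \<in> carrier (free_space K B)"
    proof clarify
      fix f g assume fg: "f \<in> carrier (free_space K B)" "g \<in> carrier (free_space K B)"
      have "supp K (\<lambda>x. f x \<oplus>\<^bsub>K\<^esub> g x) \<subseteq> supp K f \<union> supp K g" by (auto simp: supp_def)
      from fs[OF this fg] show "f \<oplus>\<^bsub>free_space K B\<^esub> g \<in> carrier (free_space K B)" using fg by simp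
    qed
    show "\<forall>c v. c \<in> carrier K \<and> v \<in> carrier (free_space K B) \<longrightarrow>
        c \<odot>\<^bsub>free_space K B\<^esub> v \<in> carrier (free_space K B)"
    proof clarify
      fix c f assume fg: "c \<in> carrier K" "f \<in> carrier (free_space K B)"
      have "supp K (\<lambda>x. c \<otimes>\<^bsub>K\<^esub> f x) \<subseteq> supp K f \<union> supp K f" using fg(1) by (auto simp: supp_def)
      from fs[OF this fg(2,2)] show "c \<odot>\<^bsub>free_space K B\<^esub> f \<in> carrier (free_space K B)" using fg by simp
    qed
  qed (use neg in \<open>auto simp: supp_def a_ac m_ac l_distr r_distr\<close>)
qed

lemma basis_vec_in_free_space:
  assumes "field K" "b \<in> B" shows "basis_vec K b \<in> carrier (free_space K B)"
proof -
  interpret field K by fact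
  have "supp K (basis_vec K b) = {b}" by (auto simp: supp_def basis_vec_def)
  then show ?thesis using assms(2) by (auto simp: basis_vec_def)
qed

lemma supp_basis_vec:
  assumes "field K" shows "supp K (basis_vec K b) = {b}"
proof -
  interpret field K by fact
  show ?thesis by (auto simp: supp_def basis_vec_def)
qed

lemma basis_vecs_span:
  assumes "field K"
  shows "module.span K (free_space K B) (basis_vec K ` B) = carrier (free_space K B)"
proof -
  interpret field K by fact
  let ?F = "free_space K B" and ?U = "module.span K (free_space K B) (basis_vec K ` B)"
  have F: "vectorspace K ?F" by (rule free_space_vectorspace[OF assms])
  have sub: "basis_vec K ` B \<subseteq> carrier ?F" by (intro image_subsetI basis_vec_in_free_space[OF assms])
  note U = span_subspace[OF F sub]
  have "f \<in> ?U" if "finite X" "f \<in> carrier ?F" "supp K f = X" for f X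
    using that
  proof (induction X arbitrary: f)
    case empty
    then have "f = \<zero>\<^bsub>?F\<^esub>" by (auto simp: supp_def)
    then show ?case using subspaceD(3)[OF U] by metis
  next
    case (insert x X)
    define g where "g = f(x := \<zero>\<^bsub>K\<^esub>)"
    have "supp K g = X" using insert by (auto simp: g_def supp_def split: if_splits)
    moreover have "g \<in> carrier ?F" using insert \<open>supp K g = X\<close> by (auto simp: g_def)
    ultimately have "g \<in> ?U" using insert by blast
    moreover have "basis_vec K x \<in> ?U" using insert span_superset[OF F sub] by auto
    moreover have "f = f x \<odot>\<^bsub>?F\<^esub> basis_vec K x \<oplus>\<^bsub>?F\<^esub> g"
      using insert by (auto simp: g_def basis_vec_def)
    ultimately show ?case using subspaceD(4,5)[OF U] insert(4) by (metis free_space_simps(1))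
  qed
  then show ?thesis using subspaceD(2)[OF U] by auto
qed

lemma free_space_hom_subspace:
  assumes K: "field K" and h: "h \<in> module_hom K (free_space K B) V" and U: "subspace K U V"
    and basis: "\<And>b. b \<in> B \<Longrightarrow> h (basis_vec K b) \<in> U" and f: "f \<in> carrier (free_space K B)"
  shows "h f \<in> U"
proof -
  have "basis_vec K ` B \<subseteq> {f \<in> carrier (free_space K B). h f \<in> U}"
    by (intro image_subsetI CollectI conjI basis_vec_in_free_space[OF K] basis)
  from span_subset_subspace[OF vimage_subspace[OF free_space_vectorspace[OF K] h U] this,
      unfolded basis_vecs_span[OF K]]
  show ?thesis using f by blast
qed

lemma free_space_hom_eqI:
  assumes K: "field K" and V: "vectorspace K V"
    and "g \<in> module_hom K (free_space K B) V" "h \<in> module_hom K (free_space K B) V"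
    and "\<And>b. b \<in> B \<Longrightarrow> g (basis_vec K b) = h (basis_vec K b)" and "f \<in> carrier (free_space K B)"
  shows "g f = h f"
proof (rule module_hom_eq_on_span[OF free_space_vectorspace[OF K] V assms(3,4)])
  show "basis_vec K ` B \<subseteq> carrier (free_space K B)"
    by (intro image_subsetI basis_vec_in_free_space[OF K])
  show "module.span K (free_space K B) (basis_vec K ` B) = carrier (free_space K B)"
    by (rule basis_vecs_span[OF K])
qed (use assms in auto)

lemma free_space_bilinear_eqI:
  assumes K: "field K" and V: "vectorspace K V"
    and g: "bilinear K (free_space K B) (free_space K C) V g"
    and h: "bilinear K (free_space K B) (free_space K C) V h"
    and eq: "\<And>b c. \<lbrakk>b \<in> B; c \<in> C\<rbrakk> \<Longrightarrow> g (basis_vec K b) (basis_vec K c) = h (basis_vec K b) (basis_vec K c)"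
    and x: "x \<in> carrier (free_space K B)" and y: "y \<in> carrier (free_space K C)"
  shows "g x y = h x y"
proof (rule free_space_hom_eqI[OF K V bilinear_right[OF g y] bilinear_right[OF h y] _ x])
  fix b assume b: "b \<in> B"
  note bb = basis_vec_in_free_space[OF K b]
  show "g (basis_vec K b) y = h (basis_vec K b) y"
    by (rule free_space_hom_eqI[OF K V bilinear_left[OF g bb] bilinear_left[OF h bb] eq[OF b] y])
qed

text \<open>The operators \<open>lin_ext\<close> and \<open>bilin_ext\<close> sum pointwise in the field. Here the sum is taken in
  the target space, so that linearity is proved once for all targets.\<close>

definition lift where
  "lift K V m f = (\<Oplus>\<^bsub>V\<^esub>s\<in>supp K f. f s \<odot>\<^bsub>V\<^esub> m s)"

lemma lift_superset:
  assumes V: "vectorspace K V" and m: "\<And>b. b \<in> B \<Longrightarrow> m b \<in> carrier V"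
    and X: "finite X" "supp K f \<subseteq> X" "X \<subseteq> B" and f: "f \<in> carrier (free_space K B)"
  shows "lift K V m f = (\<Oplus>\<^bsub>V\<^esub>s\<in>X. f s \<odot>\<^bsub>V\<^esub> m s)"
proof -
  interpret vectorspace K V by fact
  show ?thesis unfolding lift_def
    using X f m by (intro add.finprod_mono_neutral_cong_left) (auto simp: supp_def)
qed

lemma lift_hom:
  assumes K: "field K" and V: "vectorspace K V" and m: "\<And>b. b \<in> B \<Longrightarrow> m b \<in> carrier V"
  shows "lift K V m \<in> module_hom K (free_space K B) V"
proof -
  interpret vectorspace K V by fact
  show ?thesis
  proof (rule module_homI)
    fix f assume "f \<in> carrier (free_space K B)"
    then show "lift K V m f \<in> carrier V" using m by (auto simp: lift_def intro!: finsum_closed)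
  next
    fix f g assume fg: "f \<in> carrier (free_space K B)" "g \<in> carrier (free_space K B)"
    let ?X = "supp K f \<union> supp K g"
    have X: "finite ?X" "?X \<subseteq> B" using fg by auto
    have fg': "f \<oplus>\<^bsub>free_space K B\<^esub> g \<in> carrier (free_space K B)" "supp K (f \<oplus>\<^bsub>free_space K B\<^esub> g) \<subseteq> ?X"
    proof -
      interpret F: vectorspace K "free_space K B" by (rule free_space_vectorspace[OF K])
      show "f \<oplus>\<^bsub>free_space K B\<^esub> g \<in> carrier (free_space K B)" using fg by (rule F.M.a_closed)
    qed (auto simp: supp_def)
    have c: "f s \<odot>\<^bsub>V\<^esub> m s \<in> carrier V" "g s \<odot>\<^bsub>V\<^esub> m s \<in> carrier V"
      "(f s \<oplus>\<^bsub>K\<^esub> g s) \<odot>\<^bsub>V\<^esub> m s = f s \<odot>\<^bsub>V\<^esub> m s \<oplus>\<^bsub>V\<^esub> g s \<odot>\<^bsub>V\<^esub> m s" if "s \<in> ?X" for s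
      using X that m[of s] fg by (auto simp: smult_l_distr)
    have "lift K V m (f \<oplus>\<^bsub>free_space K B\<^esub> g) = (\<Oplus>\<^bsub>V\<^esub>s\<in>?X. (f s \<oplus>\<^bsub>K\<^esub> g s) \<odot>\<^bsub>V\<^esub> m s)"
      using lift_superset[OF V m X(1) fg'(2) X(2) fg'(1)] by simp
    also have "\<dots> = (\<Oplus>\<^bsub>V\<^esub>s\<in>?X. f s \<odot>\<^bsub>V\<^esub> m s \<oplus>\<^bsub>V\<^esub> g s \<odot>\<^bsub>V\<^esub> m s)"
      using c by (intro M.finsum_cong') auto
    also have "\<dots> = (\<Oplus>\<^bsub>V\<^esub>s\<in>?X. f s \<odot>\<^bsub>V\<^esub> m s) \<oplus>\<^bsub>V\<^esub> (\<Oplus>\<^bsub>V\<^esub>s\<in>?X. g s \<odot>\<^bsub>V\<^esub> m s)"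
      using c by (intro M.finsum_addf) auto
    also have "\<dots> = lift K V m f \<oplus>\<^bsub>V\<^esub> lift K V m g"
      using lift_superset[OF V m X(1) _ X(2) fg(1)] lift_superset[OF V m X(1) _ X(2) fg(2)] by simp
    finally show "lift K V m (f \<oplus>\<^bsub>free_space K B\<^esub> g) = lift K V m f \<oplus>\<^bsub>V\<^esub> lift K V m g" .
  next
    fix c f assume c: "c \<in> carrier K" and f: "f \<in> carrier (free_space K B)"
    have X: "finite (supp K f)" "supp K f \<subseteq> B" using f by auto
    have cf: "c \<odot>\<^bsub>free_space K B\<^esub> f \<in> carrier (free_space K B)" "supp K (c \<odot>\<^bsub>free_space K B\<^esub> f) \<subseteq> supp K f"
    proof -
      interpret F: vectorspace K "free_space K B" by (rule free_space_vectorspace[OF K])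
      show "c \<odot>\<^bsub>free_space K B\<^esub> f \<in> carrier (free_space K B)" using c f by (rule F.smult_closed)
    qed (use c in \<open>auto simp: supp_def\<close>)
    have "lift K V m (c \<odot>\<^bsub>free_space K B\<^esub> f) = (\<Oplus>\<^bsub>V\<^esub>s\<in>supp K f. (c \<otimes>\<^bsub>K\<^esub> f s) \<odot>\<^bsub>V\<^esub> m s)"
      using lift_superset[OF V m X(1) cf(2) X(2) cf(1)] by simp
    also have "\<dots> = (\<Oplus>\<^bsub>V\<^esub>s\<in>supp K f. c \<odot>\<^bsub>V\<^esub> (f s \<odot>\<^bsub>V\<^esub> m s))"
      using c f m by (intro M.finsum_cong') (auto simp: smult_assoc1 subset_iff)
    also have "\<dots> = c \<odot>\<^bsub>V\<^esub> lift K V m f"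
      unfolding lift_def using c f m by (intro finsum_smult[symmetric]) auto
    finally show "lift K V m (c \<odot>\<^bsub>free_space K B\<^esub> f) = c \<odot>\<^bsub>V\<^esub> lift K V m f" .
  qed
qed

lemma lift_basis_vec:
  assumes K: "field K" and V: "vectorspace K V" and m: "m b \<in> carrier V"
  shows "lift K V m (basis_vec K b) = m b"
proof -
  interpret vectorspace K V by fact
  show ?thesis unfolding lift_def supp_basis_vec[OF K] using m by (simp add: basis_vec_def)
qed

lemma finsum_free_space_apply:
  assumes K: "field K" and X: "finite X" and g: "\<And>x. x \<in> X \<Longrightarrow> g x \<in> carrier (free_space K C)"
  shows "(\<Oplus>\<^bsub>free_space K C\<^esub>x\<in>X. g x) u = (\<Oplus>\<^bsub>K\<^esub>x\<in>X. g x u)"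
  using X g
proof (induction X)
  case empty
  interpret F: vectorspace K "free_space K C" by (rule free_space_vectorspace[OF K])
  show ?case using F.M.finsum_empty[of g] by simp
next
  case (insert x X)
  interpret F: vectorspace K "free_space K C" by (rule free_space_vectorspace[OF K])
  have "(\<Oplus>\<^bsub>free_space K C\<^esub>x\<in>insert x X. g x) = g x \<oplus>\<^bsub>free_space K C\<^esub> (\<Oplus>\<^bsub>free_space K C\<^esub>x\<in>X. g x)"
    using insert by (intro F.M.finsum_insert) auto
  moreover have "(\<Oplus>\<^bsub>K\<^esub>x\<in>insert x X. g x u) = g x u \<oplus>\<^bsub>K\<^esub> (\<Oplus>\<^bsub>K\<^esub>x\<in>X. g x u)"
    using insert by (intro F.R.finsum_insert) auto
  ultimately show ?case using insert by simp
qed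

lemma lin_ext_eq_lift:
  assumes K: "field K" and m: "\<And>b. b \<in> B \<Longrightarrow> m b \<in> carrier (free_space K C)"
    and f: "f \<in> carrier (free_space K B)"
  shows "lin_ext K m f = lift K (free_space K C) m f"
proof
  fix u
  interpret F: vectorspace K "free_space K C" by (rule free_space_vectorspace[OF K])
  have "f s \<odot>\<^bsub>free_space K C\<^esub> m s \<in> carrier (free_space K C)" if "s \<in> supp K f" for s
    using f that by (intro F.smult_closed m) auto
  then have "(\<Oplus>\<^bsub>free_space K C\<^esub>s\<in>supp K f. f s \<odot>\<^bsub>free_space K C\<^esub> m s) u
      = (\<Oplus>\<^bsub>K\<^esub>s\<in>supp K f. (f s \<odot>\<^bsub>free_space K C\<^esub> m s) u)"
    using f by (intro finsum_free_space_apply[OF K]) auto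
  then show "lin_ext K m f u = lift K (free_space K C) m f u" by (simp add: lin_ext_def lift_def)
qed

lemma lin_ext_hom:
  assumes K: "field K" and m: "\<And>b. b \<in> B \<Longrightarrow> m b \<in> carrier (free_space K C)"
  shows "lin_ext K m \<in> module_hom K (free_space K B) (free_space K C)"
proof -
  show ?thesis
    by (rule module_hom_cong[OF free_space_vectorspace[OF K]
          lift_hom[OF K free_space_vectorspace[OF K] m] lin_ext_eq_lift[OF K m]])
qed

lemma lin_ext_basis_vec:
  assumes K: "field K" and m: "m b \<in> carrier (free_space K C)"
  shows "lin_ext K m (basis_vec K b) = m b"
proof -
  have "lin_ext K m (basis_vec K b) = lift K (free_space K C) m (basis_vec K b)"
    using m by (intro lin_ext_eq_lift[OF K, of "{b}" m C] basis_vec_in_free_space[OF K]) auto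
  then show ?thesis using lift_basis_vec[OF K free_space_vectorspace[OF K, of C], of m b] m by simp
qed

text \<open>Writing the double sum as an iterated linear extension reduces bilinearity to the linear
  case.\<close>

lemma bilin_ext_eq_lin_ext:
  assumes K: "field K" and m: "\<And>s t. \<lbrakk>s \<in> B; t \<in> C\<rbrakk> \<Longrightarrow> m s t \<in> carrier (free_space K D)"
    and f: "f \<in> carrier (free_space K B)" and g: "g \<in> carrier (free_space K C)"
  shows "bilin_ext K m f g = lin_ext K (\<lambda>s. lin_ext K (m s) g) f"
proof
  fix u
  interpret field K by fact
  have c: "m s t u \<in> carrier K" "f s \<in> carrier K" "g t \<in> carrier K"
    if "s \<in> supp K f" "t \<in> supp K g" for s t
    using that f g m[of s t] by auto
  have "(\<Oplus>\<^bsub>K\<^esub>t\<in>supp K g. f s \<otimes>\<^bsub>K\<^esub> g t \<otimes>\<^bsub>K\<^esub> m s t u) = f s \<otimes>\<^bsub>K\<^esub> (\<Oplus>\<^bsub>K\<^esub>t\<in>supp K g. g t \<otimes>\<^bsub>K\<^esub> m s t u)"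
    if s: "s \<in> supp K f" for s
  proof -
    have "(\<Oplus>\<^bsub>K\<^esub>t\<in>supp K g. f s \<otimes>\<^bsub>K\<^esub> g t \<otimes>\<^bsub>K\<^esub> m s t u) = (\<Oplus>\<^bsub>K\<^esub>t\<in>supp K g. f s \<otimes>\<^bsub>K\<^esub> (g t \<otimes>\<^bsub>K\<^esub> m s t u))"
      using c[OF s] by (intro finsum_cong') (auto simp: m_assoc)
    also have "\<dots> = f s \<otimes>\<^bsub>K\<^esub> (\<Oplus>\<^bsub>K\<^esub>t\<in>supp K g. g t \<otimes>\<^bsub>K\<^esub> m s t u)"
      using c[OF s] f g by (intro finsum_rdistr[symmetric]) auto
    finally show ?thesis .
  qed
  moreover have "f s \<otimes>\<^bsub>K\<^esub> (\<Oplus>\<^bsub>K\<^esub>t\<in>supp K g. g t \<otimes>\<^bsub>K\<^esub> m s t u) \<in> carrier K" if "s \<in> supp K f" for s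
    using c[OF that] f by (intro m_closed finsum_closed) auto
  ultimately show "bilin_ext K m f g u = lin_ext K (\<lambda>s. lin_ext K (m s) g) f u"
    unfolding bilin_ext_def lin_ext_def by (intro finsum_cong') auto
qed

lemma bilin_ext_bilinear:
  assumes K: "field K" and m: "\<And>s t. \<lbrakk>s \<in> B; t \<in> C\<rbrakk> \<Longrightarrow> m s t \<in> carrier (free_space K D)"
  shows "bilinear K (free_space K B) (free_space K C) (free_space K D) (bilin_ext K m)"
proof -
  let ?B = "free_space K B" and ?C = "free_space K C" and ?D = "free_space K D"
  interpret B: vectorspace K ?B by (rule free_space_vectorspace[OF K])
  interpret C: vectorspace K ?C by (rule free_space_vectorspace[OF K])
  interpret D: vectorspace K ?D by (rule free_space_vectorspace[OF K])
  note e = bilin_ext_eq_lin_ext[OF K m]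
  have in_hom: "lin_ext K (m s) \<in> module_hom K ?C ?D" if "s \<in> B" for s
    using m[OF that] by (intro lin_ext_hom[OF K]) auto
  have in_closed: "lin_ext K (m s) g \<in> carrier ?D" if "s \<in> B" "g \<in> carrier ?C" for s g
    using module_homD(1)[OF in_hom] that by blast
  have 1: "(\<lambda>f. bilin_ext K m f g) \<in> module_hom K ?B ?D" if g: "g \<in> carrier ?C" for g
  proof -
    have h: "lin_ext K (\<lambda>s. lin_ext K (m s) g) \<in> module_hom K ?B ?D"
      using in_closed g by (intro lin_ext_hom[OF K]) blast
    show ?thesis by (rule module_hom_cong[OF B.vectorspace_axioms h e[OF _ _ _ g]])
  qed
  moreover have "bilin_ext K m f \<in> module_hom K ?C ?D" if f: "f \<in> carrier ?B" for f
  proof -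
    have e': "bilin_ext K m f g = (\<Oplus>\<^bsub>?D\<^esub>s\<in>supp K f. f s \<odot>\<^bsub>?D\<^esub> lin_ext K (m s) g)"
      if "g \<in> carrier ?C" for g
    proof -
      have "bilin_ext K m f g = lin_ext K (\<lambda>s. lin_ext K (m s) g) f" by (rule e[OF _ _ f that])
      also have "\<dots> = lift K ?D (\<lambda>s. lin_ext K (m s) g) f"
        using in_closed that by (intro lin_ext_eq_lift[OF K _ f]) blast
      finally show ?thesis by (simp only: lift_def)
    qed
    have h: "(\<lambda>g. \<Oplus>\<^bsub>?D\<^esub>s\<in>supp K f. f s \<odot>\<^bsub>?D\<^esub> lin_ext K (m s) g) \<in> module_hom K ?C ?D"
    proof (rule finsum_module_hom[OF C.vectorspace_axioms D.vectorspace_axioms])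
      fix s assume "s \<in> supp K f"
      then show "(\<lambda>g. f s \<odot>\<^bsub>?D\<^esub> lin_ext K (m s) g) \<in> module_hom K ?C ?D"
        using f by (intro module_hom_compose[OF in_hom module_hom_smult[OF D.vectorspace_axioms]]) auto
    qed (use f in simp)
    show ?thesis by (rule module_hom_cong[OF C.vectorspace_axioms h e'])
  qed
  ultimately show ?thesis by (simp only: bilinear_def) blast
qed

lemma bilin_ext_basis_vec:
  assumes K: "field K" and m: "m s t \<in> carrier (free_space K D)"
  shows "bilin_ext K m (basis_vec K s) (basis_vec K t) = m s t"
proof -
  have "bilin_ext K m (basis_vec K s) (basis_vec K t)
      = lin_ext K (\<lambda>s. lin_ext K (m s) (basis_vec K t)) (basis_vec K s)"
    using m by (intro bilin_ext_eq_lin_ext[OF K, of "{s}" "{t}" m D] basis_vec_in_free_space[OF K]) auto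
  also have "\<dots> = lin_ext K (m s) (basis_vec K t)"
    using m lin_ext_basis_vec[OF K, of "m s" t D] by (intro lin_ext_basis_vec[OF K, of _ _ D]) simp
  finally show ?thesis using lin_ext_basis_vec[OF K, of "m s" t D] m by simp
qed

section \<open>Quotient spaces\<close>

text \<open>From here on free spaces are unfolded into functions only on request.\<close>

declare free_space_simps [simp del]

lemma subspace_abelian_subgroup:
  assumes "subspace K W V" shows "abelian_subgroup W V"
proof -
  note W = subspaceD[OF assms]
  interpret vectorspace K V by (rule W(1))
  have "\<ominus>\<^bsub>V\<^esub> w \<in> W" if "w \<in> W" for w
    using W(5)[of "\<ominus>\<^bsub>K\<^esub> \<one>\<^bsub>K\<^esub>" w] that W(2) by (auto simp: smult_l_minus)
  then have "subgroup W (add_monoid V)"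
    using W by unfold_locales (auto simp: a_inv_def[symmetric])
  then show ?thesis
    by (intro abelian_subgroupI3 additive_subgroupI M.abelian_group_axioms)
qed

text \<open>The formula on the left is the shape in which both the scalar multiplication of a quotient
  space and the action on a tensor product are defined.\<close>

lemma coset_image:
  assumes W: "subspace K W V" and h: "h \<in> module_hom K V V" "h ` W \<subseteq> W" and v: "v \<in> carrier V"
  shows "W <+>\<^bsub>V\<^esub> h ` (W +>\<^bsub>V\<^esub> v) = W +>\<^bsub>V\<^esub> h v"
proof -
  note W = subspaceD[OF W]
  interpret vectorspace K V by (rule W(1))
  note hh = module_homD[OF h(1)]
  show ?thesis
  proof (intro equalityI subsetI)
    fix x assume "x \<in> W <+>\<^bsub>V\<^esub> h ` (W +>\<^bsub>V\<^esub> v)"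
    then obtain w w' where w: "w \<in> W" "w' \<in> W" "x = w \<oplus>\<^bsub>V\<^esub> h (w' \<oplus>\<^bsub>V\<^esub> v)"
      by (auto simp: set_add_def' a_r_coset_def')
    then have "x = (w \<oplus>\<^bsub>V\<^esub> h w') \<oplus>\<^bsub>V\<^esub> h v" using W(2) v hh by (simp add: M.a_assoc subset_iff)
    moreover have "w \<oplus>\<^bsub>V\<^esub> h w' \<in> W" using w W(4) h(2) by blast
    ultimately show "x \<in> W +>\<^bsub>V\<^esub> h v" by (auto simp: a_r_coset_def')
  next
    fix x assume "x \<in> W +>\<^bsub>V\<^esub> h v"
    then obtain w where "w \<in> W" "x = w \<oplus>\<^bsub>V\<^esub> h v" by (auto simp: a_r_coset_def')
    moreover have "v \<in> W +>\<^bsub>V\<^esub> v" using W(3) v by (force simp: a_r_coset_def')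
    ultimately show "x \<in> W <+>\<^bsub>V\<^esub> h ` (W +>\<^bsub>V\<^esub> v)" by (auto simp: set_add_def')
  qed
qed

lemma quotient_space_simps:
  assumes W: "subspace K W V"
  shows "carrier (quotient_space V W) = (\<lambda>v. W +>\<^bsub>V\<^esub> v) ` carrier V"
    and "\<zero>\<^bsub>quotient_space V W\<^esub> = W +>\<^bsub>V\<^esub> \<zero>\<^bsub>V\<^esub>"
    and "\<lbrakk>v \<in> carrier V; w \<in> carrier V\<rbrakk> \<Longrightarrow>
      (W +>\<^bsub>V\<^esub> v) \<oplus>\<^bsub>quotient_space V W\<^esub> (W +>\<^bsub>V\<^esub> w) = W +>\<^bsub>V\<^esub> (v \<oplus>\<^bsub>V\<^esub> w)"
    and "\<lbrakk>c \<in> carrier K; v \<in> carrier V\<rbrakk> \<Longrightarrow>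
      c \<odot>\<^bsub>quotient_space V W\<^esub> (W +>\<^bsub>V\<^esub> v) = W +>\<^bsub>V\<^esub> (c \<odot>\<^bsub>V\<^esub> v)"
proof -
  interpret W: abelian_subgroup W V by (rule subspace_abelian_subgroup[OF W])
  show "carrier (quotient_space V W) = (\<lambda>v. W +>\<^bsub>V\<^esub> v) ` carrier V"
    by (auto simp: quotient_space_def A_RCOSETS_def')
  show "\<zero>\<^bsub>quotient_space V W\<^esub> = W +>\<^bsub>V\<^esub> \<zero>\<^bsub>V\<^esub>"
    using W.a_subset by (simp add: quotient_space_def)
  show "(W +>\<^bsub>V\<^esub> v) \<oplus>\<^bsub>quotient_space V W\<^esub> (W +>\<^bsub>V\<^esub> w) = W +>\<^bsub>V\<^esub> (v \<oplus>\<^bsub>V\<^esub> w)"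
    if "v \<in> carrier V" "w \<in> carrier V"
    using that by (simp add: quotient_space_def W.a_rcos_sum)
  show "c \<odot>\<^bsub>quotient_space V W\<^esub> (W +>\<^bsub>V\<^esub> v) = W +>\<^bsub>V\<^esub> (c \<odot>\<^bsub>V\<^esub> v)"
    if "c \<in> carrier K" "v \<in> carrier V"
    using coset_image[OF W module_hom_smult[OF subspaceD(1)[OF W] that(1)] _ that(2)] subspaceD(5)[OF W that(1)]
    by (auto simp: quotient_space_def)
qed

lemma quotient_vectorspace:
  assumes K: "field K" and W: "subspace K W V" shows "vectorspace K (quotient_space V W)"
proof -
  interpret V: vectorspace K V by (rule subspaceD(1)[OF W])
  note q = quotient_space_simps[OF W]
  show ?thesis
  proof (rule vs_criteria[OF K])
    show "\<forall>v \<in> carrier (quotient_space V W). \<exists>w \<in> carrier (quotient_space V W).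
        v \<oplus>\<^bsub>quotient_space V W\<^esub> w = \<zero>\<^bsub>quotient_space V W\<^esub>"
    proof
      fix C assume "C \<in> carrier (quotient_space V W)"
      then obtain v where "v \<in> carrier V" "C = W +>\<^bsub>V\<^esub> v" using q(1) by blast
      then show "\<exists>w \<in> carrier (quotient_space V W). C \<oplus>\<^bsub>quotient_space V W\<^esub> w = \<zero>\<^bsub>quotient_space V W\<^esub>"
        by (intro bexI[of _ "W +>\<^bsub>V\<^esub> (\<ominus>\<^bsub>V\<^esub> v)"]) (simp_all add: q V.M.r_neg)
    qed
  qed (auto simp: q V.M.a_ac V.smult_l_distr V.smult_r_distr V.smult_assoc1)
qed

lemma quotient_proj_hom:
  assumes W: "subspace K W V" shows "(\<lambda>v. W +>\<^bsub>V\<^esub> v) \<in> module_hom K V (quotient_space V W)"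
  using quotient_space_simps[OF W] by (intro module_homI) auto

lemma quotient_proj_zero:
  assumes W: "subspace K W V" and w: "w \<in> W" shows "W +>\<^bsub>V\<^esub> w = \<zero>\<^bsub>quotient_space V W\<^esub>"
proof -
  interpret W: abelian_subgroup W V by (rule subspace_abelian_subgroup[OF W])
  show ?thesis using w W.a_subset W.a_subgroup by (simp add: quotient_space_def W.a_coset_join2 subset_iff)
qed

lemma quotient_descend:
  assumes K: "field K" and W: "subspace K W V" and U: "vectorspace K U"
    and h: "h \<in> module_hom K V U" and van: "\<And>w. w \<in> W \<Longrightarrow> h w = \<zero>\<^bsub>U\<^esub>"
  shows "\<exists>g \<in> module_hom K (quotient_space V W) U. \<forall>v \<in> carrier V. g (W +>\<^bsub>V\<^esub> v) = h v"
proof -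
  note WD = subspaceD[OF W]
  interpret V: vectorspace K V by (rule WD(1))
  interpret U: vectorspace K U by fact
  note q = quotient_space_simps[OF W]
  note hh = module_homD[OF h]
  have eq: "h v = h w" if vw: "v \<in> carrier V" "w \<in> carrier V" "W +>\<^bsub>V\<^esub> v = W +>\<^bsub>V\<^esub> w" for v w
  proof -
    have "v \<in> W +>\<^bsub>V\<^esub> v" using WD(3) vw by (force simp: a_r_coset_def')
    then obtain u where "u \<in> W" "v = u \<oplus>\<^bsub>V\<^esub> w" using vw(3) by (auto simp: a_r_coset_def')
    then show ?thesis using hh vw WD(2) van by auto
  qed
  define g where "g C = h (SOME v. v \<in> carrier V \<and> C = W +>\<^bsub>V\<^esub> v)" for C
  have g: "g (W +>\<^bsub>V\<^esub> v) = h v" if "v \<in> carrier V" for v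
  proof -
    have "\<exists>u. u \<in> carrier V \<and> W +>\<^bsub>V\<^esub> v = W +>\<^bsub>V\<^esub> u" using that by blast
    from someI_ex[OF this] show ?thesis unfolding g_def using eq that by metis
  qed
  have "g \<in> module_hom K (quotient_space V W) U"
    by (rule module_homI) (auto simp: q g hh)
  then show ?thesis using g by blast
qed


section \<open>Tensor products\<close>

text \<open>The two closure conditions ensure that the relations of the tensor product lie in the free
  space on pairs. The vector \<open>x \<otimes> n\<close> is written \<open>tens x n\<close>.\<close>

locale tensor_setup =
  fixes K :: "('k, 'c) ring_scheme" and A :: "('k, 'a, 'd) module_scheme"
    and X :: "('k, 'b, 'x, 'e) amodule_scheme" and r :: "'x \<Rightarrow> 'a \<Rightarrow> 'x"
    and N :: "('k, 'a, 'n, 'f) amodule_scheme"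
  assumes K: "field K" and X: "vectorspace K X" and N: "vectorspace K N"
    and r_closed: "\<lbrakk>x \<in> carrier X; a \<in> carrier A\<rbrakk> \<Longrightarrow> r x a \<in> carrier X"
    and N_closed: "\<lbrakk>a \<in> carrier A; n \<in> carrier N\<rbrakk> \<Longrightarrow> a \<rhd>\<^bsub>N\<^esub> n \<in> carrier N"
begin

abbreviation "F \<equiv> free_space K (carrier X \<times> carrier N)"
abbreviation "\<delta> x n \<equiv> basis_vec K (x, n)"
abbreviation "W \<equiv> module.span K F (tensor_relations K A X r N)"
abbreviation "T \<equiv> tensor_module K A X r N"

definition "tens x n = W +>\<^bsub>F\<^esub> \<delta> x n"

sublocale X: vectorspace K X by (rule X)
sublocale N: vectorspace K N by (rule N)
sublocale F: vectorspace K F by (rule free_space_vectorspace[OF K])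

lemma delta_closed [simp]: "\<lbrakk>x \<in> carrier X; n \<in> carrier N\<rbrakk> \<Longrightarrow> \<delta> x n \<in> carrier F"
  by (rule basis_vec_in_free_space[OF K]) simp

lemma relations_closed: "tensor_relations K A X r N \<subseteq> carrier F"
  unfolding tensor_relations_def Let_def
  by (auto simp: r_closed N_closed intro!: F.M.minus_closed F.M.a_closed F.smult_closed)

lemma W_subspace: "subspace K W F"
  by (rule span_subspace[OF F.vectorspace_axioms relations_closed])

lemma T_carrier: "carrier T = carrier (quotient_space F W)"
  and T_zero: "\<zero>\<^bsub>T\<^esub> = \<zero>\<^bsub>quotient_space F W\<^esub>"
  and T_add: "add T = add (quotient_space F W)"
  and T_smult: "smult T = smult (quotient_space F W)"
  and T_act: "act T b C = W <+>\<^bsub>F\<^esub> lin_ext K (\<lambda>(x, n). \<delta> (b \<rhd>\<^bsub>X\<^esub> x) n) ` C"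
  by (simp_all add: tensor_module_def Let_def with_act_def)

lemma T_vectorspace: "vectorspace K T"
  by (rule vectorspace_cong[OF quotient_vectorspace[OF K W_subspace] T_carrier T_zero T_add T_smult])

lemma proj_hom: "(\<lambda>v. W +>\<^bsub>F\<^esub> v) \<in> module_hom K F T"
  using quotient_proj_hom[OF W_subspace] by (simp add: module_hom_def T_carrier T_add T_smult)

lemma hom_T_iff: "module_hom K T U = module_hom K (quotient_space F W) U"
  by (simp add: module_hom_def T_carrier T_add T_smult)

lemma relation_tens:
  assumes "f \<ominus>\<^bsub>F\<^esub> g \<in> tensor_relations K A X r N" "f \<in> carrier F" "g \<in> carrier F"
  shows "W +>\<^bsub>F\<^esub> f = W +>\<^bsub>F\<^esub> g"
proof -
  interpret T: vectorspace K T by (rule T_vectorspace)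
  have d: "f \<ominus>\<^bsub>F\<^esub> g \<in> carrier F" "f \<ominus>\<^bsub>F\<^esub> g \<in> W"
    using assms(1) relations_closed span_superset[OF F.vectorspace_axioms relations_closed] by blast+
  have "f = (f \<ominus>\<^bsub>F\<^esub> g) \<oplus>\<^bsub>F\<^esub> g" using assms(2,3)
    by (metis F.M.a_inv_closed F.M.add.inv_solve_right' F.M.minus_closed a_minus_def)
  then have "W +>\<^bsub>F\<^esub> f = (W +>\<^bsub>F\<^esub> (f \<ominus>\<^bsub>F\<^esub> g)) \<oplus>\<^bsub>T\<^esub> (W +>\<^bsub>F\<^esub> g)"
    using module_homD(2)[OF proj_hom d(1) assms(3)] by metis
  also have "\<dots> = W +>\<^bsub>F\<^esub> g"
    using quotient_proj_zero[OF W_subspace d(2), folded T_zero] module_homD(1)[OF proj_hom assms(3)]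
    by simp
  finally show ?thesis .
qed

lemma tens_bilinear: "bilinear K X N T tens"
proof -
  note p = module_homD[OF proj_hom]
  have c: "tens x n \<in> carrier T" if "x \<in> carrier X" "n \<in> carrier N" for x n
    unfolding tens_def using that by (intro p(1) delta_closed)
  have add_l: "tens (x \<oplus>\<^bsub>X\<^esub> y) n = tens x n \<oplus>\<^bsub>T\<^esub> tens y n"
    if "x \<in> carrier X" "y \<in> carrier X" "n \<in> carrier N" for x y n
  proof -
    have "\<delta> (x \<oplus>\<^bsub>X\<^esub> y) n \<ominus>\<^bsub>F\<^esub> (\<delta> x n \<oplus>\<^bsub>F\<^esub> \<delta> y n) \<in> tensor_relations K A X r N"
      using that unfolding tensor_relations_def Let_def by blast
    from trans[OF relation_tens[OF this delta_closed[OF X.M.a_closed[OF that(1,2)] that(3)] F.M.a_closed[OF delta_closed[OF that(1,3)] delta_closed[OF that(2,3)]]] p(2)[OF delta_closed[OF that(1,3)] delta_closed[OF that(2,3)]]]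
    show ?thesis unfolding tens_def .
  qed
  have add_r: "tens x (m \<oplus>\<^bsub>N\<^esub> n) = tens x m \<oplus>\<^bsub>T\<^esub> tens x n"
    if "x \<in> carrier X" "m \<in> carrier N" "n \<in> carrier N" for x m n
  proof -
    have "\<delta> x (m \<oplus>\<^bsub>N\<^esub> n) \<ominus>\<^bsub>F\<^esub> (\<delta> x m \<oplus>\<^bsub>F\<^esub> \<delta> x n) \<in> tensor_relations K A X r N"
      using that unfolding tensor_relations_def Let_def by blast
    from trans[OF relation_tens[OF this delta_closed[OF that(1) N.M.a_closed[OF that(2,3)]] F.M.a_closed[OF delta_closed[OF that(1,2)] delta_closed[OF that(1,3)]]] p(2)[OF delta_closed[OF that(1,2)] delta_closed[OF that(1,3)]]]
    show ?thesis unfolding tens_def .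
  qed
  have smult_l: "tens (c \<odot>\<^bsub>X\<^esub> x) n = c \<odot>\<^bsub>T\<^esub> tens x n"
    if "c \<in> carrier K" "x \<in> carrier X" "n \<in> carrier N" for c x n
  proof -
    have "\<delta> (c \<odot>\<^bsub>X\<^esub> x) n \<ominus>\<^bsub>F\<^esub> c \<odot>\<^bsub>F\<^esub> \<delta> x n \<in> tensor_relations K A X r N"
      using that unfolding tensor_relations_def Let_def by blast
    from trans[OF relation_tens[OF this delta_closed[OF X.smult_closed[OF that(1,2)] that(3)] F.smult_closed[OF that(1) delta_closed[OF that(2,3)]]] p(3)[OF that(1) delta_closed[OF that(2,3)]]]
    show ?thesis unfolding tens_def .
  qed
  have smult_r: "tens x (c \<odot>\<^bsub>N\<^esub> n) = c \<odot>\<^bsub>T\<^esub> tens x n"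
    if "c \<in> carrier K" "x \<in> carrier X" "n \<in> carrier N" for c x n
  proof -
    have "\<delta> x (c \<odot>\<^bsub>N\<^esub> n) \<ominus>\<^bsub>F\<^esub> c \<odot>\<^bsub>F\<^esub> \<delta> x n \<in> tensor_relations K A X r N"
      using that unfolding tensor_relations_def Let_def by blast
    from trans[OF relation_tens[OF this delta_closed[OF that(2) N.smult_closed[OF that(1,3)]] F.smult_closed[OF that(1) delta_closed[OF that(2,3)]]] p(3)[OF that(1) delta_closed[OF that(2,3)]]]
    show ?thesis unfolding tens_def .
  qed
  show ?thesis unfolding bilinear_def
    by (intro conjI ballI module_homI) (rule c add_l add_r smult_l smult_r; assumption)+
qed

lemma tens_balanced:
  assumes "x \<in> carrier X" "a \<in> carrier A" "n \<in> carrier N"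
  shows "tens (r x a) n = tens x (a \<rhd>\<^bsub>N\<^esub> n)"
proof -
  have "\<delta> (r x a) n \<ominus>\<^bsub>F\<^esub> \<delta> x (a \<rhd>\<^bsub>N\<^esub> n) \<in> tensor_relations K A X r N"
    using assms unfolding tensor_relations_def Let_def by blast
  from relation_tens[OF this delta_closed[OF r_closed[OF assms(1,2)] assms(3)]
      delta_closed[OF assms(1) N_closed[OF assms(2,3)]]]
  show ?thesis unfolding tens_def .
qed

lemma tens_span: "module.span K T {tens x n | x n. x \<in> carrier X \<and> n \<in> carrier N} = carrier T"
  (is "module.span K T ?G = _")
proof -
  have G: "?G \<subseteq> carrier T" using bilinear_closed[OF tens_bilinear] by blast
  have sub: "subspace K {v \<in> carrier F. (W +>\<^bsub>F\<^esub> v) \<in> module.span K T ?G} F"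
    by (rule vimage_subspace[OF F.vectorspace_axioms proj_hom span_subspace[OF T_vectorspace G]])
  have "basis_vec K ` (carrier X \<times> carrier N) \<subseteq> {v \<in> carrier F. (W +>\<^bsub>F\<^esub> v) \<in> module.span K T ?G}"
  proof clarify
    fix x n assume xn: "x \<in> carrier X" "n \<in> carrier N"
    then have "tens x n \<in> module.span K T ?G" by (intro span_superset[OF T_vectorspace G]) blast
    then show "\<delta> x n \<in> carrier F \<and> W +>\<^bsub>F\<^esub> \<delta> x n \<in> module.span K T ?G"
      unfolding tens_def by (rule conjI[OF delta_closed[OF xn]])
  qed
  from span_subset_subspace[OF sub this, unfolded basis_vecs_span[OF K]]
  have "(\<lambda>v. W +>\<^bsub>F\<^esub> v) ` carrier F \<subseteq> module.span K T ?G" by blast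
  then show ?thesis
    unfolding T_carrier quotient_space_simps(1)[OF W_subspace, symmetric]
    using subspaceD(2)[OF span_subspace[OF T_vectorspace G], unfolded T_carrier] by (rule equalityI[rotated])
qed

text \<open>The linear extension of a balanced bilinear map vanishes on each of the five families of
  relations.\<close>

lemma tens_universal:
  assumes U: "vectorspace K U" and b: "bilinear K X N U b"
    and bal: "\<And>x a n. \<lbrakk>x \<in> carrier X; a \<in> carrier A; n \<in> carrier N\<rbrakk> \<Longrightarrow> b (r x a) n = b x (a \<rhd>\<^bsub>N\<^esub> n)"
  shows "\<exists>h \<in> module_hom K T U. \<forall>x \<in> carrier X. \<forall>n \<in> carrier N. h (tens x n) = b x n"
proof -
  interpret U: vectorspace K U by (rule U)
  let ?l = "lift K U (\<lambda>(x, n). b x n)"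
  have bc: "(\<lambda>(x, n). b x n) p \<in> carrier U" if "p \<in> carrier X \<times> carrier N" for p
    using that bilinear_closed[OF b] by auto
  have l: "?l \<in> module_hom K F U" by (rule lift_hom[OF K U bc])
  interpret l: mod_hom K F U ?l using l by unfold_locales
  have d: "?l (\<delta> x n) = b x n" if "x \<in> carrier X" "n \<in> carrier N" for x n
    using lift_basis_vec[OF K U, of "\<lambda>(x, n). b x n" "(x, n)"] bc[of "(x, n)"] that by simp
  have self: "u \<ominus>\<^bsub>U\<^esub> u = \<zero>\<^bsub>U\<^esub>" if "u \<in> carrier U" for u
    using that by (simp add: a_minus_def U.M.r_neg)
  have "?l f = \<zero>\<^bsub>U\<^esub>" if "f \<in> tensor_relations K A X r N" for f
    using that module_homD[OF bilinear_left[OF b]] module_homD[OF bilinear_right[OF b]] bal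
    unfolding tensor_relations_def Let_def
    by (auto simp: d self l.f_minus r_closed N_closed
        intro!: F.M.a_closed F.smult_closed)
  then have "W \<subseteq> {v \<in> carrier F. ?l v \<in> {\<zero>\<^bsub>U\<^esub>}}"
    using relations_closed
    by (intro span_subset_subspace vimage_subspace[OF F.vectorspace_axioms l zero_subspace[OF U]]) blast
  then have "?l w = \<zero>\<^bsub>U\<^esub>" if "w \<in> W" for w using that by blast
  from bexE[OF quotient_descend[OF K W_subspace U l this]] obtain h where
    h: "h \<in> module_hom K (quotient_space F W) U" "\<forall>v \<in> carrier F. h (W +>\<^bsub>F\<^esub> v) = ?l v" .
  show ?thesis
  proof (intro bexI ballI)
    show "h \<in> module_hom K T U" unfolding hom_T_iff by (rule h(1))
    show "h (tens x n) = b x n" if "x \<in> carrier X" "n \<in> carrier N" for x n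
      unfolding tens_def bspec[OF h(2) delta_closed[OF that]] by (rule d[OF that])
  qed
qed

text \<open>Linearity of the action of \<open>b\<close> makes the first four families of relations invariant, and
  commutation with the right action the fifth, so the action descends to the quotient.\<close>

lemma T_act_hom:
  assumes h: "act X b \<in> module_hom K X X"
    and comm: "\<And>x a. \<lbrakk>x \<in> carrier X; a \<in> carrier A\<rbrakk> \<Longrightarrow> b \<rhd>\<^bsub>X\<^esub> r x a = r (b \<rhd>\<^bsub>X\<^esub> x) a"
  shows "act T b \<in> module_hom K T T"
    and "\<lbrakk>x \<in> carrier X; n \<in> carrier N\<rbrakk> \<Longrightarrow> b \<rhd>\<^bsub>T\<^esub> tens x n = tens (b \<rhd>\<^bsub>X\<^esub> x) n"
proof -
  note hX = module_homD[OF h]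
  let ?m = "\<lambda>(x, n). \<delta> (b \<rhd>\<^bsub>X\<^esub> x) n"
  have mc: "?m p \<in> carrier F" if "p \<in> carrier X \<times> carrier N" for p
    using that hX(1) by (auto)
  have l: "lin_ext K ?m \<in> module_hom K F F" by (rule lin_ext_hom[OF K mc])
  interpret l: mod_hom K F F "lin_ext K ?m" using l by unfold_locales
  have d: "lin_ext K ?m (\<delta> x n) = \<delta> (b \<rhd>\<^bsub>X\<^esub> x) n" if "x \<in> carrier X" "n \<in> carrier N" for x n
    using lin_ext_basis_vec[OF K, of ?m "(x, n)" "carrier X \<times> carrier N"] mc[of "(x, n)"] that by simp
  have "lin_ext K ?m f \<in> tensor_relations K A X r N" if "f \<in> tensor_relations K A X r N" for f
    using that unfolding tensor_relations_def Let_def Un_iff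
    apply (elim disjE CollectE exE conjE)
        apply (simp_all add: d l.f_minus hX r_closed N_closed comm F.M.a_closed)
        apply (use hX in blast)+
    done
  then have "W \<subseteq> {v \<in> carrier F. lin_ext K ?m v \<in> W}"
    using relations_closed span_superset[OF F.vectorspace_axioms relations_closed]
    by (intro span_subset_subspace vimage_subspace[OF F.vectorspace_axioms l W_subspace]) blast
  then have lW: "lin_ext K ?m ` W \<subseteq> W" by blast
  have act: "b \<rhd>\<^bsub>T\<^esub> (W +>\<^bsub>F\<^esub> v) = W +>\<^bsub>F\<^esub> lin_ext K ?m v" if "v \<in> carrier F" for v
    unfolding T_act by (rule coset_image[OF W_subspace l lW that])
  note p = module_homD[OF proj_hom] and lh = module_homD[OF l]
  have rep: "\<exists>v \<in> carrier F. C = W +>\<^bsub>F\<^esub> v" if "C \<in> carrier T" for C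
    using that T_carrier quotient_space_simps(1)[OF W_subspace] by blast
  show "act T b \<in> module_hom K T T"
  proof (rule module_homI)
    fix C assume "C \<in> carrier T"
    then show "b \<rhd>\<^bsub>T\<^esub> C \<in> carrier T" using rep act p(1) lh(1) by metis
  next
    fix C D assume "C \<in> carrier T" "D \<in> carrier T"
    then obtain v w where vw: "v \<in> carrier F" "w \<in> carrier F" "C = W +>\<^bsub>F\<^esub> v" "D = W +>\<^bsub>F\<^esub> w" using rep by metis
    then show "b \<rhd>\<^bsub>T\<^esub> (C \<oplus>\<^bsub>T\<^esub> D) = b \<rhd>\<^bsub>T\<^esub> C \<oplus>\<^bsub>T\<^esub> b \<rhd>\<^bsub>T\<^esub> D"
      using act p(2) lh(1,2) F.M.a_closed by metis
  next
    fix c C assume c: "c \<in> carrier K" "C \<in> carrier T"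
    then obtain v where "v \<in> carrier F" "C = W +>\<^bsub>F\<^esub> v" using rep by metis
    then show "b \<rhd>\<^bsub>T\<^esub> (c \<odot>\<^bsub>T\<^esub> C) = c \<odot>\<^bsub>T\<^esub> (b \<rhd>\<^bsub>T\<^esub> C)"
      using act p(3) lh(1,3) F.smult_closed c by metis
  qed
  show "b \<rhd>\<^bsub>T\<^esub> tens x n = tens (b \<rhd>\<^bsub>X\<^esub> x) n" if "x \<in> carrier X" "n \<in> carrier N"
    unfolding tens_def using act[OF delta_closed[OF that]] d[OF that] by simp
qed

end

section \<open>Modules over semigroup algebras\<close>

lemma semigroup_algebra_simps:
  "carrier (semigroup_algebra K T) = carrier (free_space K (carrier T))"
  "zero (semigroup_algebra K T) = zero (free_space K (carrier T))"
  "add (semigroup_algebra K T) = add (free_space K (carrier T))"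
  "smult (semigroup_algebra K T) = smult (free_space K (carrier T))"
  "mult (semigroup_algebra K T) = bilin_ext K (\<lambda>s t. basis_vec K (s \<otimes>\<^bsub>T\<^esub> t))"
  by (simp_all add: semigroup_algebra_def)

text \<open>Both sides of the associativity law are linear in the two algebra elements and in the vector.\<close>

lemma alg_module_from_basis:
  assumes K: "field K" and closed: "\<And>s t. \<lbrakk>s \<in> carrier T; t \<in> carrier T\<rbrakk> \<Longrightarrow> s \<otimes>\<^bsub>T\<^esub> t \<in> carrier T"
    and V: "vectorspace K M"
    and bil: "bilinear K (free_space K (carrier T)) M M (act M)"
    and Y: "Y \<subseteq> carrier M" "module.span K M Y = carrier M"
    and mult: "\<And>s t y. \<lbrakk>s \<in> carrier T; t \<in> carrier T; y \<in> Y\<rbrakk> \<Longrightarrow>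
      basis_vec K (s \<otimes>\<^bsub>T\<^esub> t) \<rhd>\<^bsub>M\<^esub> y = basis_vec K s \<rhd>\<^bsub>M\<^esub> (basis_vec K t \<rhd>\<^bsub>M\<^esub> y)"
    and unit: "\<And>y. y \<in> Y \<Longrightarrow> \<exists>s \<in> carrier T. \<exists>v \<in> carrier M. y = basis_vec K s \<rhd>\<^bsub>M\<^esub> v"
  shows "alg_module K (semigroup_algebra K T) M"
proof -
  let ?F = "free_space K (carrier T)" and ?A = "semigroup_algebra K T"
  interpret V: vectorspace K M by fact
  have bv: "basis_vec K s \<in> carrier ?F" if "s \<in> carrier T" for s
    by (rule basis_vec_in_free_space[OF K that])
  have mb: "bilinear K ?F ?F ?F (mult ?A)"
    unfolding semigroup_algebra_simps by (rule bilin_ext_bilinear[OF K bv[OF closed]])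
  have mbv: "basis_vec K s \<otimes>\<^bsub>?A\<^esub> basis_vec K t = basis_vec K (s \<otimes>\<^bsub>T\<^esub> t)"
    if "s \<in> carrier T" "t \<in> carrier T" for s t
    unfolding semigroup_algebra_simps by (rule bilin_ext_basis_vec[OF K, where D = "carrier T"]) (rule bv[OF closed[OF that]])
  note L = bilinear_left[OF bil] and R = bilinear_right[OF bil]
  have 1: "basis_vec K (s \<otimes>\<^bsub>T\<^esub> t) \<rhd>\<^bsub>M\<^esub> v = basis_vec K s \<rhd>\<^bsub>M\<^esub> (basis_vec K t \<rhd>\<^bsub>M\<^esub> v)"
    if "s \<in> carrier T" "t \<in> carrier T" "v \<in> carrier M" for s t v
    using L[OF bv[OF closed[OF that(1,2)]]] module_hom_compose[OF L[OF bv[OF that(2)]] L[OF bv[OF that(1)]]]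
    by (rule module_hom_eq_on_span[OF V V _ _ Y mult[OF that(1,2)] that(3)])
  have 2: "(a \<otimes>\<^bsub>?A\<^esub> b) \<rhd>\<^bsub>M\<^esub> v = a \<rhd>\<^bsub>M\<^esub> (b \<rhd>\<^bsub>M\<^esub> v)"
    if "a \<in> carrier ?F" "b \<in> carrier ?F" "v \<in> carrier M" for a b v
    by (rule free_space_bilinear_eqI[OF K V bilinear_compose_hom[OF mb R[OF that(3)]]
          bilinear_compose_right[OF bil R[OF that(3)]] _ that(1,2)]) (simp add: mbv 1 that(3))
  have c: "a \<rhd>\<^bsub>M\<^esub> v \<in> carrier M" if "a \<in> carrier ?F" "v \<in> carrier M" for a v
    using bilinear_closed[OF bil that] .
  have "acted_part K ?A M = carrier M"
  proof
    let ?G = "{a \<rhd>\<^bsub>M\<^esub> v | a v. a \<in> carrier ?A \<and> v \<in> carrier M}"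
    have G: "?G \<subseteq> carrier M" using c by (auto simp: semigroup_algebra_simps)
    show "acted_part K ?A M \<subseteq> carrier M"
      unfolding acted_part_def by (rule subspaceD(2)[OF span_subspace[OF V G]])
    have "Y \<subseteq> module.span K M ?G"
    proof
      fix y assume "y \<in> Y"
      then obtain s v where "s \<in> carrier T" "v \<in> carrier M" "y = basis_vec K s \<rhd>\<^bsub>M\<^esub> v" using unit by blast
      then have "y \<in> ?G" using bv by (auto simp: semigroup_algebra_simps)
      then show "y \<in> module.span K M ?G" by (rule span_superset[OF V G])
    qed
    from span_subset_subspace[OF span_subspace[OF V G] this]
    show "carrier M \<subseteq> acted_part K ?A M" unfolding acted_part_def Y(2) .
  qed
  then show ?thesis
    using 2 c module_homD[OF L] module_homD[OF R] V
    by (intro alg_module.intro alg_module_axioms.intro)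
      (simp_all add: semigroup_algebra_simps(1,3,4))
qed

lemma alg_module_bilinear:
  assumes "alg_module K (semigroup_algebra K T) M"
  shows "bilinear K (free_space K (carrier T)) M M (act M)"
proof -
  interpret alg_module K "semigroup_algebra K T" M by fact
  show ?thesis unfolding bilinear_def
    using act_closed act_add_left act_add_right act_smult_left act_smult_right
    by (auto intro!: module_homI simp: semigroup_algebra_simps)
qed

lemma alg_module_basis_mult:
  assumes K: "field K" and M: "alg_module K (semigroup_algebra K T) M"
    and s: "s \<in> carrier T" and t: "t \<in> carrier T" and st: "s \<otimes>\<^bsub>T\<^esub> t \<in> carrier T" and v: "v \<in> carrier M"
  shows "basis_vec K (s \<otimes>\<^bsub>T\<^esub> t) \<rhd>\<^bsub>M\<^esub> v = basis_vec K s \<rhd>\<^bsub>M\<^esub> (basis_vec K t \<rhd>\<^bsub>M\<^esub> v)"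
proof -
  interpret alg_module K "semigroup_algebra K T" M by fact
  have "basis_vec K s \<otimes>\<^bsub>semigroup_algebra K T\<^esub> basis_vec K t = basis_vec K (s \<otimes>\<^bsub>T\<^esub> t)"
    unfolding semigroup_algebra_simps
    by (rule bilin_ext_basis_vec[OF K, where D = "carrier T"]) (rule basis_vec_in_free_space[OF K st])
  then show ?thesis
    using act_mult[unfolded semigroup_algebra_simps(1),
        OF basis_vec_in_free_space[OF K s] basis_vec_in_free_space[OF K t] v] by simp
qed

text \<open>For fixed \<open>w \<in> W\<close> the algebra elements that take \<open>w\<close> into \<open>W\<close> form a subspace.\<close>

lemma alg_submodule_from_basis:
  assumes K: "field K" and M: "alg_module K (semigroup_algebra K T) M" and W: "subspace K W M"
    and inv: "\<And>s w. \<lbrakk>s \<in> carrier T; w \<in> W\<rbrakk> \<Longrightarrow> basis_vec K s \<rhd>\<^bsub>M\<^esub> w \<in> W"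
  shows "alg_submodule K (semigroup_algebra K T) W M"
  unfolding alg_submodule_def semigroup_algebra_simps
proof (intro conjI ballI W)
  fix a w assume a: "a \<in> carrier (free_space K (carrier T))" and w: "w \<in> W"
  have "w \<in> carrier M" using subspaceD(2)[OF W] w by blast
  from free_space_hom_subspace[OF K bilinear_right[OF alg_module_bilinear[OF M] this] W inv[OF _ w] a]
  show "a \<rhd>\<^bsub>M\<^esub> w \<in> W" .
qed


section \<open>Simple modules\<close>

lemma simple_alg_moduleD:
  assumes "simple_alg_module K A M"
  shows "alg_module K A M" "vectorspace K M" "carrier M \<noteq> {\<zero>\<^bsub>M\<^esub>}"
    "alg_submodule K A W M \<Longrightarrow> W \<noteq> {\<zero>\<^bsub>M\<^esub>} \<Longrightarrow> W = carrier M"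
proof -
  show "alg_module K A M" using assms by (simp add: simple_alg_module_def)
  then interpret alg_module K A M .
  show "vectorspace K M" "carrier M \<noteq> {\<zero>\<^bsub>M\<^esub>}" using assms unitary vectorspace_axioms
    by (auto simp: simple_alg_module_def)
  show "alg_submodule K A W M \<Longrightarrow> W \<noteq> {\<zero>\<^bsub>M\<^esub>} \<Longrightarrow> W = carrier M"
    using assms by (auto simp: simple_alg_module_def)
qed

lemma simple_alg_moduleI:
  assumes M: "alg_module K A M" and ne: "v \<in> carrier M" "v \<noteq> \<zero>\<^bsub>M\<^esub>"
    and sub: "\<And>W w. \<lbrakk>alg_submodule K A W M; w \<in> W; w \<noteq> \<zero>\<^bsub>M\<^esub>\<rbrakk> \<Longrightarrow> carrier M \<subseteq> W"
  shows "simple_alg_module K A M"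
proof -
  interpret alg_module K A M by (rule M)
  have "W = {\<zero>\<^bsub>M\<^esub>} \<or> W = carrier M" if "alg_submodule K A W M" for W
  proof -
    have "subspace K W M" using that by (simp add: alg_submodule_def)
    note W = subspaceD[OF this]
    show ?thesis
    proof (cases "W \<subseteq> {\<zero>\<^bsub>M\<^esub>}")
      case False
      then show ?thesis using sub[OF that] W(2) by blast
    qed (use W(3) in blast)
  qed
  then show ?thesis using M ne unitary by (auto simp: simple_alg_module_def)
qed

text \<open>Schur's lemma: kernel and image of \<open>h\<close> are submodules, and \<open>h \<noteq> 0\<close>. The inverse map is
  returned, as it is the direction in which modules are compared with induced ones.\<close>

lemma simple_hom_isomorphic:
  assumes M: "simple_alg_module K A M" and L: "simple_alg_module K A L"
    and h: "h \<in> module_hom K L M"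
    and comm: "\<And>a v. \<lbrakk>a \<in> carrier A; v \<in> carrier L\<rbrakk> \<Longrightarrow> h (a \<rhd>\<^bsub>L\<^esub> v) = a \<rhd>\<^bsub>M\<^esub> h v"
    and ne: "v0 \<in> carrier L" "h v0 \<noteq> \<zero>\<^bsub>M\<^esub>"
  shows "\<exists>g \<in> module_hom K M L. bij_betw g (carrier M) (carrier L) \<and>
    (\<forall>a \<in> carrier A. \<forall>v \<in> carrier M. g (a \<rhd>\<^bsub>M\<^esub> v) = a \<rhd>\<^bsub>L\<^esub> g v)"
proof -
  note Lv = simple_alg_moduleD(2)[OF L] and Mv = simple_alg_moduleD(2)[OF M]
  note La = simple_alg_moduleD(1)[OF L] and Ma = simple_alg_moduleD(1)[OF M]
  interpret L: vectorspace K L by (rule Lv)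
  interpret M: vectorspace K M by (rule Mv)
  interpret h: mod_hom K L M h using h by unfold_locales
  note hD = module_homD[OF h]
  have z: "a \<rhd>\<^bsub>M\<^esub> \<zero>\<^bsub>M\<^esub> = \<zero>\<^bsub>M\<^esub>" if a: "a \<in> carrier A" for a
  proof -
    have "a \<rhd>\<^bsub>M\<^esub> (\<zero>\<^bsub>K\<^esub> \<odot>\<^bsub>M\<^esub> \<zero>\<^bsub>M\<^esub>) = \<zero>\<^bsub>K\<^esub> \<odot>\<^bsub>M\<^esub> (a \<rhd>\<^bsub>M\<^esub> \<zero>\<^bsub>M\<^esub>)"
      by (rule alg_module.act_smult_right[OF Ma]) (use a in auto)
    then show ?thesis using alg_module.act_closed[OF Ma a M.M.zero_closed] by simp
  qed
  let ?ker = "{v \<in> carrier L. h v \<in> {\<zero>\<^bsub>M\<^esub>}}"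
  have "alg_submodule K A ?ker L"
    unfolding alg_submodule_def
    using vimage_subspace[OF Lv h zero_subspace[OF Mv]] comm z alg_module.act_closed[OF La] by auto
  then have ker: "?ker = {\<zero>\<^bsub>L\<^esub>}" using simple_alg_moduleD(4)[OF L, of ?ker] ne by auto
  have inj: "inj_on h (carrier L)"
  proof
    fix v w assume vw: "v \<in> carrier L" "w \<in> carrier L" "h v = h w"
    then have "v \<ominus>\<^bsub>L\<^esub> w \<in> ?ker" by (simp add: h.f_minus a_minus_def M.M.r_neg)
    then have "v \<ominus>\<^bsub>L\<^esub> w = \<zero>\<^bsub>L\<^esub>" unfolding ker by simp
    moreover have "(v \<ominus>\<^bsub>L\<^esub> w) \<oplus>\<^bsub>L\<^esub> w = v"
      using vw(1,2) by (simp add: a_minus_def L.M.a_assoc L.M.l_neg)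
    ultimately show "v = w" using vw(2) by simp
  qed
  have "subspace K (h ` carrier L) M"
  proof (rule subspaceI[OF Mv])
    show "\<zero>\<^bsub>M\<^esub> \<in> h ` carrier L" using module_hom_zero[OF Lv Mv h] by (metis L.M.zero_closed imageI)
    show "v \<oplus>\<^bsub>M\<^esub> w \<in> h ` carrier L" if "v \<in> h ` carrier L" "w \<in> h ` carrier L" for v w
      using that hD(2) L.M.a_closed by (metis (no_types, lifting) imageE imageI)
    show "c \<odot>\<^bsub>M\<^esub> v \<in> h ` carrier L" if "c \<in> carrier K" "v \<in> h ` carrier L" for c v
      using that hD(3) L.smult_closed by (metis (no_types, lifting) imageE imageI)
  qed (use hD in blast)
  then have "alg_submodule K A (h ` carrier L) M"
    unfolding alg_submodule_def using comm alg_module.act_closed[OF La]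
    by (metis (no_types, lifting) imageE imageI)
  moreover have "h ` carrier L \<noteq> {\<zero>\<^bsub>M\<^esub>}" using ne by blast
  ultimately have surj: "h ` carrier L = carrier M" by (rule simple_alg_moduleD(4)[OF M])
  define g where "g = the_inv_into (carrier L) h"
  have gh: "g (h v) = v" if "v \<in> carrier L" for v
    unfolding g_def by (rule the_inv_into_f_f[OF inj that])
  have bij: "bij_betw g (carrier M) (carrier L)"
    unfolding g_def using bij_betw_the_inv_into[of h "carrier L" "carrier M"] inj surj by (simp add: bij_betw_def)
  have ex: "\<exists>u \<in> carrier L. v = h u" if "v \<in> carrier M" for v
    using that unfolding surj[symmetric] by blast
  have "g \<in> module_hom K M L"
  proof (rule module_homI)
    show "g v \<in> carrier L" if "v \<in> carrier M" for v using ex[OF that] gh by auto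
    show "g (v \<oplus>\<^bsub>M\<^esub> w) = g v \<oplus>\<^bsub>L\<^esub> g w" if "v \<in> carrier M" "w \<in> carrier M" for v w
      using ex[OF that(1)] ex[OF that(2)] gh hD(2) L.M.a_closed by metis
    show "g (c \<odot>\<^bsub>M\<^esub> v) = c \<odot>\<^bsub>L\<^esub> g v" if "c \<in> carrier K" "v \<in> carrier M" for c v
      using ex[OF that(2)] gh hD(3) L.smult_closed that(1) by metis
  qed
  moreover have "g (a \<rhd>\<^bsub>M\<^esub> v) = a \<rhd>\<^bsub>L\<^esub> g v" if "a \<in> carrier A" "v \<in> carrier M" for a v
    using ex[OF that(2)] gh comm[OF that(1)] alg_module.act_closed[OF La that(1)] by metis
  ultimately show ?thesis using bij by blast
qed


section \<open>The structure of the induced modules\<close>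

lemma max_subgroup_mult_eq: "g \<otimes>\<^bsub>max_subgroup S e\<^esub> h = g \<otimes>\<^bsub>cd_semigroup S\<^esub> h"
  by (simp add: max_subgroup_def)

locale induced = inverse_semigroup S
  for S :: "('s, 'm) monoid_scheme" (structure) and K :: "('k, 'c) ring_scheme" and e :: "'s set"
    and N :: "('k, 's set \<Rightarrow> 'k, 'n, 'f) amodule_scheme" +
  assumes K: "field K" and e: "e \<in> idems (cd_semigroup S)"
    and N: "alg_module K (group_algebra_at K S e) N"
begin

interpretation cd: inverse_semigroup "cd_semigroup S" by (rule cd_inverse_semigroup)

abbreviation "X \<equiv> kL_module K S e"
abbreviation "A \<equiv> group_algebra_at K S e"
abbreviation "r \<equiv> kL_right_act K S"
abbreviation "I \<equiv> Ind K S e N"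
abbreviation "FS \<equiv> free_space K (carrier S)"
abbreviation "FL \<equiv> free_space K (L_class S e)"
abbreviation "FG \<equiv> free_space K (carrier (max_subgroup S e))"
abbreviation "FC \<equiv> free_space K (carrier (cd_semigroup S))"

lemma N_vectorspace: "vectorspace K N"
  using N by (simp add: alg_module_def)

lemma N_bilinear: "bilinear K FG N N (act N)"
  by (rule alg_module_bilinear[OF N])

lemma X_simps:
  "carrier X = carrier FL" "zero X = zero FL" "add X = add FL" "smult X = smult FL"
  by (simp_all add: kL_module_def with_act_def)

lemma X_act: "act X = bilin_ext K (\<lambda>B A. if B \<star> A \<in> L_class S e then basis_vec K (B \<star> A) else (\<lambda>x. \<zero>\<^bsub>K\<^esub>))"
  by (simp add: kL_module_def with_act_def Let_def)

lemma X_vectorspace: "vectorspace K X"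
  by (rule vectorspace_cong[OF free_space_vectorspace[OF K] X_simps])

lemma FL_zero: "(\<lambda>x. \<zero>\<^bsub>K\<^esub>) = \<zero>\<^bsub>FL\<^esub>"
  by (simp add: free_space_simps)

lemma FL_zero_closed: "(\<lambda>x. \<zero>\<^bsub>K\<^esub>) \<in> carrier FL"
  unfolding FL_zero using subspaceD(3)[OF carrier_subspace[OF free_space_vectorspace[OF K]]] .

lemma basis_closed: "B \<in> L_class S e \<Longrightarrow> basis_vec K B \<in> carrier FL"
  by (rule basis_vec_in_free_space[OF K])

lemma X_act_bilinear: "bilinear K FC FL FL (act X)"
  unfolding X_act by (rule bilin_ext_bilinear[OF K]) (use basis_closed FL_zero_closed in auto)

lemma X_act_basis:
  "basis_vec K B \<rhd>\<^bsub>X\<^esub> basis_vec K C = (if B \<star> C \<in> L_class S e then basis_vec K (B \<star> C) else \<zero>\<^bsub>FL\<^esub>)"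
  unfolding X_act FL_zero[symmetric]
  by (rule bilin_ext_basis_vec[OF K, of _ _ _ "L_class S e"]) (use basis_closed FL_zero_closed in auto)

lemma r_bilinear: "bilinear K FL FG FL r"
  unfolding kL_right_act_def
  by (rule bilin_ext_bilinear[OF K]) (rule basis_closed[OF L_class_mult_subgroup(1)[OF e]])

lemma r_basis:
  assumes "B \<in> L_class S e" "g \<in> carrier (max_subgroup S e)"
  shows "r (basis_vec K B) (basis_vec K g) = basis_vec K (B \<star> g)"
  unfolding kL_right_act_def
  by (rule bilin_ext_basis_vec[OF K, where D = "L_class S e"])
    (rule basis_closed[OF L_class_mult_subgroup(1)[OF e assms]])

lemma iota_alg_hom: "iota_alg K S \<in> module_hom K FS FC"
  unfolding iota_alg_def by (rule lin_ext_hom[OF K basis_vec_in_free_space[OF K iota_closed]])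

lemma iota_alg_basis: "s \<in> carrier S \<Longrightarrow> iota_alg K S (basis_vec K s) = basis_vec K (iota S s)"
  unfolding iota_alg_def
  by (rule lin_ext_basis_vec[OF K, where C = "carrier (cd_semigroup S)"])
    (rule basis_vec_in_free_space[OF K iota_closed])

text \<open>The action of \<open>kS\<close> on \<open>kL\<^sub>e\<close> through \<open>\<iota>\<close>.\<close>

definition "xact a x = iota_alg K S a \<rhd>\<^bsub>X\<^esub> x"

lemma xact_bilinear: "bilinear K FS FL FL xact"
  unfolding xact_def by (rule bilinear_compose_left[OF X_act_bilinear iota_alg_hom])

lemma xact_basis:
  assumes "s \<in> carrier S"
  shows "xact (basis_vec K s) (basis_vec K B)
    = (if iota S s \<star> B \<in> L_class S e then basis_vec K (iota S s \<star> B) else \<zero>\<^bsub>FL\<^esub>)"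
  unfolding xact_def iota_alg_basis[OF assms] by (rule X_act_basis)

text \<open>On basis elements this is associativity in \<open>\<L>(S)\<close>, together with the fact that translation by
  the group does not change whether a product stays in the \<open>\<L>\<close>-class.\<close>

lemma xact_r_commute:
  assumes a: "a \<in> carrier FS" and x: "x \<in> carrier FL" and g: "g \<in> carrier FG"
  shows "xact a (r x g) = r (xact a x) g"
proof (rule free_space_bilinear_eqI[OF K free_space_vectorspace[OF K]
      bilinear_compose_hom[OF r_bilinear bilinear_left[OF xact_bilinear a]]
      bilinear_compose_left[OF r_bilinear bilinear_left[OF xact_bilinear a]] _ x g])
  fix B h assume B: "B \<in> L_class S e" and h: "h \<in> carrier (max_subgroup S e)"
  have hb: "basis_vec K h \<in> carrier FG" by (rule basis_vec_in_free_space[OF K h])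
  have Bh: "B \<star> h \<in> L_class S e" using L_class_mult_subgroup(1)[OF e B h] .
  show "xact a (r (basis_vec K B) (basis_vec K h)) = r (xact a (basis_vec K B)) (basis_vec K h)"
    unfolding r_basis[OF B h]
  proof (rule free_space_hom_eqI[OF K free_space_vectorspace[OF K]
        bilinear_right[OF xact_bilinear basis_closed[OF Bh]]
        module_hom_compose[OF bilinear_right[OF xact_bilinear basis_closed[OF B]] bilinear_right[OF r_bilinear hb]] _ a])
    fix s assume s: "s \<in> carrier S"
    have r0: "r \<zero>\<^bsub>FL\<^esub> (basis_vec K h) = \<zero>\<^bsub>FL\<^esub>"
      by (rule bilinear_zero(1)[OF r_bilinear free_space_vectorspace[OF K] free_space_vectorspace[OF K]
            free_space_vectorspace[OF K] hb])
    have "iota S s \<star> (B \<star> h) = iota S s \<star> B \<star> h"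
      using s B h by (simp add: cd.mult_assoc L_class_iff max_subgroup_iff[OF e])
    then show "xact (basis_vec K s) (basis_vec K (B \<star> h)) = r (xact (basis_vec K s) (basis_vec K B)) (basis_vec K h)"
      using mult_L_class_orbit_iff[OF e iota_closed[OF s] B h] r_basis[OF _ h]
      by (simp add: xact_basis[OF s] r0)
  qed
qed

sublocale tensor: tensor_setup K A X r N
proof (rule tensor_setup.intro)
  show "r x a \<in> carrier X" if "x \<in> carrier X" "a \<in> carrier A" for x a
    using bilinear_closed[OF r_bilinear] that by (simp add: X_simps semigroup_algebra_simps)
  show "a \<rhd>\<^bsub>N\<^esub> n \<in> carrier N" if "a \<in> carrier A" "n \<in> carrier N" for a n
    using bilinear_closed[OF N_bilinear] that by (simp add: semigroup_algebra_simps)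
qed (rule K X_vectorspace N_vectorspace)+

lemma I_simps:
  "carrier I = carrier tensor.T" "zero I = zero tensor.T" "add I = add tensor.T" "smult I = smult tensor.T"
  "act I a v = iota_alg K S a \<rhd>\<^bsub>tensor.T\<^esub> v"
  by (simp_all add: Ind_def with_act_def Let_def)

lemma I_vectorspace: "vectorspace K I"
  by (rule vectorspace_cong[OF tensor.T_vectorspace I_simps(1-4)])

lemma hom_from_I: "module_hom K I U = module_hom K tensor.T U"
  by (simp add: module_hom_def I_simps)

lemma tens_bilinear: "bilinear K FL N I tensor.tens"
  using tensor.tens_bilinear by (simp add: bilinear_def module_hom_def X_simps I_simps)

lemma xact_hom:
  assumes a: "a \<in> carrier FS"
  shows "act I a \<in> module_hom K I I"
    and "\<lbrakk>x \<in> carrier FL; n \<in> carrier N\<rbrakk> \<Longrightarrow> a \<rhd>\<^bsub>I\<^esub> tensor.tens x n = tensor.tens (xact a x) n"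
proof -
  have h: "act X (iota_alg K S a) \<in> module_hom K X X"
    using bilinear_left[OF xact_bilinear a]
    by (simp add: module_hom_def X_simps xact_def Pi_def)
  have c: "iota_alg K S a \<rhd>\<^bsub>X\<^esub> r x g = r (iota_alg K S a \<rhd>\<^bsub>X\<^esub> x) g"
    if "x \<in> carrier X" "g \<in> carrier A" for x g
    using xact_r_commute[OF a] that by (simp add: X_simps semigroup_algebra_simps xact_def)
  show "act I a \<in> module_hom K I I"
    using tensor.T_act_hom(1)[OF h c] by (simp add: module_hom_def I_simps Pi_def)
  show "a \<rhd>\<^bsub>I\<^esub> tensor.tens x n = tensor.tens (xact a x) n" if "x \<in> carrier FL" "n \<in> carrier N"
    using tensor.T_act_hom(2)[OF h c] that by (simp add: I_simps X_simps xact_def)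
qed

lemma I_tens_span:
  "{tensor.tens x n | x n. x \<in> carrier X \<and> n \<in> carrier N} \<subseteq> carrier I"
  "module.span K I {tensor.tens x n | x n. x \<in> carrier X \<and> n \<in> carrier N} = carrier I"
proof -
  show sub: "{tensor.tens x n | x n. x \<in> carrier X \<and> n \<in> carrier N} \<subseteq> carrier I"
    using bilinear_closed[OF tens_bilinear] unfolding X_simps by blast
  show "module.span K I {tensor.tens x n | x n. x \<in> carrier X \<and> n \<in> carrier N} = carrier I"
    unfolding span_cong[OF tensor.T_vectorspace I_simps(1-4) sub[unfolded I_simps(1)]] tensor.tens_span I_simps(1) ..
qed

text \<open>The generator \<open>B \<otimes> n\<close> of the induced module.\<close>

definition "\<tau> B n = tensor.tens (basis_vec K B) n"

lemma tau_hom: "B \<in> L_class S e \<Longrightarrow> \<tau> B \<in> module_hom K N I"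
  unfolding \<tau>_def using bilinear_left[OF tens_bilinear basis_closed] by simp

lemma tau_closed: "\<lbrakk>B \<in> L_class S e; n \<in> carrier N\<rbrakk> \<Longrightarrow> \<tau> B n \<in> carrier I"
  using module_homD(1)[OF tau_hom] .

lemma tau_balanced:
  assumes B: "B \<in> L_class S e" and g: "g \<in> carrier (max_subgroup S e)" and n: "n \<in> carrier N"
  shows "\<tau> (B \<star> g) n = \<tau> B (basis_vec K g \<rhd>\<^bsub>N\<^esub> n)"
  using tensor.tens_balanced[of "basis_vec K B" "basis_vec K g" n] r_basis[OF B g] n
    basis_closed[OF B] basis_vec_in_free_space[OF K g]
  by (simp add: \<tau>_def X_simps semigroup_algebra_simps)

lemma tau_span: "module.span K I {\<tau> B n | B n. B \<in> L_class S e \<and> n \<in> carrier N} = carrier I"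
  (is "module.span K I ?G = _")
proof -
  have G: "?G \<subseteq> carrier I" using tau_closed by blast
  note sG = span_subspace[OF I_vectorspace G]
  have "tensor.tens x n \<in> module.span K I ?G" if x: "x \<in> carrier FL" and n: "n \<in> carrier N" for x n
  proof (rule free_space_hom_subspace[OF K bilinear_right[OF tens_bilinear n] sG _ x])
    fix B assume "B \<in> L_class S e"
    then have "\<tau> B n \<in> ?G" using n by blast
    then show "tensor.tens (basis_vec K B) n \<in> module.span K I ?G"
      unfolding \<tau>_def[symmetric] by (rule span_superset[OF I_vectorspace G])
  qed
  then have "{tensor.tens x n | x n. x \<in> carrier X \<and> n \<in> carrier N} \<subseteq> module.span K I ?G"
    unfolding X_simps by blast
  from span_subset_subspace[OF sG this]
  show ?thesis unfolding I_tens_span(2) using subspaceD(2)[OF sG] by (rule equalityI[rotated])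
qed

lemma I_bilinear: "bilinear K FS I I (act I)"
  unfolding bilinear_def
proof (intro conjI ballI)
  fix v assume v: "v \<in> carrier I"
  interpret FS: vectorspace K FS by (rule free_space_vectorspace[OF K])
  interpret I: vectorspace K I by (rule I_vectorspace)
  let ?Y = "{tensor.tens x n | x n. x \<in> carrier X \<and> n \<in> carrier N}"
  note eqI = module_hom_eq_on_span[OF I_vectorspace I_vectorspace _ _ I_tens_span _ v]
  note xb = bilinear_right[OF xact_bilinear]
  note tb = bilinear_right[OF tens_bilinear]
  note xc = bilinear_closed[OF xact_bilinear]
  show "(\<lambda>a. a \<rhd>\<^bsub>I\<^esub> v) \<in> module_hom K FS I"
  proof (rule module_homI)
    fix a assume "a \<in> carrier FS"
    then show "a \<rhd>\<^bsub>I\<^esub> v \<in> carrier I" using module_homD(1)[OF xact_hom(1) v] by blast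
  next
    fix a b assume ab: "a \<in> carrier FS" "b \<in> carrier FS"
    show "(a \<oplus>\<^bsub>FS\<^esub> b) \<rhd>\<^bsub>I\<^esub> v = a \<rhd>\<^bsub>I\<^esub> v \<oplus>\<^bsub>I\<^esub> b \<rhd>\<^bsub>I\<^esub> v"
    proof (rule eqI[OF xact_hom(1)[OF FS.M.a_closed[OF ab]]
          module_hom_add[OF I_vectorspace xact_hom(1)[OF ab(1)] xact_hom(1)[OF ab(2)]]])
      fix y assume "y \<in> ?Y"
      then obtain x n where y: "y = tensor.tens x n" "x \<in> carrier FL" "n \<in> carrier N" by (auto simp: X_simps)
      show "(a \<oplus>\<^bsub>FS\<^esub> b) \<rhd>\<^bsub>I\<^esub> y = a \<rhd>\<^bsub>I\<^esub> y \<oplus>\<^bsub>I\<^esub> b \<rhd>\<^bsub>I\<^esub> y"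
        unfolding y(1) xact_hom(2)[OF FS.M.a_closed[OF ab] y(2,3)] xact_hom(2)[OF ab(1) y(2,3)]
          xact_hom(2)[OF ab(2) y(2,3)] module_homD(2)[OF xb[OF y(2)] ab]
        by (rule module_homD(2)[OF tb[OF y(3)] xc[OF ab(1) y(2)] xc[OF ab(2) y(2)]])
    qed
  next
    fix c a assume c: "c \<in> carrier K" and a: "a \<in> carrier FS"
    show "(c \<odot>\<^bsub>FS\<^esub> a) \<rhd>\<^bsub>I\<^esub> v = c \<odot>\<^bsub>I\<^esub> (a \<rhd>\<^bsub>I\<^esub> v)"
    proof (rule eqI[OF xact_hom(1)[OF FS.smult_closed[OF c a]]
          module_hom_compose[OF xact_hom(1)[OF a] module_hom_smult[OF I_vectorspace c]]])
      fix y assume "y \<in> ?Y"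
      then obtain x n where y: "y = tensor.tens x n" "x \<in> carrier FL" "n \<in> carrier N" by (auto simp: X_simps)
      show "(c \<odot>\<^bsub>FS\<^esub> a) \<rhd>\<^bsub>I\<^esub> y = c \<odot>\<^bsub>I\<^esub> (a \<rhd>\<^bsub>I\<^esub> y)"
        unfolding y(1) xact_hom(2)[OF FS.smult_closed[OF c a] y(2,3)] xact_hom(2)[OF a y(2,3)]
          module_homD(3)[OF xb[OF y(2)] c a]
        by (rule module_homD(3)[OF tb[OF y(3)] c xc[OF a y(2)]])
    qed
  qed
qed (rule xact_hom(1))

lemma act_tau:
  assumes s: "s \<in> carrier S" and B: "B \<in> L_class S e" and n: "n \<in> carrier N"
  shows "basis_vec K s \<rhd>\<^bsub>I\<^esub> \<tau> B n = (if iota S s \<star> B \<in> L_class S e then \<tau> (iota S s \<star> B) n else \<zero>\<^bsub>I\<^esub>)"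
proof -
  have "tensor.tens \<zero>\<^bsub>FL\<^esub> n = \<zero>\<^bsub>I\<^esub>"
    by (rule bilinear_zero(1)[OF tens_bilinear free_space_vectorspace[OF K] N_vectorspace I_vectorspace n])
  then show ?thesis
    unfolding \<tau>_def xact_hom(2)[OF basis_vec_in_free_space[OF K s] basis_closed[OF B] n] xact_basis[OF s]
    by simp
qed

text \<open>The vectors \<open>B \<otimes> n\<close> span, and each of them is fixed by some element of \<open>S\<close>, which makes the
  module unitary.\<close>

lemma I_alg_module: "alg_module K (semigroup_algebra K S) I"
proof (rule alg_module_from_basis[OF K mult_closed I_vectorspace I_bilinear _ tau_span])
  show "{\<tau> B n | B n. B \<in> L_class S e \<and> n \<in> carrier N} \<subseteq> carrier I" using tau_closed by blast
next
  fix s t y assume s: "s \<in> carrier S" and t: "t \<in> carrier S" and "y \<in> {\<tau> B n | B n. B \<in> L_class S e \<and> n \<in> carrier N}"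
  then obtain B n where y: "y = \<tau> B n" and B: "B \<in> L_class S e" and n: "n \<in> carrier N" by blast
  have st: "s \<otimes> t \<in> carrier S" using s t by simp
  have eq: "iota S s \<star> (iota S t \<star> B) = iota S (s \<otimes> t) \<star> B"
    using s t L_class_carrier[OF B] by (simp add: iota_mult cd.mult_assoc)
  show "basis_vec K (s \<otimes> t) \<rhd>\<^bsub>I\<^esub> y = basis_vec K s \<rhd>\<^bsub>I\<^esub> (basis_vec K t \<rhd>\<^bsub>I\<^esub> y)"
  proof (cases "iota S t \<star> B \<in> L_class S e")
    case True
    then show ?thesis unfolding y act_tau[OF st B n] act_tau[OF t B n]
      using act_tau[OF s True n] by (simp add: eq)
  next
    case False
    then have "iota S (s \<otimes> t) \<star> B \<notin> L_class S e" using iota_mult_L_class_cancel[OF s t B] by blast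
    moreover have "basis_vec K s \<rhd>\<^bsub>I\<^esub> \<zero>\<^bsub>I\<^esub> = \<zero>\<^bsub>I\<^esub>"
      by (rule bilinear_zero(2)[OF I_bilinear free_space_vectorspace[OF K] I_vectorspace I_vectorspace
            basis_vec_in_free_space[OF K s]])
    ultimately show ?thesis unfolding y act_tau[OF st B n] act_tau[OF t B n] using False by simp
  qed
next
  fix y assume "y \<in> {\<tau> B n | B n. B \<in> L_class S e \<and> n \<in> carrier N}"
  then obtain B n where y: "y = \<tau> B n" and B: "B \<in> L_class S e" and n: "n \<in> carrier N" by blast
  obtain s where s: "s \<in> carrier S" "iota S s \<star> B = B" using L_class_transitive[OF e B B] by blast
  then have "y = basis_vec K s \<rhd>\<^bsub>I\<^esub> y" unfolding y act_tau[OF s(1) B n] using B by simp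
  then show "\<exists>s \<in> carrier S. \<exists>v \<in> carrier I. y = basis_vec K s \<rhd>\<^bsub>I\<^esub> v"
    using s(1) tau_closed[OF B n] y by blast
qed

text \<open>The family \<open>\<beta>\<close> extends linearly from \<open>L\<^sub>e\<close> to \<open>kL\<^sub>e\<close>, and being balanced over the group
  it is balanced over the group algebra.\<close>

lemma I_universal:
  assumes U: "vectorspace K U" and b: "\<And>B. B \<in> L_class S e \<Longrightarrow> \<beta> B \<in> module_hom K N U"
    and bal: "\<And>B g n. \<lbrakk>B \<in> L_class S e; g \<in> carrier (max_subgroup S e); n \<in> carrier N\<rbrakk>
      \<Longrightarrow> \<beta> (B \<star> g) n = \<beta> B (basis_vec K g \<rhd>\<^bsub>N\<^esub> n)"
  shows "\<exists>h \<in> module_hom K I U. \<forall>B \<in> L_class S e. \<forall>n \<in> carrier N. h (\<tau> B n) = \<beta> B n"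
proof -
  define c where "c x n = lift K U (\<lambda>B. \<beta> B n) x" for x n
  have cb: "c (basis_vec K B) n = \<beta> B n" if "B \<in> L_class S e" "n \<in> carrier N" for B n
    unfolding c_def using module_homD(1)[OF b[OF that(1)] that(2)] by (rule lift_basis_vec[OF K U])
  have c: "bilinear K FL N U c"
    unfolding bilinear_def
  proof (intro conjI ballI)
    fix n assume n: "n \<in> carrier N"
    show "(\<lambda>x. c x n) \<in> module_hom K FL U"
      unfolding c_def using module_homD(1)[OF b n] by (rule lift_hom[OF K U])
  next
    fix x assume x: "x \<in> carrier FL"
    show "c x \<in> module_hom K N U"
      unfolding c_def lift_def
    proof (rule finsum_module_hom[OF N_vectorspace U])
      show "finite (supp K x)" using x by (simp add: free_space_simps)
      fix B assume B: "B \<in> supp K x"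
      show "(\<lambda>n. x B \<odot>\<^bsub>U\<^esub> \<beta> B n) \<in> module_hom K N U"
        using x B by (intro module_hom_compose[OF b module_hom_smult[OF U]]) (auto simp: free_space_simps)
    qed
  qed
  have bal': "c (r x a) n = c x (a \<rhd>\<^bsub>N\<^esub> n)"
    if x: "x \<in> carrier FL" and a: "a \<in> carrier FG" and n: "n \<in> carrier N" for x a n
  proof (rule free_space_bilinear_eqI[OF K U bilinear_compose_hom[OF r_bilinear bilinear_right[OF c n]]
        bilinear_compose_right[OF c bilinear_right[OF N_bilinear n]] _ x a])
    fix B g assume B: "B \<in> L_class S e" and g: "g \<in> carrier (max_subgroup S e)"
    show "c (r (basis_vec K B) (basis_vec K g)) n = c (basis_vec K B) (basis_vec K g \<rhd>\<^bsub>N\<^esub> n)"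
      unfolding r_basis[OF B g] cb[OF L_class_mult_subgroup(1)[OF e B g] n]
        cb[OF B bilinear_closed[OF N_bilinear basis_vec_in_free_space[OF K g] n]]
      by (rule bal[OF B g n])
  qed
  have "bilinear K X N U c" using c by (simp add: bilinear_def module_hom_def X_simps)
  from tensor.tens_universal[OF U this] obtain h where
    h: "h \<in> module_hom K tensor.T U" "\<forall>x \<in> carrier FL. \<forall>n \<in> carrier N. h (tensor.tens x n) = c x n"
    using bal' unfolding X_simps semigroup_algebra_simps by blast
  show ?thesis
  proof (intro bexI ballI)
    show "h \<in> module_hom K I U" unfolding hom_from_I by (rule h(1))
    fix B n assume "B \<in> L_class S e" "n \<in> carrier N"
    then show "h (\<tau> B n) = \<beta> B n" unfolding \<tau>_def using h(2) basis_closed cb by simp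
  qed
qed

section \<open>Induced modules of simple modules are simple\<close>

lemma tau_zero: "B \<in> L_class S e \<Longrightarrow> \<tau> B \<zero>\<^bsub>N\<^esub> = \<zero>\<^bsub>I\<^esub>"
  by (rule module_hom_zero[OF N_vectorspace I_vectorspace tau_hom])

lemma group_act_mult:
  assumes g: "g \<in> carrier (max_subgroup S e)" and h: "h \<in> carrier (max_subgroup S e)" and n: "n \<in> carrier N"
  shows "basis_vec K (g \<star> h) \<rhd>\<^bsub>N\<^esub> n = basis_vec K g \<rhd>\<^bsub>N\<^esub> (basis_vec K h \<rhd>\<^bsub>N\<^esub> n)"
proof -
  have m: "g \<otimes>\<^bsub>max_subgroup S e\<^esub> h = g \<star> h" by (simp add: max_subgroup_def)
  from alg_module_basis_mult[OF K N g h _ n] max_subgroup_mult[OF e g h]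
  show ?thesis unfolding m .
qed

lemma group_act_closed:
  "\<lbrakk>g \<in> carrier (max_subgroup S e); n \<in> carrier N\<rbrakk> \<Longrightarrow> basis_vec K g \<rhd>\<^bsub>N\<^esub> n \<in> carrier N"
  by (rule bilinear_closed[OF N_bilinear basis_vec_in_free_space[OF K]])

lemma group_act_hom: "g \<in> carrier (max_subgroup S e) \<Longrightarrow> act N (basis_vec K g) \<in> module_hom K N N"
  by (rule bilinear_left[OF N_bilinear basis_vec_in_free_space[OF K]])

text \<open>This is where unitarity of \<open>N\<close> enters: the vectors \<open>an\<close> span \<open>N\<close>, and \<open>e\<close> is a left unit of
  the group algebra.\<close>

lemma group_act_one:
  assumes n: "n \<in> carrier N" shows "basis_vec K e \<rhd>\<^bsub>N\<^esub> n = n"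
proof -
  note eG = max_subgroup_one[OF e]
  let ?Y = "{a \<rhd>\<^bsub>N\<^esub> v | a v. a \<in> carrier A \<and> v \<in> carrier N}"
  have Y: "?Y \<subseteq> carrier N" using tensor.N_closed by blast
  have span: "module.span K N ?Y = carrier N"
    using alg_module.unitary[OF N] by (simp add: acted_part_def)
  have id: "(\<lambda>v. v) \<in> module_hom K N N" by (rule module_homI) auto
  show ?thesis
  proof (rule module_hom_eq_on_span[OF N_vectorspace N_vectorspace group_act_hom[OF eG] id Y span _ n])
    fix y assume "y \<in> ?Y"
    then obtain a v where y: "y = a \<rhd>\<^bsub>N\<^esub> v" and a: "a \<in> carrier FG" and v: "v \<in> carrier N"
      by (auto simp: semigroup_algebra_simps)
    show "basis_vec K e \<rhd>\<^bsub>N\<^esub> y = y" unfolding y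
    proof (rule free_space_hom_eqI[OF K N_vectorspace
          module_hom_compose[OF bilinear_right[OF N_bilinear v] group_act_hom[OF eG]]
          bilinear_right[OF N_bilinear v] _ a])
      fix g assume g: "g \<in> carrier (max_subgroup S e)"
      show "basis_vec K e \<rhd>\<^bsub>N\<^esub> (basis_vec K g \<rhd>\<^bsub>N\<^esub> v) = basis_vec K g \<rhd>\<^bsub>N\<^esub> v"
        using group_act_mult[OF eG g v] max_subgroup_unit(2)[OF e g] by simp
    qed
  qed
qed

text \<open>The coordinate functions: \<open>C \<otimes> n = B \<otimes> (B\<^sup>\<star> \<star> C) n\<close> if \<open>C\<close> lies in the \<open>G\<^sub>e\<close>-orbit of \<open>B\<close>.\<close>

lemma tau_projection:
  assumes B: "B \<in> L_class S e"
  shows "\<exists>h \<in> module_hom K I N. \<forall>C \<in> L_class S e. \<forall>n \<in> carrier N.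
    h (\<tau> C n) = (if C \<star> C\<^sup>\<star> = B \<star> B\<^sup>\<star> then basis_vec K (B\<^sup>\<star> \<star> C) \<rhd>\<^bsub>N\<^esub> n else \<zero>\<^bsub>N\<^esub>)"
proof (rule I_universal[OF N_vectorspace])
  fix C assume C: "C \<in> L_class S e"
  note G = L_class_orbit(1)[OF e B C]
  show "(\<lambda>n. if C \<star> C\<^sup>\<star> = B \<star> B\<^sup>\<star> then basis_vec K (B\<^sup>\<star> \<star> C) \<rhd>\<^bsub>N\<^esub> n else \<zero>\<^bsub>N\<^esub>) \<in> module_hom K N N"
  proof (cases "C \<star> C\<^sup>\<star> = B \<star> B\<^sup>\<star>")
    case True
    then show ?thesis using group_act_hom[OF G] by simp
  next
    case False
    then show ?thesis by (auto intro!: module_homI)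
  qed
  fix g n assume g: "g \<in> carrier (max_subgroup S e)" and n: "n \<in> carrier N"
  have "B\<^sup>\<star> \<star> (C \<star> g) = B\<^sup>\<star> \<star> C \<star> g"
    using L_class_carrier[OF B] L_class_carrier[OF C] g by (simp add: cd.mult_assoc max_subgroup_iff[OF e])
  then show "(if C \<star> g \<star> (C \<star> g)\<^sup>\<star> = B \<star> B\<^sup>\<star> then basis_vec K (B\<^sup>\<star> \<star> (C \<star> g)) \<rhd>\<^bsub>N\<^esub> n else \<zero>\<^bsub>N\<^esub>)
    = (if C \<star> C\<^sup>\<star> = B \<star> B\<^sup>\<star> then basis_vec K (B\<^sup>\<star> \<star> C) \<rhd>\<^bsub>N\<^esub> (basis_vec K g \<rhd>\<^bsub>N\<^esub> n) else \<zero>\<^bsub>N\<^esub>)"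
    using L_class_mult_subgroup(2)[OF e C g] group_act_mult[OF G g n] by simp
qed

lemma tau_eq_zero:
  assumes B: "B \<in> L_class S e" and n: "n \<in> carrier N" and "\<tau> B n = \<zero>\<^bsub>I\<^esub>"
  shows "n = \<zero>\<^bsub>N\<^esub>"
proof -
  obtain h where h: "h \<in> module_hom K I N" "h (\<tau> B n) = basis_vec K (B\<^sup>\<star> \<star> B) \<rhd>\<^bsub>N\<^esub> n"
    using tau_projection[OF B] B n by auto
  then have "h (\<tau> B n) = n" using L_class_dom[OF B] group_act_one[OF n] by simp
  then show ?thesis using assms(3) module_hom_zero[OF I_vectorspace N_vectorspace h(1)] by simp
qed

lemma tau_orbit:
  assumes "B \<in> L_class S e" "C \<in> L_class S e" "B \<star> B\<^sup>\<star> = C \<star> C\<^sup>\<star>" "n \<in> carrier N"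
  shows "\<tau> C n = \<tau> B (basis_vec K (B\<^sup>\<star> \<star> C) \<rhd>\<^bsub>N\<^esub> n)"
  using tau_balanced[OF assms(1) L_class_orbit(1)[OF e assms(1-3)] assms(4)] L_class_orbit(2)[OF e assms(1-3)]
  by simp

text \<open>The weight of \<open>B \<otimes> n\<close> is \<open>B \<star> B\<^sup>\<star>\<close>.\<close>

lemma idem_act_tau:
  assumes x: "x \<in> idems S" and B: "B \<in> L_class S e" and n: "n \<in> carrier N"
  shows "basis_vec K x \<rhd>\<^bsub>I\<^esub> \<tau> B n = (if x \<in> B \<star> B\<^sup>\<star> then \<tau> B n else \<zero>\<^bsub>I\<^esub>)"
  using act_tau[OF idem_carrier[OF x] B n] iota_mult_L_class_iff[OF idem_carrier[OF x] B]
    iota_idem_fix[OF x B] B x by auto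

lemma act_tau_transitive:
  assumes "B \<in> L_class S e" "C \<in> L_class S e"
  shows "\<exists>s \<in> carrier S. \<forall>n \<in> carrier N. basis_vec K s \<rhd>\<^bsub>I\<^esub> \<tau> B n = \<tau> C n"
proof -
  obtain s where "s \<in> carrier S" "iota S s \<star> B = C" using L_class_transitive[OF e assms] by blast
  then show ?thesis using act_tau assms by auto
qed

text \<open>Finite sums of generators, indexed by lists so that terms may repeat.\<close>

definition "tsum ps = foldr (\<lambda>p v. \<tau> (fst p) (snd p) \<oplus>\<^bsub>I\<^esub> v) ps \<zero>\<^bsub>I\<^esub>"

definition "terms = {ps. \<forall>(B, n) \<in> set ps. B \<in> L_class S e \<and> n \<in> carrier N}"

lemma terms_simps [simp]:
  "[] \<in> terms"
  "(B, n) # ps \<in> terms \<longleftrightarrow> B \<in> L_class S e \<and> n \<in> carrier N \<and> ps \<in> terms"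
  "ps @ qs \<in> terms \<longleftrightarrow> ps \<in> terms \<and> qs \<in> terms"
  by (auto simp: terms_def)

lemma terms_filter [simp]: "ps \<in> terms \<Longrightarrow> filter P ps \<in> terms"
  by (auto simp: terms_def)

lemma terms_mem: "\<lbrakk>ps \<in> terms; (B, n) \<in> set ps\<rbrakk> \<Longrightarrow> B \<in> L_class S e \<and> n \<in> carrier N"
  by (auto simp: terms_def)

lemma terms_induct [consumes 1, case_names Nil Cons]:
  assumes "ps \<in> terms" "P []"
    and "\<And>B n ps. \<lbrakk>B \<in> L_class S e; n \<in> carrier N; ps \<in> terms; P ps\<rbrakk> \<Longrightarrow> P ((B, n) # ps)"
  shows "P ps"
  using assms(1)
proof (induction ps)
  case (Cons p ps)
  then show ?case using assms(3) by (cases p) simp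
qed (rule assms(2))

lemma tsum_simps [simp]:
  "tsum [] = \<zero>\<^bsub>I\<^esub>" "tsum ((B, n) # ps) = \<tau> B n \<oplus>\<^bsub>I\<^esub> tsum ps"
  by (simp_all add: tsum_def)

lemma tsum_closed: "ps \<in> terms \<Longrightarrow> tsum ps \<in> carrier I"
proof -
  interpret I: vectorspace K I by (rule I_vectorspace)
  show "ps \<in> terms \<Longrightarrow> tsum ps \<in> carrier I"
    by (induction ps rule: terms_induct) (simp_all add: tau_closed)
qed

lemma tsum_append:
  assumes "ps \<in> terms" and qs: "qs \<in> terms" shows "tsum (ps @ qs) = tsum ps \<oplus>\<^bsub>I\<^esub> tsum qs"
proof -
  interpret I: vectorspace K I by (rule I_vectorspace)
  show ?thesis using assms(1)
    by (induction ps rule: terms_induct) (simp_all add: tsum_closed tau_closed I.M.a_assoc qs)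
qed

lemma tsum_smult:
  assumes c: "c \<in> carrier K" and "ps \<in> terms"
  shows "\<exists>qs \<in> terms. c \<odot>\<^bsub>I\<^esub> tsum ps = tsum qs"
  using assms(2)
proof (induction ps rule: terms_induct)
  case Nil
  interpret I: vectorspace K I by (rule I_vectorspace)
  show ?case using c by (intro bexI[of _ "[]"]) simp_all
next
  case (Cons B n ps)
  interpret I: vectorspace K I by (rule I_vectorspace)
  obtain qs where qs: "qs \<in> terms" "c \<odot>\<^bsub>I\<^esub> tsum ps = tsum qs" using Cons by blast
  have "c \<odot>\<^bsub>I\<^esub> tsum ((B, n) # ps) = tsum ((B, c \<odot>\<^bsub>N\<^esub> n) # qs)"
    using qs Cons.hyps tsum_closed[of ps] c tau_closed module_homD(3)[OF tau_hom[OF Cons.hyps(1)] c Cons.hyps(2)]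
    by (simp add: I.smult_r_distr)
  moreover have "(B, c \<odot>\<^bsub>N\<^esub> n) # qs \<in> terms"
    using qs Cons.hyps c subspaceD(5)[OF carrier_subspace[OF N_vectorspace]] by simp
  ultimately show ?case by blast
qed

lemma tsum_surj:
  assumes "v \<in> carrier I" shows "\<exists>ps \<in> terms. v = tsum ps"
proof -
  have "subspace K (tsum ` terms) I"
  proof (rule subspaceI[OF I_vectorspace])
    show "tsum ` terms \<subseteq> carrier I" using tsum_closed by blast
    show "\<zero>\<^bsub>I\<^esub> \<in> tsum ` terms" by (rule image_eqI[of _ _ "[]"]) simp_all
    fix v w assume "v \<in> tsum ` terms" "w \<in> tsum ` terms"
    then obtain ps qs where *: "ps \<in> terms" "qs \<in> terms" "v = tsum ps" "w = tsum qs" by blast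
    then have "v \<oplus>\<^bsub>I\<^esub> w = tsum (ps @ qs)" "ps @ qs \<in> terms" by (simp_all add: tsum_append)
    then show "v \<oplus>\<^bsub>I\<^esub> w \<in> tsum ` terms" by blast
  next
    fix c v assume "c \<in> carrier K" "v \<in> tsum ` terms"
    then show "c \<odot>\<^bsub>I\<^esub> v \<in> tsum ` terms" using tsum_smult by blast
  qed
  moreover have "{\<tau> B n | B n. B \<in> L_class S e \<and> n \<in> carrier N} \<subseteq> tsum ` terms"
  proof clarify
    fix B n assume Bn: "B \<in> L_class S e" "n \<in> carrier N"
    interpret I: vectorspace K I by (rule I_vectorspace)
    have "\<tau> B n = tsum [(B, n)]" using tau_closed[OF Bn] by simp
    then show "\<tau> B n \<in> tsum ` terms" using Bn by (intro image_eqI[of _ _ "[(B, n)]"]) simp_all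
  qed
  ultimately have "carrier I \<subseteq> tsum ` terms" unfolding tau_span[symmetric] by (rule span_subset_subspace)
  then show ?thesis using assms by blast
qed

lemma tsum_same_orbit:
  assumes B: "B \<in> L_class S e" and "ps \<in> terms" and "\<And>C n. (C, n) \<in> set ps \<Longrightarrow> B \<star> B\<^sup>\<star> = C \<star> C\<^sup>\<star>"
  shows "\<exists>n \<in> carrier N. tsum ps = \<tau> B n"
  using assms(2,3)
proof (induction ps rule: terms_induct)
  case Nil
  show ?case using tau_zero[OF B] subspaceD(3)[OF carrier_subspace[OF N_vectorspace]]
    by (intro bexI[of _ "\<zero>\<^bsub>N\<^esub>"]) simp_all
next
  case (Cons C n ps)
  have eq: "B \<star> B\<^sup>\<star> = C \<star> C\<^sup>\<star>" using Cons.prems[of C n] by simp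
  have "\<exists>m \<in> carrier N. tsum ps = \<tau> B m"
    by (rule Cons.IH, rule Cons.prems, erule list.set_intros(2))
  then obtain m where m: "m \<in> carrier N" "tsum ps = \<tau> B m" by blast
  let ?n = "basis_vec K (B\<^sup>\<star> \<star> C) \<rhd>\<^bsub>N\<^esub> n"
  have n: "?n \<in> carrier N" using group_act_closed[OF L_class_orbit(1)[OF e B Cons.hyps(1) eq] Cons.hyps(2)] .
  have "tsum ((C, n) # ps) = \<tau> B (?n \<oplus>\<^bsub>N\<^esub> m)"
    using tau_orbit[OF B Cons.hyps(1) eq Cons.hyps(2)] m module_homD(2)[OF tau_hom[OF B] n m(1)] by simp
  then show ?case using subspaceD(4)[OF carrier_subspace[OF N_vectorspace] n m(1)] by blast
qed

lemma idem_act_tsum: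
  assumes x: "x \<in> idems S" and ps: "ps \<in> terms"
  shows "basis_vec K x \<rhd>\<^bsub>I\<^esub> tsum ps = tsum (filter (\<lambda>(C, n). x \<in> C \<star> C\<^sup>\<star>) ps)"
  using ps
proof (induction ps rule: terms_induct)
  case Nil
  then show ?case
    using bilinear_zero(2)[OF I_bilinear free_space_vectorspace[OF K] I_vectorspace I_vectorspace
        basis_vec_in_free_space[OF K idem_carrier[OF x]]] by simp
next
  case (Cons C n ps)
  interpret I: vectorspace K I by (rule I_vectorspace)
  show ?case
    using module_homD(2)[OF xact_hom(1)[OF basis_vec_in_free_space[OF K idem_carrier[OF x]]]
        tau_closed[OF Cons.hyps(1,2)] tsum_closed[OF Cons.hyps(3)]]
      idem_act_tau[OF x Cons.hyps(1,2)] Cons.IH tsum_closed[OF terms_filter[OF Cons.hyps(3)]]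
    by simp
qed

lemma tsum_partition:
  assumes "ps \<in> terms" shows "tsum ps = tsum (filter P ps) \<oplus>\<^bsub>I\<^esub> tsum (filter (\<lambda>p. \<not> P p) ps)"
  using assms
proof (induction ps rule: terms_induct)
  case Nil
  interpret I: vectorspace K I by (rule I_vectorspace)
  show ?case by simp
next
  case (Cons C n ps)
  interpret I: vectorspace K I by (rule I_vectorspace)
  show ?case
    using Cons.IH tau_closed[OF Cons.hyps(1,2)] tsum_closed[OF terms_filter[OF Cons.hyps(3)]]
    by (simp add: I.M.a_ac)
qed

text \<open>If a nonzero sum involves two different idempotents \<open>C \<star> C\<^sup>\<star>\<close>, an idempotent of \<open>S\<close> that
  separates them splits the sum into two shorter ones in the same submodule.\<close>

lemma submodule_contains_generator:
  assumes W: "alg_submodule K (semigroup_algebra K S) W I"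
    and "ps \<in> terms" "tsum ps \<in> W" "tsum ps \<noteq> \<zero>\<^bsub>I\<^esub>"
  shows "\<exists>B \<in> L_class S e. \<exists>n \<in> carrier N. \<tau> B n \<in> W \<and> \<tau> B n \<noteq> \<zero>\<^bsub>I\<^esub>"
  using assms(2-)
proof (induction "length ps" arbitrary: ps rule: less_induct)
  case less
  interpret I: vectorspace K I by (rule I_vectorspace)
  have sW: "subspace K W I" and aW: "\<And>a w. \<lbrakk>a \<in> carrier FS; w \<in> W\<rbrakk> \<Longrightarrow> a \<rhd>\<^bsub>I\<^esub> w \<in> W"
    using W by (auto simp: alg_submodule_def semigroup_algebra_simps)
  note WD = subspaceD[OF sW]
  obtain B n qs where ps: "ps = (B, n) # qs" using less.prems(3) by (cases ps) auto
  have B: "B \<in> L_class S e" using less.prems(1) ps by simp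
  show ?case
  proof (cases "\<forall>(C, m) \<in> set ps. B \<star> B\<^sup>\<star> = C \<star> C\<^sup>\<star>")
    case True
    then show ?thesis using tsum_same_orbit[OF B less.prems(1)] less.prems(2,3) B by force
  next
    case False
    then obtain C m where C: "(C, m) \<in> set ps" "B \<star> B\<^sup>\<star> \<noteq> C \<star> C\<^sup>\<star>" by auto
    have CL: "C \<in> L_class S e" using terms_mem[OF less.prems(1) C(1)] by blast
    obtain x where x: "x \<in> idems S" "(x \<in> B \<star> B\<^sup>\<star>) \<noteq> (x \<in> C \<star> C\<^sup>\<star>)"
      using cd_idem_separate[OF L_class_ran[OF B] L_class_ran[OF CL] C(2)] by blast
    \<comment> \<open>The action of \<open>x\<close> keeps the terms satisfying \<open>?P\<close>; one of the two parts is nonzero.\<close>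
    let ?P = "\<lambda>(C, n :: 'n). x \<in> C \<star> C\<^sup>\<star>"
    let ?qs = "filter ?P ps" and ?rs = "filter (\<lambda>p. \<not> ?P p) ps"
    have t: "?qs \<in> terms" "?rs \<in> terms" using less.prems(1) by simp_all
    have "\<exists>p \<in> set ps. \<not> ?P p" "\<exists>p \<in> set ps. ?P p" using C x(2) ps by (force, force)
    then have len: "length ?qs < length ps" "length ?rs < length ps"
      using length_filter_less[of _ ps ?P] length_filter_less[of _ ps "\<lambda>p. \<not> ?P p"] by blast+
    have q: "tsum ?qs \<in> W"
      using aW[OF basis_vec_in_free_space[OF K idem_carrier[OF x(1)]] less.prems(2)]
        idem_act_tsum[OF x(1) less.prems(1)] by simp
    show ?thesis
    proof (cases "tsum ?qs = \<zero>\<^bsub>I\<^esub>")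
      case True
      then have "tsum ps = tsum ?rs" using tsum_partition[OF less.prems(1), of ?P] tsum_closed[OF t(2)] by simp
      then show ?thesis using less.hyps[OF len(2) t(2)] less.prems by simp
    next
      case False
      then show ?thesis using less.hyps[OF len(1) t(1) q] by simp
    qed
  qed
qed

text \<open>Once \<open>W\<close> contains some nonzero \<open>B \<otimes> n\<close>, the vectors \<open>m\<close> with \<open>B \<otimes> m \<in> W\<close> form a nonzero
  submodule of \<open>N\<close>: if \<open>B \<otimes> m \<in> W\<close>, an element of \<open>S\<close> takes it to \<open>B \<star> g \<otimes> m = B \<otimes> gm\<close>.\<close>

lemma Ind_simple:
  assumes sN: "simple_alg_module K A N"
  shows "simple_alg_module K (semigroup_algebra K S) I"
proof -
  note eL = L_class_idem[OF e]
  obtain n0 where n0: "n0 \<in> carrier N" "n0 \<noteq> \<zero>\<^bsub>N\<^esub>"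
    using simple_alg_moduleD(3)[OF sN] subspaceD(3)[OF carrier_subspace[OF N_vectorspace]] by blast
  show ?thesis
  proof (rule simple_alg_moduleI[OF I_alg_module tau_closed[OF eL n0(1)]])
    show "\<tau> e n0 \<noteq> \<zero>\<^bsub>I\<^esub>" using tau_eq_zero[OF eL] n0 by blast
    fix W w assume W: "alg_submodule K (semigroup_algebra K S) W I" and w: "w \<in> W" "w \<noteq> \<zero>\<^bsub>I\<^esub>"
    have sW: "subspace K W I" and aW: "\<And>a w. \<lbrakk>a \<in> carrier FS; w \<in> W\<rbrakk> \<Longrightarrow> a \<rhd>\<^bsub>I\<^esub> w \<in> W"
      using W by (auto simp: alg_submodule_def semigroup_algebra_simps)
    note WD = subspaceD[OF sW]
    obtain B n where B: "B \<in> L_class S e" and n: "n \<in> carrier N" "\<tau> B n \<in> W" "\<tau> B n \<noteq> \<zero>\<^bsub>I\<^esub>"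
      using tsum_surj[of w] submodule_contains_generator[OF W] w WD(2) by blast
    have move: "\<tau> C m \<in> W" if Bm: "\<tau> B m \<in> W" "m \<in> carrier N" and C: "C \<in> L_class S e" for C m
    proof -
      obtain s where "s \<in> carrier S" "basis_vec K s \<rhd>\<^bsub>I\<^esub> \<tau> B m = \<tau> C m"
        using act_tau_transitive[OF B C] Bm(2) by blast
      then show ?thesis using aW[OF basis_vec_in_free_space[OF K] Bm(1)] by metis
    qed
    let ?N = "{m \<in> carrier N. \<tau> B m \<in> W}"
    have "alg_submodule K A ?N N"
    proof (rule alg_submodule_from_basis[OF K N vimage_subspace[OF N_vectorspace tau_hom[OF B] sW]])
      fix g m assume g: "g \<in> carrier (max_subgroup S e)" and m: "m \<in> ?N"
      have "\<tau> (B \<star> g) m \<in> W" using move[of m "B \<star> g"] m L_class_mult_subgroup(1)[OF e B g] by blast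
      then show "basis_vec K g \<rhd>\<^bsub>N\<^esub> m \<in> ?N"
        using tau_balanced[OF B g] m group_act_closed[OF g] by auto
    qed
    moreover have "n \<in> ?N" "n \<noteq> \<zero>\<^bsub>N\<^esub>" using n tau_zero[OF B] by auto
    ultimately have "?N = carrier N" using simple_alg_moduleD(4)[OF sN] by blast
    then have "{\<tau> C m | C m. C \<in> L_class S e \<and> m \<in> carrier N} \<subseteq> W" using move by blast
    from span_subset_subspace[OF sW this] show "carrier I \<subseteq> W" unfolding tau_span .
  qed
qed


section \<open>Finite index and finite dimension\<close>

lemma D_class_idems:
  "{f \<in> idems (cd_semigroup S). green_D (cd_semigroup S) e f} = (\<lambda>B. B \<star> B\<^sup>\<star>) ` L_class S e"
  using green_D_iff[OF e] L_class_ran by auto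

text \<open>One \<open>B\<close> for each weight, combined with a finite spanning set of \<open>N\<close>, suffices.\<close>

lemma Ind_fin_dim:
  assumes fi: "finite_index S e" and fd: "vectorspace.fin_dim K N"
  shows "vectorspace.fin_dim K I"
proof -
  obtain Y where Y: "finite Y" "Y \<subseteq> carrier N" "module.span K N Y = carrier N"
    by (rule fin_dimE[OF N_vectorspace fd])
  have "finite ((\<lambda>B. B \<star> B\<^sup>\<star>) ` L_class S e)" using fi by (simp add: finite_index_def D_class_idems)
  from finite_subset_image[OF this subset_refl] obtain R where
    R: "R \<subseteq> L_class S e" "finite R" "(\<lambda>B. B \<star> B\<^sup>\<star>) ` L_class S e = (\<lambda>B. B \<star> B\<^sup>\<star>) ` R"
    by (elim exE conjE) (rule that)
  let ?Z = "{\<tau> B y | B y. B \<in> R \<and> y \<in> Y}"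
  have Z: "?Z \<subseteq> carrier I" using R(1) Y(2) tau_closed by blast
  note sZ = span_subspace[OF I_vectorspace Z]
  have "finite ((\<lambda>(B, y). \<tau> B y) ` (R \<times> Y))" using R(2) Y(1) by simp
  moreover have "?Z = (\<lambda>(B, y). \<tau> B y) ` (R \<times> Y)" by auto
  ultimately have fZ: "finite ?Z" by simp
  have 1: "\<tau> B n \<in> module.span K I ?Z" if "B \<in> R" "n \<in> carrier N" for B n
  proof -
    have "Y \<subseteq> {n \<in> carrier N. \<tau> B n \<in> module.span K I ?Z}"
      using that(1) Y(2) span_superset[OF I_vectorspace Z] by blast
    from span_subset_subspace[OF vimage_subspace[OF N_vectorspace tau_hom sZ] this, unfolded Y(3)] that R(1)
    show ?thesis by blast
  qed
  have "\<tau> C n \<in> module.span K I ?Z" if C: "C \<in> L_class S e" and n: "n \<in> carrier N" for C n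
  proof -
    have "C \<star> C\<^sup>\<star> \<in> (\<lambda>B. B \<star> B\<^sup>\<star>) ` R" unfolding R(3)[symmetric] using C by (rule imageI)
    then obtain B where B: "B \<in> R" "B \<star> B\<^sup>\<star> = C \<star> C\<^sup>\<star>" by fastforce
    then have BL: "B \<in> L_class S e" using R(1) B(1) by blast
    show ?thesis unfolding tau_orbit[OF BL C B(2) n]
      by (rule 1[OF B(1) group_act_closed[OF L_class_orbit(1)[OF e BL C B(2)] n]])
  qed
  then have "{\<tau> C n | C n. C \<in> L_class S e \<and> n \<in> carrier N} \<subseteq> module.span K I ?Z" by blast
  from span_subset_subspace[OF sZ this] have "module.span K I ?Z = carrier I"
    unfolding tau_span using subspaceD(2)[OF sZ] by blast
  then show ?thesis by (rule fin_dimI[OF I_vectorspace fZ Z])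
qed

text \<open>A finite spanning set involves only finitely many weights. The coordinate function of any other
  weight would vanish on it, hence everywhere.\<close>

lemma finite_index_if_fin_dim:
  assumes fd: "vectorspace.fin_dim K I" and n: "n \<in> carrier N" "n \<noteq> \<zero>\<^bsub>N\<^esub>"
  shows "finite_index S e"
proof -
  obtain Z where Z: "finite Z" "Z \<subseteq> carrier I" "module.span K I Z = carrier I"
    by (rule fin_dimE[OF I_vectorspace fd])
  have "\<forall>z \<in> Z. \<exists>ps. ps \<in> terms \<and> z = tsum ps" using tsum_surj Z(2) by blast
  from bchoice[OF this] obtain p where p: "\<forall>z \<in> Z. p z \<in> terms \<and> z = tsum (p z)" ..
  let ?R = "(\<lambda>(B, n :: 'n). B \<star> B\<^sup>\<star>) ` (\<Union>z \<in> Z. set (p z))"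
  have "(\<lambda>B. B \<star> B\<^sup>\<star>) ` L_class S e \<subseteq> ?R"
  proof (rule ccontr)
    assume "\<not> ?thesis"
    then obtain B where B: "B \<in> L_class S e" "B \<star> B\<^sup>\<star> \<notin> ?R" by blast
    obtain h where h: "h \<in> module_hom K I N"
      "\<And>C n. \<lbrakk>C \<in> L_class S e; n \<in> carrier N\<rbrakk> \<Longrightarrow>
        h (\<tau> C n) = (if C \<star> C\<^sup>\<star> = B \<star> B\<^sup>\<star> then basis_vec K (B\<^sup>\<star> \<star> C) \<rhd>\<^bsub>N\<^esub> n else \<zero>\<^bsub>N\<^esub>)"
      using tau_projection[OF B(1)] by blast
      have van: "h (tsum ps) = \<zero>\<^bsub>N\<^esub>"
      if "ps \<in> terms" "\<And>C n. (C, n) \<in> set ps \<Longrightarrow> C \<star> C\<^sup>\<star> \<noteq> B \<star> B\<^sup>\<star>" for ps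
      using that
    proof (induction ps rule: terms_induct)
      case Nil
      then show ?case using module_hom_zero[OF I_vectorspace N_vectorspace h(1)] by simp
    next
      case (Cons C n ps)
      have "C \<star> C\<^sup>\<star> \<noteq> B \<star> B\<^sup>\<star>" using Cons.prems[of C n] by simp
      moreover have "h (tsum ps) = \<zero>\<^bsub>N\<^esub>" by (rule Cons.IH, rule Cons.prems, erule list.set_intros(2))
      ultimately show ?case
        using module_homD(2)[OF h(1) tau_closed[OF Cons.hyps(1,2)] tsum_closed[OF Cons.hyps(3)]]
          h(2)[OF Cons.hyps(1,2)] subspaceD(3)[OF carrier_subspace[OF N_vectorspace]] by simp
    qed
    have "h z = \<zero>\<^bsub>N\<^esub>" if z: "z \<in> Z" for z
    proof -
      have "p z \<in> terms" and eq: "tsum (p z) = z" using bspec[OF p z] by simp_all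
      then have "h (tsum (p z)) = \<zero>\<^bsub>N\<^esub>"
      proof (intro van)
        fix C m assume "(C, m) \<in> set (p z)"
        then have "C \<star> C\<^sup>\<star> \<in> ?R" using z by (intro image_eqI[of _ _ "(C, m)"] UN_I) simp_all
        then show "C \<star> C\<^sup>\<star> \<noteq> B \<star> B\<^sup>\<star>" using B(2) by metis
      qed
      then show ?thesis unfolding eq .
    qed
    then have "Z \<subseteq> {v \<in> carrier I. h v \<in> {\<zero>\<^bsub>N\<^esub>}}" using Z(2) by (simp add: subset_iff)
    from span_subset_subspace[OF vimage_subspace[OF I_vectorspace h(1) zero_subspace[OF N_vectorspace]] this,
        unfolded Z(3)]
    have "h (\<tau> B n) = \<zero>\<^bsub>N\<^esub>" using tau_closed[OF B(1) n(1)] by (simp add: subset_iff)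
    then show False using h(2)[OF B(1) n(1)] L_class_dom[OF B(1)] group_act_one[OF n(1)] n(2) by simp
  qed
  then show ?thesis
    unfolding finite_index_def D_class_idems by (rule finite_subset) (simp add: Z(1))
qed

end

section \<open>Finite-dimensional simple modules are induced\<close>

locale simple_fd = inverse_semigroup S
  for S :: "('s, 'm) monoid_scheme" (structure) and K :: "('k, 'c) ring_scheme"
    and M :: "('k, 's \<Rightarrow> 'k, 'v, 'f) amodule_scheme" +
  assumes K: "field K" and M: "simple_alg_module K (semigroup_algebra K S) M"
    and fd: "vectorspace.fin_dim K M"
begin

interpretation cd: inverse_semigroup "cd_semigroup S" by (rule cd_inverse_semigroup)

definition "\<rho> s = act M (basis_vec K s)"

lemmas M_vectorspace = simple_alg_moduleD(2)[OF M]
lemmas M_module = simple_alg_moduleD(1)[OF M]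
lemmas M_bilinear = alg_module_bilinear[OF M_module]

lemma rho_hom: "s \<in> carrier S \<Longrightarrow> \<rho> s \<in> module_hom K M M"
  unfolding \<rho>_def by (rule bilinear_left[OF M_bilinear basis_vec_in_free_space[OF K]])

lemma rho_closed [simp]: "\<lbrakk>s \<in> carrier S; v \<in> carrier M\<rbrakk> \<Longrightarrow> \<rho> s v \<in> carrier M"
  by (rule module_homD(1)[OF rho_hom])

lemma rho_mult: "\<lbrakk>s \<in> carrier S; t \<in> carrier S; v \<in> carrier M\<rbrakk> \<Longrightarrow> \<rho> (s \<otimes> t) v = \<rho> s (\<rho> t v)"
  unfolding \<rho>_def by (rule alg_module_basis_mult[OF K M_module]) auto

lemma rho_zero: "s \<in> carrier S \<Longrightarrow> \<rho> s \<zero>\<^bsub>M\<^esub> = \<zero>\<^bsub>M\<^esub>"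
  by (rule module_hom_zero[OF M_vectorspace M_vectorspace rho_hom])

lemma rho_dom: "\<lbrakk>s \<in> carrier S; v \<in> carrier M\<rbrakk> \<Longrightarrow> \<rho> s (\<rho> (sinv S s \<otimes> s) v) = \<rho> s v"
  using rho_mult[of s "sinv S s \<otimes> s" v] by simp

lemma rho_nonzero_dom:
  assumes "s \<in> carrier S" "v \<in> carrier M" "\<rho> s v \<noteq> \<zero>\<^bsub>M\<^esub>"
  shows "\<rho> (sinv S s \<otimes> s) v \<noteq> \<zero>\<^bsub>M\<^esub>"
  using rho_dom[OF assms(1,2)] rho_zero[OF assms(1)] assms(3) by auto

text \<open>For idempotent \<open>x\<close> this is the image of \<open>x\<close>.\<close>

definition "fixed x = {v \<in> carrier M. \<rho> x v = v}"

lemma fixedD: "v \<in> fixed x \<Longrightarrow> \<rho> x v = v"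
  by (simp add: fixed_def)

lemma fixed_subspace:
  assumes "x \<in> idems S" shows "subspace K (fixed x) M"
  using module_homD[OF rho_hom[OF idem_carrier[OF assms]]] rho_zero[OF idem_carrier[OF assms]]
    subspaceD(3-)[OF carrier_subspace[OF M_vectorspace]]
  unfolding fixed_def by (intro subspaceI[OF M_vectorspace]) auto

lemma rho_fixed: "\<lbrakk>x \<in> idems S; v \<in> carrier M\<rbrakk> \<Longrightarrow> \<rho> x v \<in> fixed x"
  using rho_mult[of x x v] by (simp add: fixed_def)

lemma fixed_mult_subset:
  assumes "x \<in> idems S" "y \<in> idems S"
  shows "fixed (x \<otimes> y) \<subseteq> fixed x" "fixed (x \<otimes> y) \<subseteq> fixed y"
proof -
  have *: "fixed (x \<otimes> y) \<subseteq> fixed x" if that: "x \<in> idems S" "y \<in> idems S" for x y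
  proof
    fix v assume "v \<in> fixed (x \<otimes> y)"
    then have v: "v \<in> carrier M" "\<rho> x (\<rho> y v) = v" using rho_mult[of x y v] that by (simp_all add: fixed_def)
    then show "v \<in> fixed x" using rho_fixed[OF that(1) rho_closed[OF idem_carrier[OF that(2)] v(1)]] by simp
  qed
  show "fixed (x \<otimes> y) \<subseteq> fixed x" using *[OF assms] .
  show "fixed (x \<otimes> y) \<subseteq> fixed y" using *[OF assms(2,1)] idem_commute[OF assms] by simp
qed

lemma exists_idem_fixed: "\<exists>x \<in> idems S. fixed x \<noteq> {\<zero>\<^bsub>M\<^esub>}"
proof (rule ccontr)
  assume *: "\<not> ?thesis"
  have "\<rho> s v = \<zero>\<^bsub>M\<^esub>" if "s \<in> carrier S" "v \<in> carrier M" for s v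
    using * rho_fixed[OF dom_idem[OF that(1)] that(2)] rho_nonzero_dom[OF that] dom_idem[OF that(1)] by blast
  then have "a \<rhd>\<^bsub>M\<^esub> v \<in> {\<zero>\<^bsub>M\<^esub>}" if "a \<in> carrier (free_space K (carrier S))" "v \<in> carrier M" for a v
    using free_space_hom_subspace[OF K bilinear_right[OF M_bilinear that(2)] zero_subspace[OF M_vectorspace] _ that(1)]
      that(2) unfolding \<rho>_def by blast
  then have "acted_part K (semigroup_algebra K S) M \<subseteq> {\<zero>\<^bsub>M\<^esub>}"
    unfolding acted_part_def semigroup_algebra_simps
    by (intro span_subset_subspace[OF zero_subspace[OF M_vectorspace]]) blast
  then show False using simple_alg_moduleD(3)[OF M] alg_module.unitary[OF M_module]
      subspaceD(3)[OF carrier_subspace[OF M_vectorspace]] by blast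
qed

text \<open>Take \<open>x\<close> with a minimal nonzero space of fixed vectors. If \<open>y\<close> does not kill that space, then
  \<open>xy\<close> has a nonzero space of fixed vectors inside it, which by minimality is the same space.\<close>

lemma exists_primitive_idem:
  "\<exists>x \<in> idems S. fixed x \<noteq> {\<zero>\<^bsub>M\<^esub>} \<and>
    (\<forall>y \<in> idems S. \<forall>v \<in> fixed x. \<rho> y v \<noteq> \<zero>\<^bsub>M\<^esub> \<longrightarrow> fixed x \<subseteq> fixed y)"
proof -
  obtain d :: "'v set \<Rightarrow> nat" where
    d: "\<And>U U'. \<lbrakk>subspace K U M; subspace K U' M; U \<subset> U'\<rbrakk> \<Longrightarrow> d U < d U'"
    using subspace_measure[OF M_vectorspace fd] by blast
  let ?P = "\<lambda>x. x \<in> idems S \<and> fixed x \<noteq> {\<zero>\<^bsub>M\<^esub>}"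
  obtain x0 where "?P x0" using exists_idem_fixed by blast
  from ex_has_least_nat[of ?P, OF this, of "\<lambda>x. d (fixed x)"] obtain x where
    x: "x \<in> idems S" "fixed x \<noteq> {\<zero>\<^bsub>M\<^esub>}" and least: "\<And>y. ?P y \<Longrightarrow> d (fixed x) \<le> d (fixed y)" by blast
  have "fixed x \<subseteq> fixed y" if y: "y \<in> idems S" and v: "v \<in> fixed x" "\<rho> y v \<noteq> \<zero>\<^bsub>M\<^esub>" for y v
  proof -
    have xy: "x \<otimes> y \<in> idems S" using idem_prod_idem[OF x(1) y] .
    have vM: "v \<in> carrier M" "\<rho> x v = v" using v by (auto simp: fixed_def)
    have "\<rho> (x \<otimes> y) v = \<rho> y v"
      using idem_commute[OF x(1) y] rho_mult[of y x v] x(1) y vM by simp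
    then have "fixed (x \<otimes> y) \<noteq> {\<zero>\<^bsub>M\<^esub>}" using rho_fixed[OF xy vM(1)] v(2) by auto
    then have "\<not> fixed (x \<otimes> y) \<subset> fixed x"
      using d[OF fixed_subspace[OF xy] fixed_subspace[OF x(1)]] least[of "x \<otimes> y"] xy by fastforce
    then show ?thesis using fixed_mult_subset[OF x(1) y] by blast
  qed
  then show ?thesis using x by blast
qed

definition "x0 = (SOME x. x \<in> idems S \<and> fixed x \<noteq> {\<zero>\<^bsub>M\<^esub>} \<and>
    (\<forall>y \<in> idems S. \<forall>v \<in> fixed x. \<rho> y v \<noteq> \<zero>\<^bsub>M\<^esub> \<longrightarrow> fixed x \<subseteq> fixed y))"

abbreviation "V \<equiv> fixed x0"

lemma x0: "x0 \<in> idems S" "V \<noteq> {\<zero>\<^bsub>M\<^esub>}"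
  and dichotomy: "\<lbrakk>y \<in> idems S; v \<in> V; \<rho> y v \<noteq> \<zero>\<^bsub>M\<^esub>\<rbrakk> \<Longrightarrow> V \<subseteq> fixed y"
  using someI_ex[of "\<lambda>x. x \<in> idems S \<and> fixed x \<noteq> {\<zero>\<^bsub>M\<^esub>} \<and>
    (\<forall>y \<in> idems S. \<forall>v \<in> fixed x. \<rho> y v \<noteq> \<zero>\<^bsub>M\<^esub> \<longrightarrow> fixed x \<subseteq> fixed y)"] exists_primitive_idem
  unfolding x0_def[symmetric] by blast+

lemma x0_carrier [simp]: "x0 \<in> carrier S" using x0(1) by simp

lemma V_carrier [simp]: "v \<in> V \<Longrightarrow> v \<in> carrier M"
  and V_fixed: "v \<in> V \<Longrightarrow> \<rho> x0 v = v"
  and mem_V: "\<lbrakk>v \<in> carrier M; \<rho> x0 v = v\<rbrakk> \<Longrightarrow> v \<in> V"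
  by (simp_all add: fixed_def)

lemma V_subspace: "subspace K V M" by (rule fixed_subspace[OF x0(1)])

lemma V_nonzero: "\<exists>v \<in> V. v \<noteq> \<zero>\<^bsub>M\<^esub>"
  using x0(2) subspaceD(3)[OF V_subspace] by blast

text \<open>\<open>V\<close> is the weight space of the filter \<open>F\<close>.\<close>

definition "F = {y \<in> idems S. V \<subseteq> fixed y}"

definition "H = up_closure S F"

lemma F_fix: "\<lbrakk>y \<in> F; v \<in> V\<rbrakk> \<Longrightarrow> \<rho> y v = v"
  unfolding F_def by (rule fixedD) blast

lemma F_idem: "y \<in> F \<Longrightarrow> y \<in> idems S" by (simp add: F_def)

lemma mem_F: "\<lbrakk>y \<in> idems S; v \<in> V; \<rho> y v \<noteq> \<zero>\<^bsub>M\<^esub>\<rbrakk> \<Longrightarrow> y \<in> F"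
  using dichotomy by (simp add: F_def)

lemma x0_F: "x0 \<in> F" using x0 by (simp add: F_def)

lemma F_up:
  assumes "y \<in> F" "z \<in> idems S" "nat_le S y z" shows "z \<in> F"
proof -
  obtain v where v: "v \<in> V" "v \<noteq> \<zero>\<^bsub>M\<^esub>" using V_nonzero by blast
  have y: "y \<in> idems S" using F_idem[OF assms(1)] .
  have "y = z \<otimes> (sinv S y \<otimes> y)" by (rule nat_le_dom[OF assms(3)])
  then have "y = z \<otimes> y" using y by simp
  then have "\<rho> z (\<rho> y v) = \<rho> y v" using rho_mult[of z y v] y assms(2) v(1) by simp
  then have "\<rho> z v = v" using F_fix[OF assms(1) v(1)] by simp
  then show ?thesis using mem_F[OF assms(2) v(1)] v(2) by simp
qed

lemma H_idem: "H \<in> idems (cd_semigroup S)"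
  unfolding H_def
proof (rule filter_up_closure_idem)
  show "F \<subseteq> idems S" "F \<noteq> {}" using F_idem x0_F by auto
  fix y z assume yz: "y \<in> F" "z \<in> F"
  note i = F_idem[OF yz(1)] F_idem[OF yz(2)]
  obtain v where v: "v \<in> V" "v \<noteq> \<zero>\<^bsub>M\<^esub>" using V_nonzero by blast
  have "\<rho> (y \<otimes> z) v = v"
    using rho_mult[of y z v] F_fix[OF yz(1) v(1)] F_fix[OF yz(2) v(1)] i v(1) by simp
  then show "y \<otimes> z \<in> F" using mem_F[OF idem_prod_idem[OF i] v(1)] v(2) by simp
qed

lemma H_mem_iff: "y \<in> idems S \<Longrightarrow> y \<in> H \<longleftrightarrow> y \<in> F"
  unfolding H_def by (rule filter_up_closure_mem[OF subsetI[OF F_idem] F_up])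

lemma mem_H: "y \<in> H \<longleftrightarrow> (\<exists>f \<in> F. nat_le S f y)"
  unfolding H_def up_closure_def by (auto dest: nat_leD(2))

lemma L_class_cd: "B \<in> L_class S H \<Longrightarrow> closed_directed S B"
  using L_class_carrier cd_carrier by blast

lemma L_class_mem [simp]: "\<lbrakk>B \<in> L_class S H; b \<in> B\<rbrakk> \<Longrightarrow> b \<in> carrier S"
  using cd_sub[OF L_class_cd] .

lemma L_class_dom_F:
  assumes B: "B \<in> L_class S H" and b: "b \<in> B" shows "sinv S b \<otimes> b \<in> F"
proof -
  have "sinv S b \<otimes> b \<in> B\<^sup>\<star> \<star> B"
    using b B by (intro mult_mem_cd_mult) (auto simp: sinv_cd[OF L_class_carrier] cd_sinv_image L_class_cd)
  then show ?thesis using L_class_dom[OF B] H_mem_iff[OF dom_idem] B b by simp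
qed

text \<open>If \<open>c \<le> b\<close> in \<open>B\<close>, then \<open>c = bq\<close> for the domain \<open>q\<close> of \<open>c\<close>. Here \<open>q\<close> lies in \<open>H\<close>, so it
  acts as the identity on \<open>V\<close>. So \<open>\<sigma> B\<close> below does not depend on the chosen element of \<open>B\<close>.\<close>

lemma L_class_act_eq:
  assumes B: "B \<in> L_class S H" and b: "b \<in> B" and b': "b' \<in> B" and v: "v \<in> V"
  shows "\<rho> b v = \<rho> b' v"
proof -
  obtain c where c: "c \<in> B" "nat_le S c b" "nat_le S c b'" using cd_dir[OF L_class_cd[OF B] b b'] by blast
  have "\<rho> c v = \<rho> a v" if "a \<in> B" "nat_le S c a" for a
  proof -
    have "\<rho> c v = \<rho> (a \<otimes> (sinv S c \<otimes> c)) v" using nat_le_dom[OF that(2)] by simp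
    then show ?thesis using rho_mult[of a "sinv S c \<otimes> c" v] F_fix[OF L_class_dom_F[OF B c(1)] v] B that c v by simp
  qed
  then show ?thesis using c b b' by metis
qed

definition "\<sigma> B v = \<rho> (SOME b. b \<in> B) v"

lemma sigma_eq:
  assumes "B \<in> L_class S H" "b \<in> B" "v \<in> V" shows "\<sigma> B v = \<rho> b v"
  unfolding \<sigma>_def using assms L_class_act_eq someI[of "\<lambda>b. b \<in> B" b] by blast

lemma L_class_ne: "B \<in> L_class S H \<Longrightarrow> \<exists>b. b \<in> B"
  using cd_ne[OF L_class_cd] .

text \<open>For \<open>a \<in> g\<close> the idempotent \<open>a\<inverse>x\<^sub>0a\<close> lies in \<open>g\<^sup>\<star> \<star> H \<star> g = H\<close> and so fixes \<open>v\<close>; therefore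
  \<open>x\<^sub>0\<close> fixes \<open>av\<close>.\<close>

lemma sigma_group_closed:
  assumes g: "g \<in> carrier (max_subgroup S H)" and v: "v \<in> V" shows "\<sigma> g v \<in> V"
proof -
  have gL: "g \<in> L_class S H" using max_subgroup_L_class[OF H_idem g] .
  obtain a where a: "a \<in> g" using L_class_ne[OF gL] by blast
  have ac[simp]: "a \<in> carrier S" using gL a by simp
  have gc: "g \<in> carrier (cd_semigroup S)" using L_class_carrier[OF gL] .
  have i: "sinv S a \<in> g\<^sup>\<star>" using a sinv_cd[OF gc] by blast
  have cg: "closed_directed S g" "closed_directed S (g\<^sup>\<star>)" "closed_directed S H"
    using gc cd.sinv_closed[OF gc] cd.idem_carrier[OF H_idem] by (simp_all add: cd_carrier)
  have "x0 \<in> H" using H_mem_iff[OF x0(1)] x0_F by simp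
  then have "sinv S a \<otimes> x0 \<otimes> a \<in> g\<^sup>\<star> \<star> H \<star> g" using a i cg by (intro mult_mem_cd_mult cd_mult_closed)
  moreover have "g\<^sup>\<star> \<star> H = g\<^sup>\<star>"
    using max_subgroup_unit(1)[OF H_idem max_subgroup_inv[OF H_idem g]] .
  ultimately have "sinv S a \<otimes> x0 \<otimes> a \<in> H" using g max_subgroup_iff[OF H_idem] by simp
  then have F: "sinv S a \<otimes> x0 \<otimes> a \<in> F" using H_mem_iff conj_idem'(1)[OF ac x0(1)] by blast
  have "\<rho> x0 (\<rho> a v) = \<rho> (x0 \<otimes> a) v" using v by (simp add: rho_mult)
  also have "\<dots> = \<rho> (a \<otimes> (sinv S a \<otimes> x0 \<otimes> a)) v" using conj_idem'(2)[OF ac x0(1)] by simp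
  also have "\<dots> = \<rho> a v" using rho_mult[of a "sinv S a \<otimes> x0 \<otimes> a" v] F_fix[OF F v] v by simp
  finally show ?thesis using sigma_eq[OF gL a v] v by (intro mem_V) simp_all
qed

lemma sigma_mult:
  assumes B: "B \<in> L_class S H" and g: "g \<in> carrier (max_subgroup S H)" and v: "v \<in> V"
  shows "\<sigma> (B \<star> g) v = \<sigma> B (\<sigma> g v)"
proof -
  have gL: "g \<in> L_class S H" using max_subgroup_L_class[OF H_idem g] .
  obtain a b where ab: "a \<in> g" "b \<in> B" using L_class_ne gL B by blast
  have "b \<otimes> a \<in> B \<star> g" using ab L_class_cd gL B by (intro mult_mem_cd_mult)
  then have "\<sigma> (B \<star> g) v = \<rho> (b \<otimes> a) v"
    using sigma_eq L_class_mult_subgroup(1)[OF H_idem B g] v by blast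
  also have "\<dots> = \<rho> b (\<rho> a v)" using rho_mult ab gL B v by simp
  also have "\<dots> = \<sigma> B (\<sigma> g v)"
    using sigma_eq[OF gL ab(1) v] sigma_eq[OF B ab(2) sigma_group_closed[OF g v]] by simp
  finally show ?thesis .
qed

lemma sigma_one: "v \<in> V \<Longrightarrow> \<sigma> H v = v"
  using sigma_eq[OF L_class_idem[OF H_idem], of x0 v] H_mem_iff[OF x0(1)] x0_F F_fix by simp

text \<open>An idempotent that does not kill some vector of \<open>V\<close> belongs to \<open>F\<close>. Tested on the vectors \<open>n\<close>
  and \<open>tn\<close>, this shows \<open>t\<inverse>Ft \<subseteq> F\<close> and \<open>tFt\<inverse> \<subseteq> F\<close>, so \<open>g = \<iota>(t) \<star> H\<close> satisfies
  \<open>g\<^sup>\<star> \<star> g = H = g \<star> g\<^sup>\<star>\<close>.\<close>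

lemma mem_max_subgroup:
  assumes t[simp]: "t \<in> carrier S" and n: "n \<in> V" and u: "\<rho> t n \<in> V" "\<rho> t n \<noteq> \<zero>\<^bsub>M\<^esub>"
  shows "\<exists>g \<in> carrier (max_subgroup S H). t \<in> g"
proof -
  have nM[simp]: "n \<in> carrier M" using n by simp
  have tt: "sinv S t \<otimes> t \<in> F" using mem_F[OF dom_idem n rho_nonzero_dom] t u by simp
  have c1: "sinv S t \<otimes> y \<otimes> t \<in> F" if y: "y \<in> F" for y
  proof -
    have [simp]: "y \<in> carrier S" using F_idem[OF y] by simp
    have "\<rho> (sinv S t \<otimes> y \<otimes> t) n = \<rho> (sinv S t) (\<rho> y (\<rho> t n))" by (simp add: rho_mult mult_assoc)
    also have "\<dots> = \<rho> (sinv S t \<otimes> t) n" using F_fix[OF y u(1)] by (simp add: rho_mult)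
    also have "\<dots> = n" using F_fix[OF tt n] .
    finally show ?thesis using mem_F[OF conj_idem'(1)[OF t F_idem[OF y]] n] u rho_zero[OF t] by auto
  qed
  have c2: "t \<otimes> y \<otimes> sinv S t \<in> F" if y: "y \<in> F" for y
  proof -
    have [simp]: "y \<in> carrier S" using F_idem[OF y] by simp
    have "\<rho> (t \<otimes> y \<otimes> sinv S t) (\<rho> t n) = \<rho> t (\<rho> y (\<rho> (sinv S t \<otimes> t) n))" by (simp add: rho_mult mult_assoc)
    also have "\<dots> = \<rho> t n" using F_fix[OF tt n] F_fix[OF y n] by simp
    finally show ?thesis using mem_F[OF conj_idem(1)[OF t F_idem[OF y]] u(1)] u(2) by simp
  qed
  define g where "g = iota S t \<star> H"
  have Hc[simp]: "H \<in> carrier (cd_semigroup S)" using H_idem by simp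
  have cH: "closed_directed S H" "closed_directed S (iota S t)" "closed_directed S (iota S (sinv S t))"
    using Hc iota_closed[of t] iota_closed[of "sinv S t"] by (simp_all add: cd_carrier del: iota_closed Hc)
  have gc[simp]: "g \<in> carrier (cd_semigroup S)" by (simp add: g_def)
  have qH: "iota S (sinv S t \<otimes> t) \<star> H = H"
    using iota_idem_absorb_iff[OF _ H_idem] H_mem_iff tt by simp
  have gi: "g\<^sup>\<star> = H \<star> iota S (sinv S t)"
    using H_idem by (simp add: g_def cd.sinv_mult sinv_iota)
  have "g\<^sup>\<star> \<star> g = H \<star> (iota S (sinv S t \<otimes> t) \<star> H)"
    unfolding gi by (simp add: g_def iota_mult cd.mult_assoc)
  then have 1: "g\<^sup>\<star> \<star> g = H" unfolding qH using H_idem by simp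
  have "g \<star> g\<^sup>\<star> = iota S t \<star> (H \<star> H) \<star> iota S (sinv S t)"
    unfolding gi by (simp add: g_def cd.mult_assoc)
  then have gg: "g \<star> g\<^sup>\<star> = g \<star> iota S (sinv S t)" using H_idem by (simp add: g_def)
  have "z \<in> H" if z: "z \<in> g \<star> iota S (sinv S t)" for z
  proof -
    obtain p r where pr: "p \<in> g" "nat_le S (sinv S t) r" "nat_le S (p \<otimes> r) z"
      using z mem_iotaD unfolding mem_cd_mult[of _ g] by blast
    obtain a h where ah: "nat_le S t a" "h \<in> H" "nat_le S (a \<otimes> h) p"
      using pr(1) mem_iotaD unfolding g_def mem_cd_mult[of _ "iota S t"] by blast
    obtain y where y: "y \<in> F" "nat_le S y h" using ah(2) mem_H by blast
    have "nat_le S (t \<otimes> y \<otimes> sinv S t) (p \<otimes> r)"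
      using nat_le_mult[OF nat_le_trans[OF nat_le_mult[OF ah(1) y(2)] ah(3)] pr(2)] .
    then show ?thesis using c2[OF y(1)] nat_le_trans[OF _ pr(3)] mem_H by blast
  qed
  moreover have "z \<in> g \<star> iota S (sinv S t)" if z: "z \<in> H" for z
  proof -
    obtain y where y: "y \<in> F" "nat_le S y z" using z mem_H by blast
    have yi: "y \<in> idems S" and [simp]: "y \<in> carrier S" using F_idem[OF y(1)] by auto
    let ?w = "sinv S t \<otimes> y \<otimes> t"
    have "?w \<in> H" using c1[OF y(1)] H_mem_iff conj_idem'(1)[OF t yi] by blast
    then have "t \<otimes> ?w \<in> g" unfolding g_def using cH self_mem_iota[OF t] by (intro mult_mem_cd_mult)
    then have "t \<otimes> ?w \<otimes> sinv S t \<in> g \<star> iota S (sinv S t)"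
      using cH self_mem_iota[of "sinv S t"] gc by (intro mult_mem_cd_mult) (simp_all add: cd_carrier del: gc)
    moreover have "t \<otimes> ?w \<otimes> sinv S t = y \<otimes> (t \<otimes> sinv S t)"
      using conj_idem'(2)[OF t yi] by (simp add: mult_assoc)
    moreover have "nat_le S (y \<otimes> (t \<otimes> sinv S t)) z"
      using nat_le_trans[OF mult_idem_le(1)[OF yi ran_idem[OF t]] y(2)] .
    moreover have "closed_directed S (g \<star> iota S (sinv S t))"
      using gc cH cd_mult_closed by (simp add: cd_carrier del: gc)
    ultimately show ?thesis using cd_up by metis
  qed
  ultimately have "g \<star> g\<^sup>\<star> = H" unfolding gg by blast
  then have "g \<in> carrier (max_subgroup S H)" using 1 by (simp add: max_subgroup_iff[OF H_idem])
  moreover have "t \<otimes> (sinv S t \<otimes> t) \<in> g"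
    unfolding g_def using cH self_mem_iota[OF t] tt H_mem_iff[OF dom_idem[OF t]] by (intro mult_mem_cd_mult) auto
  ultimately show ?thesis by auto
qed

text \<open>\<open>V\<close> as a module over the group algebra at \<open>H\<close>: a group element acts as any of the elements of
  \<open>S\<close> that it contains.\<close>

definition N :: "('k, 's set \<Rightarrow> 'k, 'v) amodule" where
  "N = with_act (M\<lparr>carrier := V\<rparr>) (\<lambda>f v. lift K M (\<lambda>B. \<sigma> B v) f)"

abbreviation "FG \<equiv> free_space K (carrier (max_subgroup S H))"

lemma N_simps:
  "carrier N = V" "zero N = zero M" "add N = add M" "smult N = smult M"
  "act N f v = lift K M (\<lambda>B. \<sigma> B v) f"
  by (simp_all add: N_def with_act_def)

lemma N_vectorspace: "vectorspace K N"
proof (rule vectorspace_cong)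
  show "vectorspace K (M\<lparr>carrier := V\<rparr>)"
    by (rule vectorspace.subspace_is_vs[OF M_vectorspace V_subspace])
qed (simp_all add: N_simps)

lemma hom_restrict: "h \<in> module_hom K M U \<Longrightarrow> h \<in> module_hom K N U"
  using module_homD[of h K M U] by (intro module_homI) (simp_all add: N_simps)

lemma hom_corestrict: "\<lbrakk>h \<in> module_hom K U M; \<And>u. u \<in> carrier U \<Longrightarrow> h u \<in> V\<rbrakk> \<Longrightarrow> h \<in> module_hom K U N"
  using module_homD[of h K U M] by (intro module_homI) (simp_all add: N_simps)

lemma sigma_hom:
  assumes B: "B \<in> L_class S H" shows "\<sigma> B \<in> module_hom K N M"
proof -
  obtain b where b: "b \<in> B" using L_class_ne[OF B] by blast
  show ?thesis
    by (rule module_hom_cong[OF N_vectorspace hom_restrict[OF rho_hom[OF L_class_mem[OF B b]]]])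
      (simp add: N_simps sigma_eq[OF B b])
qed

lemma sigma_closed: "\<lbrakk>B \<in> L_class S H; v \<in> V\<rbrakk> \<Longrightarrow> \<sigma> B v \<in> carrier M"
  using module_homD(1)[OF sigma_hom] by (simp add: N_simps)

lemma group_L_class: "g \<in> carrier (max_subgroup S H) \<Longrightarrow> g \<in> L_class S H"
  by (rule max_subgroup_L_class[OF H_idem])

lemma act_N_basis: "\<lbrakk>g \<in> carrier (max_subgroup S H); v \<in> V\<rbrakk> \<Longrightarrow> basis_vec K g \<rhd>\<^bsub>N\<^esub> v = \<sigma> g v"
  unfolding N_simps
  by (rule lift_basis_vec[OF K M_vectorspace]) (rule sigma_closed[OF group_L_class])

lemma N_bilinear: "bilinear K FG N N (act N)"
proof -
  have right: "(\<lambda>f. f \<rhd>\<^bsub>N\<^esub> v) \<in> module_hom K FG M" if v: "v \<in> V" for v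
    unfolding N_simps using sigma_closed[OF group_L_class v] by (rule lift_hom[OF K M_vectorspace])
  have closed: "f \<rhd>\<^bsub>N\<^esub> v \<in> V" if f: "f \<in> carrier FG" and v: "v \<in> V" for f v
    by (rule free_space_hom_subspace[OF K right[OF v] V_subspace _ f])
      (simp add: act_N_basis v sigma_group_closed)
  have left: "act N f \<in> module_hom K N M" if f: "f \<in> carrier FG" for f
  proof -
    have "(\<lambda>v. \<Oplus>\<^bsub>M\<^esub>B\<in>supp K f. f B \<odot>\<^bsub>M\<^esub> \<sigma> B v) \<in> module_hom K N M"
    proof (rule finsum_module_hom[OF N_vectorspace M_vectorspace])
      show "finite (supp K f)" using f by (simp add: free_space_simps)
      fix B assume "B \<in> supp K f"
      then show "(\<lambda>v. f B \<odot>\<^bsub>M\<^esub> \<sigma> B v) \<in> module_hom K N M"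
        using f by (intro module_hom_compose[OF sigma_hom[OF group_L_class] module_hom_smult[OF M_vectorspace]])
          (auto simp: free_space_simps)
    qed
    then show ?thesis by (rule module_hom_cong[OF N_vectorspace]) (simp add: N_simps lift_def)
  qed
  show ?thesis unfolding bilinear_def
  proof (intro conjI ballI)
    show "act N f \<in> module_hom K N N" if "f \<in> carrier FG" for f
      by (rule hom_corestrict[OF left[OF that]]) (simp add: closed that N_simps(1))
    show "(\<lambda>f. f \<rhd>\<^bsub>N\<^esub> v) \<in> module_hom K FG N" if "v \<in> carrier N" for v
      using that unfolding N_simps(1) by (intro hom_corestrict[OF right]) (simp_all add: closed)
  qed
qed

lemma N_module: "alg_module K (group_algebra_at K S H) N"
proof (rule alg_module_from_basis[OF K _ N_vectorspace N_bilinear subset_refl span_carrier[OF N_vectorspace]])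
  fix g h assume g: "g \<in> carrier (max_subgroup S H)" and h: "h \<in> carrier (max_subgroup S H)"
  note gh = max_subgroup_mult[OF H_idem g h]
  show "g \<otimes>\<^bsub>max_subgroup S H\<^esub> h \<in> carrier (max_subgroup S H)" unfolding max_subgroup_mult_eq by (rule gh)
  fix v assume "v \<in> carrier N"
  then have v: "v \<in> V" by (simp add: N_simps)
  show "basis_vec K (g \<otimes>\<^bsub>max_subgroup S H\<^esub> h) \<rhd>\<^bsub>N\<^esub> v = basis_vec K g \<rhd>\<^bsub>N\<^esub> (basis_vec K h \<rhd>\<^bsub>N\<^esub> v)"
    unfolding max_subgroup_mult_eq act_N_basis[OF gh v] act_N_basis[OF h v]
      act_N_basis[OF g sigma_group_closed[OF h v]]
    by (rule sigma_mult[OF group_L_class[OF g] h v])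
next
  fix v assume "v \<in> carrier N"
  then show "\<exists>g \<in> carrier (max_subgroup S H). \<exists>w \<in> carrier N. v = basis_vec K g \<rhd>\<^bsub>N\<^esub> w"
    using act_N_basis[OF max_subgroup_one[OF H_idem], of v] sigma_one[of v] max_subgroup_one[OF H_idem]
    by (metis N_simps(1))
qed

text \<open>A vector \<open>w \<in> W\<close> is moved by \<open>x\<^sub>0t\<close> either to zero or to a nonzero vector of \<open>V\<close>. In the second
  case \<open>x\<^sub>0t\<close> lies in a group element by \<open>mem_max_subgroup\<close>, so the image is in \<open>W\<close>. Hence the
  \<open>kS\<close>-submodule generated by \<open>w\<close>, which is \<open>M\<close>, meets \<open>V\<close> inside \<open>W\<close>.\<close>

lemma N_simple: "simple_alg_module K (group_algebra_at K S H) N"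
proof -
  obtain v where v: "v \<in> V" "v \<noteq> \<zero>\<^bsub>M\<^esub>" using V_nonzero by blast
  show ?thesis
  proof (rule simple_alg_moduleI[OF N_module, of v])
    show "v \<in> carrier N" "v \<noteq> \<zero>\<^bsub>N\<^esub>" using v by (simp_all add: N_simps)
    fix W w assume W: "alg_submodule K (group_algebra_at K S H) W N" and w: "w \<in> W" "w \<noteq> \<zero>\<^bsub>N\<^esub>"
    have sWN: "subspace K W N" using W by (simp add: alg_submodule_def)
    note WD = subspaceD(2-)[OF sWN, unfolded N_simps]
    have sW: "subspace K W M" using WD by (intro subspaceI[OF M_vectorspace]) auto
    have gW: "\<sigma> g u \<in> W" if "g \<in> carrier (max_subgroup S H)" "u \<in> W" for g u
    proof -
      have "basis_vec K g \<rhd>\<^bsub>N\<^esub> u \<in> W"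
        using W that basis_vec_in_free_space[OF K that(1)] by (auto simp: alg_submodule_def semigroup_algebra_simps)
      then show ?thesis using act_N_basis[OF that(1)] WD(1) that(2) by auto
    qed
    \<comment> \<open>The largest submodule of \<open>M\<close> whose image under \<open>x\<^sub>0\<close> lies in \<open>W\<close>.\<close>
    let ?P = "{m \<in> carrier M. \<forall>t \<in> carrier S. \<rho> x0 (\<rho> t m) \<in> W}"
    have sub1: "subspace K {m \<in> carrier M. \<rho> x0 (\<rho> t m) \<in> W} M" if "t \<in> carrier S" for t
      by (rule vimage_subspace[OF M_vectorspace module_hom_compose[OF rho_hom[OF that] rho_hom[OF x0_carrier]] sW])
    have "subspace K ?P M"
      using subspaceD(3-)[OF sub1] subspaceD(3-)[OF carrier_subspace[OF M_vectorspace]]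
      by (intro subspaceI[OF M_vectorspace]) auto
    then have subP: "alg_submodule K (semigroup_algebra K S) ?P M"
    proof (rule alg_submodule_from_basis[OF K M_module])
      fix s m assume s: "s \<in> carrier S" and m: "m \<in> ?P"
      have mM: "m \<in> carrier M" and mW: "\<forall>t \<in> carrier S. \<rho> x0 (\<rho> t m) \<in> W" using m by simp_all
      have "\<rho> x0 (\<rho> t (\<rho> s m)) \<in> W" if t: "t \<in> carrier S" for t
        using bspec[OF mW mult_closed[OF t s]] rho_mult[OF t s mM] by simp
      then show "basis_vec K s \<rhd>\<^bsub>M\<^esub> m \<in> ?P" using rho_closed[OF s mM] by (simp add: \<rho>_def)
    qed
    have wP: "w \<in> ?P"
    proof -
      have wV: "w \<in> V" using w(1) WD(1) by blast
      have "\<rho> x0 (\<rho> t w) \<in> W" if t: "t \<in> carrier S" for t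
      proof (cases "\<rho> x0 (\<rho> t w) = \<zero>\<^bsub>M\<^esub>")
        case True
        then show ?thesis using WD(2) by simp
      next
        case False
        have eq: "\<rho> (x0 \<otimes> t) w = \<rho> x0 (\<rho> t w)" using rho_mult t wV by simp
        have "\<rho> (x0 \<otimes> t) w \<in> V" unfolding eq using rho_fixed[OF x0(1)] t wV by simp
        then obtain g where g: "g \<in> carrier (max_subgroup S H)" "x0 \<otimes> t \<in> g"
          using mem_max_subgroup[of "x0 \<otimes> t" w] t wV False eq by auto
        have "\<rho> x0 (\<rho> t w) = \<sigma> g w" using sigma_eq[OF group_L_class[OF g(1)] g(2) wV] eq by simp
        then show ?thesis using gW[OF g(1) w(1)] by simp
      qed
      then show ?thesis using wV by simp
    qed
    have "?P \<noteq> {\<zero>\<^bsub>M\<^esub>}"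
    proof
      assume "?P = {\<zero>\<^bsub>M\<^esub>}"
      from wP[unfolded this] show False using w(2) by (simp add: N_simps(2))
    qed
    from simple_alg_moduleD(4)[OF M subP this] have P: "?P = carrier M" .
    show "carrier N \<subseteq> W"
    proof
      fix m assume "m \<in> carrier N"
      then have m: "m \<in> carrier M" "\<rho> x0 m = m" using V_fixed by (simp_all add: N_simps)
      have "m \<in> ?P" unfolding P by (rule m(1))
      then have "\<forall>t \<in> carrier S. \<rho> x0 (\<rho> t m) \<in> W" by simp
      from bspec[OF this x0_carrier] show "m \<in> W" unfolding m(2) .
    qed
  qed
qed

lemma N_fin_dim: "vectorspace.fin_dim K N"
proof (rule fin_dim_surj_image[OF M_vectorspace N_vectorspace _ _ fd])
  show "\<rho> x0 \<in> module_hom K M N"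
    using rho_fixed[OF x0(1)] by (intro hom_corestrict[OF rho_hom[OF x0_carrier]])
  show "\<rho> x0 ` carrier M = carrier N"
    unfolding N_simps(1)
  proof (intro equalityI subsetI)
    show "v \<in> V" if "v \<in> \<rho> x0 ` carrier M" for v using that rho_fixed[OF x0(1)] by auto
    show "v \<in> \<rho> x0 ` carrier M" if v: "v \<in> V" for v
      using imageI[OF V_carrier[OF v], of "\<rho> x0"] unfolding V_fixed[OF v] .
  qed
qed

sublocale ind: induced S K H N
  by (rule induced.intro[OF inverse_semigroup_axioms induced_axioms.intro[OF K H_idem N_module]])

text \<open>If \<open>s(bn) \<noteq> 0\<close> for \<open>b \<in> B\<close> and \<open>q\<close> is the domain of \<open>s\<close>, then \<open>b\<inverse>qb\<close> lies in \<open>F\<close>. So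
  \<open>qbb\<inverse> \<le> q\<close> puts \<open>q\<close> into \<open>B \<star> H \<star> B\<^sup>\<star> = B \<star> B\<^sup>\<star>\<close>. This matches the zeros of the
  Schuetzenberger action.\<close>

lemma act_outside_L_class:
  assumes s: "s \<in> carrier S" and B: "B \<in> L_class S H" and n: "n \<in> V" and out: "iota S s \<star> B \<notin> L_class S H"
  shows "\<rho> s (\<sigma> B n) = \<zero>\<^bsub>M\<^esub>"
proof (rule ccontr)
  assume ne: "\<rho> s (\<sigma> B n) \<noteq> \<zero>\<^bsub>M\<^esub>"
  obtain b where b: "b \<in> B" using L_class_ne[OF B] by blast
  have bc[simp]: "b \<in> carrier S" "s \<in> carrier S" "n \<in> carrier M" using B b s n by simp_all
  let ?q = "sinv S s \<otimes> s"
  have q: "?q \<in> idems S" by simp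
  have "\<rho> s (\<rho> b n) \<noteq> \<zero>\<^bsub>M\<^esub>" using ne sigma_eq[OF B b n] by simp
  then have "\<rho> (s \<otimes> b) n \<noteq> \<zero>\<^bsub>M\<^esub>" by (simp add: rho_mult)
  from rho_nonzero_dom[OF _ _ this] have "\<rho> (sinv S b \<otimes> ?q \<otimes> b) n \<noteq> \<zero>\<^bsub>M\<^esub>"
    by (simp add: sinv_mult mult_assoc)
  then have "sinv S b \<otimes> ?q \<otimes> b \<in> F" by (rule mem_F[OF conj_idem'(1)[OF bc(1) q] n])
  then have wH: "sinv S b \<otimes> ?q \<otimes> b \<in> H" using H_mem_iff[OF conj_idem'(1)[OF bc(1) q]] by blast
  have Bc: "B \<in> carrier (cd_semigroup S)" using L_class_carrier[OF B] .
  have c: "closed_directed S B" "closed_directed S H" "closed_directed S (B\<^sup>\<star>)"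
    using Bc cd.sinv_closed[OF Bc] cd.idem_carrier[OF H_idem] by (simp_all add: cd_carrier)
  have "b \<otimes> (sinv S b \<otimes> ?q \<otimes> b) \<in> B \<star> H" by (rule mult_mem_cd_mult[OF c(1,2) b wH])
  then have "?q \<otimes> b \<in> B" using L_class_unit[OF B] conj_idem'(2)[OF bc(1) q] by simp
  moreover have "sinv S b \<in> B\<^sup>\<star>" using b sinv_cd[OF Bc] by blast
  ultimately have "?q \<otimes> b \<otimes> sinv S b \<in> B \<star> B\<^sup>\<star>" by (intro mult_mem_cd_mult c)
  moreover have "nat_le S (?q \<otimes> b \<otimes> sinv S b) ?q"
    using nat_leI_right[of ?q "b \<otimes> sinv S b"] by (simp add: mult_assoc)
  ultimately have "?q \<in> B \<star> B\<^sup>\<star>" using cd_up[OF cd_idemD(1)[OF L_class_ran[OF B]]] by blast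
  then show False using iota_mult_L_class_iff[OF s B] out by blast
qed

text \<open>The family \<open>\<sigma>\<close> is balanced, so it defines \<open>h : Ind\<^sub>H(N) \<rightarrow> M\<close> with \<open>h(B \<otimes> n) = bn\<close> for
  \<open>b \<in> B\<close>. On generators \<open>h\<close> commutes with \<open>S\<close>: inside the \<open>\<L>\<close>-class because \<open>sb\<close> lies in
  \<open>\<iota>(s) \<star> B\<close>, outside because both sides vanish.\<close>

lemma induced_from_subgroup:
  shows "finite_index S H" "alg_module_isomorphic K (semigroup_algebra K S) M (Ind K S H N)"
proof -
  let ?A = "semigroup_algebra K S"
  have bal: "\<sigma> (B \<star> g) n = \<sigma> B (basis_vec K g \<rhd>\<^bsub>N\<^esub> n)"
    if "B \<in> L_class S H" "g \<in> carrier (max_subgroup S H)" "n \<in> carrier N" for B g n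
    using that sigma_mult act_N_basis by (simp add: N_simps(1))
  obtain h where h: "h \<in> module_hom K ind.I M"
    "\<And>B n. \<lbrakk>B \<in> L_class S H; n \<in> V\<rbrakk> \<Longrightarrow> h (ind.\<tau> B n) = \<sigma> B n"
    using ind.I_universal[OF M_vectorspace sigma_hom bal] unfolding N_simps(1) by blast
  have comm: "h (a \<rhd>\<^bsub>ind.I\<^esub> v) = a \<rhd>\<^bsub>M\<^esub> h v" if a: "a \<in> carrier ?A" and v: "v \<in> carrier ind.I" for a v
  proof (rule bilinear_eq_on_spans[OF free_space_vectorspace[OF K] ind.I_vectorspace M_vectorspace
        bilinear_compose_hom[OF ind.I_bilinear h(1)] bilinear_compose_right[OF M_bilinear h(1)]
        _ basis_vecs_span[OF K] _ ind.tau_span _ _ v])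
    show "basis_vec K ` carrier S \<subseteq> carrier (free_space K (carrier S))"
      by (intro image_subsetI basis_vec_in_free_space[OF K])
    show "{ind.\<tau> B n | B n. B \<in> L_class S H \<and> n \<in> carrier N} \<subseteq> carrier ind.I"
      using ind.tau_closed by blast
    show "a \<in> carrier (free_space K (carrier S))" using a by (simp only: semigroup_algebra_simps)
    fix x y assume "x \<in> basis_vec K ` carrier S" "y \<in> {ind.\<tau> B n | B n. B \<in> L_class S H \<and> n \<in> carrier N}"
    then obtain s B n where x: "x = basis_vec K s" "s \<in> carrier S"
      and y: "y = ind.\<tau> B n" "B \<in> L_class S H" "n \<in> V" by (auto simp: N_simps(1))
    have nN: "n \<in> carrier N" using y by (simp add: N_simps(1))
    show "h (x \<rhd>\<^bsub>ind.I\<^esub> y) = x \<rhd>\<^bsub>M\<^esub> h y"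
    proof (cases "iota S s \<star> B \<in> L_class S H")
      case True
      obtain b where b: "b \<in> B" using L_class_ne[OF y(2)] by blast
      have "s \<otimes> b \<in> iota S s \<star> B"
        using b self_mem_iota[OF x(2)] L_class_cd[OF y(2)] iota_closed[OF x(2)] cd_carrier
        by (intro mult_mem_cd_mult) auto
      then have "\<sigma> (iota S s \<star> B) n = \<rho> (s \<otimes> b) n" by (rule sigma_eq[OF True _ y(3)])
      also have "\<dots> = \<rho> s (\<sigma> B n)"
        using rho_mult[OF x(2) L_class_mem[OF y(2) b]] sigma_eq[OF y(2) b y(3)] y(3) by simp
      finally show ?thesis
        using ind.act_tau[OF x(2) y(2) nN] h(2) True y x(1) by (simp add: \<rho>_def)
    next
      case False
      then show ?thesis
        using ind.act_tau[OF x(2) y(2) nN] h(2) y x(1) act_outside_L_class[OF x(2) y(2,3)]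
          module_hom_zero[OF ind.I_vectorspace M_vectorspace h(1)] by (simp add: \<rho>_def)
    qed
  qed
  have HL: "H \<in> L_class S H" using L_class_idem[OF H_idem] .
  obtain n where n: "n \<in> V" "n \<noteq> \<zero>\<^bsub>M\<^esub>" using V_nonzero by blast
  then have nN: "n \<in> carrier N" "n \<noteq> \<zero>\<^bsub>N\<^esub>" by (simp_all add: N_simps)
  have "h (ind.\<tau> H n) \<noteq> \<zero>\<^bsub>M\<^esub>" using h(2)[OF HL n(1)] sigma_one[OF n(1)] n(2) by simp
  from simple_hom_isomorphic[OF M ind.Ind_simple[OF N_simple] h(1) comm ind.tau_closed[OF HL nN(1)] this]
  obtain g where g: "g \<in> module_hom K M ind.I" "bij_betw g (carrier M) (carrier ind.I)"
    "\<forall>a \<in> carrier ?A. \<forall>v \<in> carrier M. g (a \<rhd>\<^bsub>M\<^esub> v) = a \<rhd>\<^bsub>ind.I\<^esub> g v" by blast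
  then show "alg_module_isomorphic K ?A M ind.I" unfolding alg_module_isomorphic_def by blast
  have "vectorspace.fin_dim K ind.I"
    by (rule fin_dim_surj_image[OF M_vectorspace ind.I_vectorspace g(1) bij_betw_imp_surj_on[OF g(2)] fd])
  then show "finite_index S H" by (rule ind.finite_index_if_fin_dim[OF _ nN])
qed

end


theorem theorem4p6:
  fixes K :: "('k, 'c) ring_scheme"
    and S :: "('s, 'm) monoid_scheme"
  assumes "field K"
    and "inverse_semigroup S"
  shows "(\<forall>e (N :: ('k, 's set \<Rightarrow> 'k, 'n) amodule).
            e \<in> idems (cd_semigroup S) \<and> finite_index S e \<and>
            simple_alg_module K (group_algebra_at K S e) N \<and> vectorspace.fin_dim K N \<longrightarrow>
            simple_alg_module K (semigroup_algebra K S) (Ind K S e N) \<and>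
            vectorspace.fin_dim K (Ind K S e N))
       \<and> (\<forall>M :: ('k, 's \<Rightarrow> 'k, 'v) amodule.
            simple_alg_module K (semigroup_algebra K S) M \<and> vectorspace.fin_dim K M \<longrightarrow>
            (\<exists>e (N :: ('k, 's set \<Rightarrow> 'k, 'v) amodule).
               e \<in> idems (cd_semigroup S) \<and> finite_index S e \<and>
               simple_alg_module K (group_algebra_at K S e) N \<and> vectorspace.fin_dim K N \<and>
               alg_module_isomorphic K (semigroup_algebra K S) M (Ind K S e N)))"
proof (intro conjI allI impI)
  fix e and N :: "('k, 's set \<Rightarrow> 'k, 'n) amodule"
  assume *: "e \<in> idems (cd_semigroup S) \<and> finite_index S e \<and>
    simple_alg_module K (group_algebra_at K S e) N \<and> vectorspace.fin_dim K N"
  then interpret induced S K e N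
    using assms by (intro induced.intro induced_axioms.intro) (auto dest: simple_alg_moduleD(1))
  show "simple_alg_module K (semigroup_algebra K S) (Ind K S e N)"
    using * by (intro Ind_simple) blast
  show "vectorspace.fin_dim K (Ind K S e N)" using * by (intro Ind_fin_dim) blast+
next
  fix M :: "('k, 's \<Rightarrow> 'k, 'v) amodule"
  assume *: "simple_alg_module K (semigroup_algebra K S) M \<and> vectorspace.fin_dim K M"
  then interpret simple_fd S K M
    using assms by (intro simple_fd.intro simple_fd_axioms.intro) auto
  show "\<exists>e (N :: ('k, 's set \<Rightarrow> 'k, 'v) amodule).
      e \<in> idems (cd_semigroup S) \<and> finite_index S e \<and>
      simple_alg_module K (group_algebra_at K S e) N \<and> vectorspace.fin_dim K N \<and>
      alg_module_isomorphic K (semigroup_algebra K S) M (Ind K S e N)"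
    using H_idem N_simple N_fin_dim induced_from_subgroup by blast
qed

end
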